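(* Let $I=[0,1]$ with Lebesgue measure $m$, and let $T:I\to I$ be an $m$-computable map (i.e. $\delta$ a.e.-computable with respect to $m$) which is piecewise expanding in the following sense: there is a finite partition $\{I_1,\dots,I_k\}$ of $I$ into disjoint intervals such that (1) the restriction of $T$ to each $I_i$ can be extended to a $C^1$ monotonic map defined on $\overline{I_i}$, and the function $h(x)=|DT(x)|^{-1}$ has bounded variation on $I$; (2) there are constants $C>0$ and $\sigma>1$ such that $|DT^n(x)|>C\sigma^n$ for every $n\ge1$ and every $x\in I$ for which the derivative is defined; (3) for each interval $J\subset I$ of positive length there is $n\ge1$ such that $T^n(J)=I$. Then the SRB measure of $T$, i.e. its unique ergodic absolutely continuous invariant probability measure, is computable.
   Context: Computability on $\mathbb N$ refers to (partial) recursive functions; an algorithm between effectively numbered countable sets is a map induced by a partial recursive function on numbers. "Uniformly in $i$" means a single algorithm takes $i$ as an additional input. $I=[0,1]$ is regarded as a metric space with ideal points $S=\mathbb Q\cap[0,1]$ (with standard numbering). Ideal balls are the balls $B(s,q)$ in $I$ with $s\in S$, $q\in\mathbb Q_{>0}$, effectively numbered as $B_0,B_1,\dots$. An open set $U\subseteq I$ is constructive if it is the union of the ideal balls enumerated by some (possibly partial) algorithm. A constructive $G_\delta$-set is an intersection of a sequence of uniformly constructive open sets. $T$ is $\delta$ a.e.-computable with respect to $m$ if there are a constructive $G_\delta$-set $E\subseteq I$ with $m(E)=1$ and uniformly constructive open sets $U_i$ such that $T^{-1}(B_i)\cap E=U_i\cap E$ for all $i$. A Borel probability measure $\mu$ on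 $I$ is computable if there is an algorithm producing probability measures $\mu_n$, each supported on finitely many points of $S$ with rational weights, with $\rho(\mu_n,\mu)\le2^{-n}$ for all $n$, where $\rho(\mu,\nu)=\inf\{\epsilon>0:\mu(A)\le\nu(A^\epsilon)+\epsilon\text{ for every Borel }A\}$ is the Prokhorov metric ($A^\epsilon=\{x:d(x,A)<\epsilon\}$). It is a known fact, taken as given, that a map satisfying (1)–(3) has a unique ergodic absolutely continuous invariant probability measure $\mu$, that its density with respect to $m$ has bounded variation, and that the basin of $\mu$ has full Lebesgue measure. *)

theory Defs
  imports "HOL-Probability.Probability"
begin

section \<open>Partial recursive functions\<close>

text \<open>
  Kleene's schemes.  Arities are left implicit in the syntax: a term is run on a list of
  arguments, and \<open>recf_eval f xs = None\<close> means that \<open>f\<close> is undefined at \<open>xs\<close>.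
\<close>

datatype recf =
    Zero
  | Succ
  | Proj nat
  | Comp recf "recf list"
  | PrimRec recf recf
  | Minimize recf

fun recf_eval :: "recf \<Rightarrow> nat list \<Rightarrow> nat option" where
  "recf_eval Zero xs = Some 0"
| "recf_eval Succ xs = (case xs of [] \<Rightarrow> None | x # _ \<Rightarrow> Some (Suc x))"
| "recf_eval (Proj i) xs = (if i < length xs then Some (xs ! i) else None)"
| "recf_eval (Comp f gs) xs =
     Option.bind (those (map (\<lambda>g. recf_eval g xs) gs)) (\<lambda>ys. recf_eval f ys)"
| "recf_eval (PrimRec f g) xs =
     (case xs of
        [] \<Rightarrow> None
      | n # ys \<Rightarrow>
          rec_nat (recf_eval f ys)
            (\<lambda>m r. Option.bind r (\<lambda>y. recf_eval g (m # y # ys))) n)"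
| "recf_eval (Minimize f) xs =
     (if \<exists>n. recf_eval f (n # xs) = Some 0 \<and> (\<forall>m<n. recf_eval f (m # xs) \<noteq> None)
      then Some (LEAST n. recf_eval f (n # xs) = Some 0)
      else None)"

definition partial_recursive :: "nat \<Rightarrow> (nat list \<Rightarrow> nat option) \<Rightarrow> bool" where
  "partial_recursive k \<phi> \<longleftrightarrow> (\<exists>f. \<forall>xs. length xs = k \<longrightarrow> \<phi> xs = recf_eval f xs)"


section \<open>The unit interval as a computable metric space\<close>

text \<open>Numberings (with repetitions) of the rationals in \<open>[0,1]\<close> and of the positive rationals.\<close>

definition ideal_point :: "nat \<Rightarrow> real" where
  "ideal_point n = (case prod_decode n of (a, b) \<Rightarrow> real (a mod (b + 2)) / real (b + 1))"

definition pos_rational :: "nat \<Rightarrow> real" where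
  "pos_rational n = (case prod_decode n of (a, b) \<Rightarrow> real (a + 1) / real (b + 1))"

definition ideal_ball :: "nat \<Rightarrow> real set" where
  "ideal_ball k =
     (case prod_decode k of (i, j) \<Rightarrow> {x \<in> {0..1}. dist (ideal_point i) x < pos_rational j})"

definition uniformly_constructive_open :: "(nat \<Rightarrow> real set) \<Rightarrow> bool" where
  "uniformly_constructive_open U \<longleftrightarrow>
     (\<exists>\<phi>. partial_recursive 2 \<phi> \<and>
          (\<forall>i. U i = \<Union> {ideal_ball k | k. \<exists>n. \<phi> [i, n] = Some k}))"

definition constructive_G_delta :: "real set \<Rightarrow> bool" where
  "constructive_G_delta E \<longleftrightarrow>
     (\<exists>V. uniformly_constructive_open V \<and> E = (\<Inter>i. V i))"

abbreviation borel_I :: "real measure" where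
  "borel_I \<equiv> restrict_space borel {0..1}"

abbreviation lebesgue_I :: "real measure" where
  "lebesgue_I \<equiv> restrict_space lborel {0..1}"

definition ae_computable :: "real measure \<Rightarrow> (real \<Rightarrow> real) \<Rightarrow> bool" where
  "ae_computable m T \<longleftrightarrow>
     (\<exists>E U. constructive_G_delta E \<and> emeasure m E = 1 \<and> uniformly_constructive_open U \<and>
            (\<forall>i. T -` ideal_ball i \<inter> E = U i \<inter> E))"


section \<open>Computable measures\<close>

text \<open>
  A number codes a list of pairs (number of an ideal point, positive rational weight); it denotes
  a probability measure provided that the weights sum to 1, i.e. \<open>pmf_of_list_wf\<close> holds.  The
  list may repeat a point, in which case its weights are added up.
\<close>

definition weighted_points :: "nat \<Rightarrow> (nat \<times> real) list" where
  "weighted_points c =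
     map (\<lambda>k. case prod_decode k of (i, w) \<Rightarrow> (i, pos_rational w)) (list_decode c)"

definition ideal_measure :: "nat \<Rightarrow> real measure" where
  "ideal_measure c = distr (measure_pmf (pmf_of_list (weighted_points c))) borel_I ideal_point"

text \<open>
  The neighbourhood of \<open>A\<close> is not written with \<open>infdist\<close> or \<open>setdist\<close>, because these return 0
  for the empty set, whose neighbourhoods have to be empty.
\<close>

definition prokhorov :: "real measure \<Rightarrow> real measure \<Rightarrow> real" where
  "prokhorov \<mu> \<nu> =
     Inf {\<epsilon>. 0 < \<epsilon> \<and>
             (\<forall>A \<in> sets borel_I.
                measure \<mu> A \<le> measure \<nu> {x \<in> {0..1}. \<exists>a\<in>A. dist x a < \<epsilon>} + \<epsilon>)}"

definition borel_prob_I :: "real measure \<Rightarrow> bool" where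
  "borel_prob_I \<mu> \<longleftrightarrow> prob_space \<mu> \<and> sets \<mu> = sets borel_I"

definition computable_measure :: "real measure \<Rightarrow> bool" where
  "computable_measure \<mu> \<longleftrightarrow>
     borel_prob_I \<mu> \<and>
     (\<exists>\<phi>. partial_recursive 1 \<phi> \<and>
          (\<forall>n. \<exists>c. \<phi> [n] = Some c \<and> pmf_of_list_wf (weighted_points c) \<and>
                   prokhorov (ideal_measure c) \<mu> \<le> 1 / 2 ^ n))"


section \<open>Piecewise expanding maps\<close>

text \<open>
  A self-map of \<open>[0,1]\<close> is represented by a function on the reals of which only the values on
  \<open>[0,1]\<close> matter; so derivatives are taken within \<open>[0,1]\<close> (one-sided at 0 and 1).
\<close>

abbreviation differentiable_I :: "(real \<Rightarrow> real) \<Rightarrow> real \<Rightarrow> bool" where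
  "differentiable_I f x \<equiv> f differentiable (at x within {0..1})"

abbreviation deriv_I :: "(real \<Rightarrow> real) \<Rightarrow> real \<Rightarrow> real" where
  "deriv_I f x \<equiv> vector_derivative f (at x within {0..1})"

definition bounded_variation_on :: "real set \<Rightarrow> (real \<Rightarrow> real) \<Rightarrow> bool" where
  "bounded_variation_on A h \<longleftrightarrow>
     (\<exists>B. \<forall>(n::nat) x. (\<forall>i\<le>n. x i \<in> A) \<and> (\<forall>i<n. x i \<le> x (Suc i)) \<longrightarrow>
            (\<Sum>i<n. \<bar>h (x (Suc i)) - h (x i)\<bar>) \<le> B)"

definition C1_monotone_on :: "real set \<Rightarrow> (real \<Rightarrow> real) \<Rightarrow> bool" where
  "C1_monotone_on A g \<longleftrightarrow>
     (\<exists>g'. (\<forall>x\<in>A. (g has_real_derivative g' x) (at x within A)) \<and> continuous_on A g') \<and>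
     (mono_on A g \<or> antimono_on A g)"

text \<open>
  In the first condition, \<open>DT\<close> may be undefined at the finitely many end points of the pieces, so
  the variation of \<open>1/|DT|\<close> is taken over the points where \<open>T\<close> is differentiable; whether it is
  finite does not depend on values assigned at finitely many further points.
\<close>

definition piecewise_expanding :: "(real \<Rightarrow> real) \<Rightarrow> bool" where
  "piecewise_expanding T \<longleftrightarrow>
     (\<exists>P. finite P \<and> partition_on {0..1} P \<and> (\<forall>J\<in>P. is_interval J) \<and>
          (\<forall>J\<in>P. \<exists>g. (\<forall>x\<in>J. g x = T x) \<and> C1_monotone_on (closure J) g) \<and>
          bounded_variation_on {x \<in> {0..1}. differentiable_I T x} (\<lambda>x. inverse \<bar>deriv_I T x\<bar>)) \<and>
     (\<exists>C \<sigma>. 0 < C \<and> 1 < \<sigma> \<and>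
            (\<forall>n\<ge>1. \<forall>x\<in>{0..1}. differentiable_I (T ^^ n) x \<longrightarrow>
               C * \<sigma> ^ n < \<bar>deriv_I (T ^^ n) x\<bar>)) \<and>
     (\<forall>J. is_interval J \<and> J \<subseteq> {0..1} \<and> 0 < emeasure lborel J \<longrightarrow>
          (\<exists>n\<ge>1. (T ^^ n) ` J = {0..1}))"


section \<open>The SRB measure\<close>

definition invariant_measure :: "(real \<Rightarrow> real) \<Rightarrow> real measure \<Rightarrow> bool" where
  "invariant_measure T \<mu> \<longleftrightarrow> T \<in> measurable \<mu> \<mu> \<and> distr \<mu> \<mu> T = \<mu>"

definition ergodic_measure :: "(real \<Rightarrow> real) \<Rightarrow> real measure \<Rightarrow> bool" where
  "ergodic_measure T \<mu> \<longleftrightarrow>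
     invariant_measure T \<mu> \<and>
     (\<forall>A\<in>sets \<mu>. T -` A \<inter> space \<mu> = A \<longrightarrow> emeasure \<mu> A = 0 \<or> emeasure \<mu> A = 1)"

definition ergodic_acip :: "(real \<Rightarrow> real) \<Rightarrow> real measure \<Rightarrow> bool" where
  "ergodic_acip T \<mu> \<longleftrightarrow>
     borel_prob_I \<mu> \<and> ergodic_measure T \<mu> \<and> absolutely_continuous lebesgue_I \<mu>"

definition SRB_measure :: "(real \<Rightarrow> real) \<Rightarrow> real measure \<Rightarrow> bool" where
  "SRB_measure T \<mu> \<longleftrightarrow> ergodic_acip T \<mu> \<and> (\<forall>\<nu>. ergodic_acip T \<nu> \<longrightarrow> \<nu> = \<mu>)"

end

theory Submission
  imports Defs
begin

text \<open>
  Let \<open>S\<close> be an iterate of \<open>T\<close> with \<open>|DS| \<ge> 16\<close>.  Once the monotonicity intervals of \<open>S\<close> are cut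
  so finely that \<open>1/|DS|\<close> varies little on each of them, the transfer operator \<open>P\<close> of \<open>S\<close> satisfies
  the Lasota-Yorke inequality \<open>var (P f) \<le> var f / 2 + B \<integral>f\<close> for \<open>f \<ge> 0\<close>.  A probability density of
  variation at most \<open>V\<close> is at least \<open>1/2\<close> on some cell of a grid that depends only on \<open>V\<close>, and for
  some \<open>k\<close> the map \<open>S\<^sup>k\<close> sends every cell onto \<open>I\<close>; so \<open>P\<^sup>k f\<close> is bounded below by a constant
  (a Doeblin condition).  Therefore the images under \<open>S\<^sup>k\<^sup>n\<close> of any two measures with such densities
  approach each other exponentially fast in total variation.  As densities of bounded variation are
  dense in \<open>L\<^sup>1\<close> and \<open>\<mu>\<close> is invariant and absolutely continuous, there is a \<open>q\<close> such that
  \<open>\<bar>\<mu>(A) - m(T\<^sup>-\<^sup>q\<^sup>n A)\<bar> \<le> 2\<^sup>-\<^sup>n\<close> for all \<open>n\<close> and \<open>A\<close>.  The number \<open>q\<close> is built into the algorithm.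

  Up to a null set, the preimage of an ideal ball under \<open>T\<^sup>N\<close> is a union of ideal balls that can be
  enumerated uniformly in \<open>N\<close>, so its Lebesgue measure can be approximated from below.  To
  approximate \<open>m \<circ> T\<^sup>-\<^sup>N\<close>, the algorithm searches for weights of the centres of the cells of a grid
  that exceed the masses of the cells by little.  Since the weights add up to 1, these one-sided
  bounds suffice.
\<close>

section \<open>Recursive functions and semidecidable predicates\<close>

text \<open>Absolute continuity of \<open>\<mu>\<close> by itself gives neither a rate nor a bound
  on the variation of a density. Invariance removes both obstacles: a rough approximating density is
  first iterated until its variation is below a fixed \<open>V\<close>, and these extra iterates do
  not change \<open>\<mu>\<close>. Hence the rate \<open>\<theta> ^ n\<close> carries no prefactor,
  and the single number \<open>q\<close> captures it.

  The branches of \<open>S\<close> need not be onto. Therefore the weight \<open>1/|DS|\<close> is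
  set to 0 at the break points, which charges the jump at each end of a branch to the variation of
  the weight. With weights at most 1/16, the oscillation inside a branch and its two end jumps cost
  at most 1/4; the product rule adds 1/16 for the variation of \<open>f\<close>, and 1/4 + 1/16 <
  1/2. This is the origin of the constant 16.

  The Prokhorov condition bounds the discrete measure from above only. An upper bound on each weight
  by a mass plus a small error is provable from lower approximations of the mass, and the search
  halts because rounded masses, normalized, pass this test.\<close>

text \<open>Environments assign values to all variables, and a program reads an initial segment that is
  long enough.  Hence no arities have to be tracked, and binding a variable shifts the others.\<close>

definition rec_fun :: "((nat \<Rightarrow> nat) \<Rightarrow> nat) \<Rightarrow> bool" where
  "rec_fun F \<longleftrightarrow> (\<exists>r K. \<forall>k\<ge>K. \<forall>e. recf_eval r (map e [0..<k]) = Some (F e))"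

definition dec :: "((nat \<Rightarrow> nat) \<Rightarrow> bool) \<Rightarrow> bool" where
  "dec P \<longleftrightarrow> rec_fun (\<lambda>e. of_bool (P e))"

text \<open>One unbounded quantifier over a decidable matrix, the normal form of a semidecidable
  predicate. The witness is variable 0 of the matrix, and the free variables move up by one.\<close>

definition sig1 :: "((nat \<Rightarrow> nat) \<Rightarrow> bool) \<Rightarrow> bool" where
  "sig1 P \<longleftrightarrow> (\<exists>Q. dec (\<lambda>e. Q (e 0) (\<lambda>i. e (Suc i))) \<and> (\<forall>e. P e \<longleftrightarrow> (\<exists>t. Q t e)))"

section \<open>Total recursive functions: substitution, recursion, arithmetic\<close>

lemma map_case_nat_upt: "map (case_nat m e) [0..<Suc k] = m # map e [0..<k]"
  by (simp add: upt_conv_Cons flip: map_Suc_upt del: upt_Suc)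

lemma those_map_Some: "(\<And>x. x \<in> set xs \<Longrightarrow> f x = Some (g x)) \<Longrightarrow> those (map f xs) = Some (map g xs)"
  by (induction xs) auto

lemma those_map_Proj:
  assumes "K \<le> k"
  shows "those (map (\<lambda>g. recf_eval g (map e [0..<k])) (map Proj [0..<K])) = Some (map e [0..<K])"
  unfolding map_map comp_def using assms by (intro those_map_Some) auto

text \<open>The program for \<open>F\<close> can be run on the first \<open>K\<close> values only.
  So although a whole sequence of functions is substituted, finitely many programs enter the
  composition and the bound \<open>M\<close> exists.\<close>

lemma rec_fun_subst:
  assumes F: "rec_fun F" and G: "\<And>i. rec_fun (G i)"
  shows "rec_fun (\<lambda>e. F (\<lambda>i. G i e))"
proof -
  obtain r K where r: "\<And>k e. k \<ge> K \<Longrightarrow> recf_eval r (map e [0..<k]) = Some (F e)"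
    using F unfolding rec_fun_def by blast
  obtain s L where s: "\<And>i k e. k \<ge> L i \<Longrightarrow> recf_eval (s i) (map e [0..<k]) = Some (G i e)"
    using G unfolding rec_fun_def by metis
  define M where "M = Max (insert 0 (L ` {..<K}))"
  have "recf_eval (Comp r (map s [0..<K])) (map e [0..<k]) = Some (F (\<lambda>i. G i e))"
    if "k \<ge> M" for k e
  proof -
    have "L i \<le> k" if "i < K" for i
      using \<open>k \<ge> M\<close> that by (auto simp: M_def)
    then have "those (map (\<lambda>g. recf_eval g (map e [0..<k])) (map s [0..<K]))
      = Some (map (\<lambda>i. G i e) [0..<K])"
      unfolding map_map comp_def by (intro those_map_Some) (auto intro!: s)
    then show ?thesis
      using r[of K "\<lambda>i. G i e"] by simp
  qed
  then show ?thesis unfolding rec_fun_def by blast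
qed

lemma rec_fun_var [intro!]: "rec_fun (\<lambda>e. e i)"
proof -
  have "recf_eval (Proj i) (map e [0..<k]) = Some (e i)" if "k \<ge> Suc i" for k and e :: "nat \<Rightarrow> nat"
    using that by simp
  then show ?thesis unfolding rec_fun_def by blast
qed

text \<open>Reduces closure under an operation to that operation on plain variables, for which a
  program is given once.\<close>

lemma rec_fun_subst1:
  assumes "rec_fun (\<lambda>e. h (e 0))" "rec_fun f"
  shows "rec_fun (\<lambda>e. h (f e))"
  using rec_fun_subst[OF assms(1), of "\<lambda>_. f"] assms(2) by simp

lemma rec_fun_subst2:
  assumes "rec_fun (\<lambda>e. h (e 0) (e (Suc 0)))" "rec_fun f" "rec_fun g"
  shows "rec_fun (\<lambda>e. h (f e) (g e))"
  using rec_fun_subst[OF assms(1), of "\<lambda>i. if i = 0 then f else g"] assms(2,3) by simp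

lemma rec_fun_rename: "rec_fun F \<Longrightarrow> rec_fun (\<lambda>e. F (\<lambda>i. e (p i)))"
  by (rule rec_fun_subst[where G = "\<lambda>i e. e (p i)"]) auto

lemma rec_fun_Suc: "rec_fun f \<Longrightarrow> rec_fun (\<lambda>e. Suc (f e))"
proof (rule rec_fun_subst1[where h = Suc])
  have "recf_eval Succ (map e [0..<k]) = Some (Suc (e 0))" if "k \<ge> 1" for k and e :: "nat \<Rightarrow> nat"
    using that by (cases k) (auto simp del: upt_Suc simp: upt_conv_Cons)
  then show "rec_fun (\<lambda>e. Suc (e 0))" unfolding rec_fun_def by blast
qed

lemma rec_fun_const [intro!]: "rec_fun (\<lambda>e. c)"
proof (induction c)
  case 0
  have "recf_eval Zero xs = Some 0" for xs by simp
  then show ?case unfolding rec_fun_def by blast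
next
  case (Suc c)
  then show ?case by (rule rec_fun_Suc)
qed

text \<open>\<open>PrimRec\<close> prepends the counter and the previous value to the parameters;
  this is the shift by two in the hypothesis on \<open>s\<close>. The projections cut the
  environment to a fixed length \<open>K\<close> that is long enough for base and step.\<close>

lemma rec_fun_rec_nat:
  assumes b: "rec_fun b" and s: "rec_fun (\<lambda>e. s (e 0) (e (Suc 0)) (\<lambda>i. e (Suc (Suc i))))"
    and n: "rec_fun n"
  shows "rec_fun (\<lambda>e. rec_nat (b e) (\<lambda>m r. s m r e) (n e))"
proof -
  obtain rb Kb where rb: "\<And>k e. k \<ge> Kb \<Longrightarrow> recf_eval rb (map e [0..<k]) = Some (b e)"
    using b unfolding rec_fun_def by blast
  obtain rn Kn where rn: "\<And>k e. k \<ge> Kn \<Longrightarrow> recf_eval rn (map e [0..<k]) = Some (n e)"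
    using n unfolding rec_fun_def by blast
  obtain rs Ks where rs: "\<And>k e. k \<ge> Ks \<Longrightarrow> recf_eval rs (map e [0..<k]) =
      Some (s (e 0) (e (Suc 0)) (\<lambda>i. e (Suc (Suc i))))"
    using s unfolding rec_fun_def by blast
  define K where "K = Kb + Kn + Ks"
  have step: "recf_eval rs (m # y # map e [0..<K]) = Some (s m y e)" for m y e
  proof -
    have "m # y # map e [0..<K] = map (case_nat m (case_nat y e)) [0..<Suc (Suc K)]"
      by (simp only: map_case_nat_upt)
    then show ?thesis by (simp only:) (subst rs, auto simp: K_def)
  qed
  have loop: "rec_nat (recf_eval rb (map e [0..<K]))
      (\<lambda>m r. Option.bind r (\<lambda>y. recf_eval rs (m # y # map e [0..<K]))) N
    = Some (rec_nat (b e) (\<lambda>m r. s m r e) N)" for N e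
  proof (induction N)
    case 0
    then show ?case using rb[of K e] by (simp add: K_def)
  next
    case (Suc N)
    then show ?case using step by simp
  qed
  have "recf_eval (Comp (PrimRec rb rs) (rn # map Proj [0..<K])) (map e [0..<k])
      = Some (rec_nat (b e) (\<lambda>m r. s m r e) (n e))" if "k \<ge> K" for k e
  proof -
    have "those (map (\<lambda>g. recf_eval g (map e [0..<k])) (rn # map Proj [0..<K]))
       = Some (n e # map e [0..<K])"
      using those_map_Proj[OF that, of e] rn[of k e] that by (simp add: K_def comp_def)
    then show ?thesis using loop by simp
  qed
  then show ?thesis unfolding rec_fun_def by blast
qed

lemma rec_fun_add: "rec_fun f \<Longrightarrow> rec_fun g \<Longrightarrow> rec_fun (\<lambda>e. f e + g e)"
proof (rule rec_fun_subst2[where h = "(+)"])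
  have "rec_nat a (\<lambda>_ r. Suc r) b = a + b" for a b :: nat by (induction b) auto
  moreover have "rec_fun (\<lambda>e. rec_nat (e 0) (\<lambda>_ r. Suc r) (e (Suc 0)))"
    by (intro rec_fun_rec_nat rec_fun_Suc rec_fun_var)
  ultimately show "rec_fun (\<lambda>e. e 0 + e (Suc 0))" by simp
qed

lemma rec_fun_mult: "rec_fun f \<Longrightarrow> rec_fun g \<Longrightarrow> rec_fun (\<lambda>e. f e * g e)"
proof (rule rec_fun_subst2[where h = "(*)"])
  have "rec_nat 0 (\<lambda>_ r. r + a) b = a * b" for a b :: nat by (induction b) auto
  moreover have "rec_fun (\<lambda>e. rec_nat 0 (\<lambda>_ r. r + e 0) (e (Suc 0)))"
    by (intro rec_fun_rec_nat rec_fun_add rec_fun_var rec_fun_const)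
  ultimately show "rec_fun (\<lambda>e. e 0 * e (Suc 0))" by simp
qed

lemma rec_fun_power: "rec_fun f \<Longrightarrow> rec_fun g \<Longrightarrow> rec_fun (\<lambda>e. f e ^ g e)"
proof (rule rec_fun_subst2[where h = "(^)"])
  have "rec_nat 1 (\<lambda>_ r. a * r) b = a ^ b" for a b :: nat by (induction b) auto
  moreover have "rec_fun (\<lambda>e. rec_nat 1 (\<lambda>_ r. e 0 * r) (e (Suc 0)))"
    by (intro rec_fun_rec_nat rec_fun_mult rec_fun_var rec_fun_const)
  ultimately show "rec_fun (\<lambda>e. e 0 ^ e (Suc 0))" by simp
qed

lemma rec_fun_diff: "rec_fun f \<Longrightarrow> rec_fun g \<Longrightarrow> rec_fun (\<lambda>e. f e - g e)"
proof (rule rec_fun_subst2[where h = "(-)"])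
  \<comment> \<open>The predecessor: the recursion returns its counter, which lags one
    behind.\<close>
  have p: "rec_nat 0 (\<lambda>m _. m) b = b - 1" for b :: nat by (induction b) auto
  have "rec_fun (\<lambda>e. rec_nat 0 (\<lambda>m _. m) (e 0))"
    by (intro rec_fun_rec_nat rec_fun_var rec_fun_const)
  then have *: "rec_fun (\<lambda>e. e 0 - 1)" unfolding p .
  have "rec_nat a (\<lambda>_ r. r - 1) b = a - b" for a b :: nat by (induction b) auto
  moreover have "rec_fun (\<lambda>e. rec_nat (e 0) (\<lambda>_ r. r - 1) (e (Suc 0)))"
    by (intro rec_fun_rec_nat rec_fun_subst1[OF *] rec_fun_var rec_fun_const)
  ultimately show "rec_fun (\<lambda>e. e 0 - e (Suc 0))" by simp
qed

lemma rec_fun_sum: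
  assumes "rec_fun (\<lambda>e. F (e 0) (\<lambda>i. e (Suc i)))" "rec_fun n"
  shows "rec_fun (\<lambda>e. \<Sum>i<n e. F i e)"
proof -
  have "rec_nat 0 (\<lambda>i r. r + F i e) N = (\<Sum>i<N. F i e)" for N e
    by (induction N) auto
  moreover have "rec_fun (\<lambda>e. rec_nat 0 (\<lambda>i r. r + F i e) (n e))"
    using rec_fun_rename[OF assms(1), of "\<lambda>i. case i of 0 \<Rightarrow> 0 | Suc j \<Rightarrow> Suc (Suc j)"]
    by (intro rec_fun_rec_nat rec_fun_add rec_fun_var rec_fun_const assms(2)) simp
  ultimately show ?thesis by simp
qed

section \<open>Decidable predicates\<close>

lemma dec_not: "dec P \<Longrightarrow> dec (\<lambda>e. \<not> P e)"
proof -
  assume "dec P"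
  have "(of_bool (\<not> P e) :: nat) = 1 - of_bool (P e)" for e by simp
  with \<open>dec P\<close> show ?thesis unfolding dec_def
    by (simp only:) (intro rec_fun_diff rec_fun_const)
qed

lemma dec_conj: "dec P \<Longrightarrow> dec Q \<Longrightarrow> dec (\<lambda>e. P e \<and> Q e)"
  using rec_fun_mult[of "\<lambda>e. of_bool (P e)" "\<lambda>e. of_bool (Q e)"]
  unfolding dec_def of_bool_conj by simp

lemma dec_disj: "dec P \<Longrightarrow> dec Q \<Longrightarrow> dec (\<lambda>e. P e \<or> Q e)"
  using dec_not[OF dec_conj[OF dec_not dec_not, of P Q]] by simp

lemma dec_imp: "dec P \<Longrightarrow> dec Q \<Longrightarrow> dec (\<lambda>e. P e \<longrightarrow> Q e)"
  unfolding imp_conv_disj by (intro dec_disj dec_not)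

lemma dec_le:
  assumes "rec_fun f" "rec_fun g"
  shows "dec (\<lambda>e. f e \<le> g e)"
proof -
  have "(of_bool (f e \<le> g e) :: nat) = 1 - (f e - g e)" for e
    by (cases "f e \<le> g e") auto
  then show ?thesis unfolding dec_def
    by (simp only:) (intro rec_fun_diff rec_fun_const assms)
qed

lemma dec_less: "rec_fun f \<Longrightarrow> rec_fun g \<Longrightarrow> dec (\<lambda>e. f e < g e)"
  using dec_not[OF dec_le[of g f]] by (simp add: not_le)

lemma dec_eq:
  assumes "rec_fun f" "rec_fun g"
  shows "dec (\<lambda>e. f e = g e)"
proof -
  have "(f e = g e) = (f e \<le> g e \<and> g e \<le> f e)" for e by (rule order.eq_iff)
  moreover have "dec (\<lambda>e. f e \<le> g e \<and> g e \<le> f e)"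
    by (intro dec_conj dec_le assms)
  ultimately show ?thesis by presburger
qed

lemma rec_fun_if:
  assumes "dec P" "rec_fun f" "rec_fun g"
  shows "rec_fun (\<lambda>e. if P e then f e else g e)"
proof -
  have "(if P e then f e else g e) = of_bool (P e) * f e + of_bool (\<not> P e) * g e" for e
    by simp
  then show ?thesis
    using assms dec_not[OF assms(1)] unfolding dec_def
    by (simp only:) (intro rec_fun_add rec_fun_mult)
qed

lemma dec_bex:
  assumes "dec (\<lambda>e. P (e 0) (\<lambda>i. e (Suc i)))" "rec_fun n"
  shows "dec (\<lambda>e. \<exists>i<n e. P i e)"
proof -
  have "(\<exists>i<n e. P i e) \<longleftrightarrow> 0 < (\<Sum>i<n e. (of_bool (P i e) :: nat))" for e
    by (auto simp flip: neq0_conv)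
  then show ?thesis
    using assms unfolding dec_def[of "\<lambda>e. P (e 0) (\<lambda>i. e (Suc i))"]
    by (simp only:) (intro dec_less rec_fun_const rec_fun_sum)
qed

lemma dec_ball:
  assumes "dec (\<lambda>e. P (e 0) (\<lambda>i. e (Suc i)))" "rec_fun n"
  shows "dec (\<lambda>e. \<forall>i<n e. P i e)"
  using dec_not[OF dec_bex[OF dec_not[OF assms(1)] assms(2)]] by simp

lemma dec_subst: "dec P \<Longrightarrow> (\<And>i. rec_fun (G i)) \<Longrightarrow> dec (\<lambda>e. P (\<lambda>i. G i e))"
  unfolding dec_def by (rule rec_fun_subst)

lemma dec_rename: "dec P \<Longrightarrow> dec (\<lambda>e. P (\<lambda>i. e (p i)))"
  unfolding dec_def by (rule rec_fun_rename)

section \<open>Pairing, remainders and coded sequences\<close>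

lemma rec_fun_triangle: "rec_fun f \<Longrightarrow> rec_fun (\<lambda>e. triangle (f e))"
proof (rule rec_fun_subst1[where h = triangle])
  have "rec_nat 0 (\<lambda>m r. r + Suc m) b = triangle b" for b :: nat by (induction b) auto
  moreover have "rec_fun (\<lambda>e. rec_nat 0 (\<lambda>m r. r + Suc m) (e 0))"
    by (intro rec_fun_rec_nat rec_fun_add rec_fun_Suc rec_fun_var rec_fun_const)
  ultimately show "rec_fun (\<lambda>e. triangle (e 0))" by simp
qed

lemma rec_fun_prod_encode: "rec_fun f \<Longrightarrow> rec_fun g \<Longrightarrow> rec_fun (\<lambda>e. prod_encode (f e, g e))"
  unfolding prod_encode_def by (simp, intro rec_fun_add rec_fun_triangle)

text \<open>The sum has at most one nonzero term, so bounded search needs no minimization.\<close>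

lemma rec_fun_bounded_the:
  assumes "dec (\<lambda>e. P (e 0) (\<lambda>i. e (Suc i)))" "rec_fun n"
    and "\<And>e. f e < n e" "\<And>e y. P y e \<longleftrightarrow> y = f e"
  shows "rec_fun f"
proof -
  have "(\<Sum>i<n e. (if P i e then i else 0)) = f e" for e
    using assms(3)[of e] by (simp add: assms(4))
  moreover have "rec_fun (\<lambda>e. \<Sum>i<n e. (if P i e then i else 0))"
    by (intro rec_fun_sum rec_fun_if rec_fun_var rec_fun_const assms(1,2))
  ultimately show ?thesis by simp
qed

lemma rec_fun_fst: "rec_fun f \<Longrightarrow> rec_fun (\<lambda>e. fst (prod_decode (f e)))"
proof (rule rec_fun_subst1[where h = "\<lambda>x. fst (prod_decode x)"])
  have *: "a < Suc x" "b < Suc x" if "prod_encode (a, b) = x" for a b x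
    using that le_prod_encode_1[of a b] le_prod_encode_2[of b a] by auto
  show "rec_fun (\<lambda>e. fst (prod_decode (e 0)))"
  proof (rule rec_fun_bounded_the)
    show "dec (\<lambda>e. \<exists>b<Suc (e (Suc 0)). prod_encode (e 0, b) = e (Suc 0))"
      by (intro dec_bex dec_eq rec_fun_prod_encode rec_fun_var rec_fun_Suc)
    show "rec_fun (\<lambda>e. Suc (e 0))" by (intro rec_fun_var rec_fun_Suc)
    show "fst (prod_decode (e 0)) < Suc (e 0)" for e :: "nat \<Rightarrow> nat"
      by (rule *(1)[of _ "snd (prod_decode (e 0))"]) simp
    show "(\<exists>b<Suc (e 0). prod_encode (y, b) = e 0) \<longleftrightarrow> y = fst (prod_decode (e 0))" for e :: "nat \<Rightarrow> nat" and y
    proof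
      assume "y = fst (prod_decode (e 0))"
      then have "prod_encode (y, snd (prod_decode (e 0))) = e 0" by simp
      then show "\<exists>b<Suc (e 0). prod_encode (y, b) = e 0" using * by blast
    next
      assume "\<exists>b<Suc (e 0). prod_encode (y, b) = e 0"
      then obtain b where "prod_encode (y, b) = e 0" by blast
      then have "prod_decode (e 0) = (y, b)" using prod_encode_inverse[of "(y, b)"] by simp
      then show "y = fst (prod_decode (e 0))" by simp
    qed
  qed
qed

lemma rec_fun_snd: "rec_fun f \<Longrightarrow> rec_fun (\<lambda>e. snd (prod_decode (f e)))"
proof (rule rec_fun_subst1[where h = "\<lambda>x. snd (prod_decode x)"])
  have *: "b < Suc x" if "prod_encode (a, b) = x" for a b x
    using that le_prod_encode_2[of b a] by auto
  show "rec_fun (\<lambda>e. snd (prod_decode (e 0)))"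
  proof (rule rec_fun_bounded_the)
    show "dec (\<lambda>e. prod_encode (fst (prod_decode (e (Suc 0))), e 0) = e (Suc 0))"
      by (intro dec_eq rec_fun_prod_encode rec_fun_fst rec_fun_var)
    show "rec_fun (\<lambda>e. Suc (e 0))" by (intro rec_fun_var rec_fun_Suc)
    show "snd (prod_decode (e 0)) < Suc (e 0)" for e :: "nat \<Rightarrow> nat"
      by (rule *[of "fst (prod_decode (e 0))"]) simp
    show "prod_encode (fst (prod_decode (e 0)), y) = e 0 \<longleftrightarrow> y = snd (prod_decode (e 0))"
      for e :: "nat \<Rightarrow> nat" and y
    proof
      assume "prod_encode (fst (prod_decode (e 0)), y) = e 0"
      then have "prod_decode (e 0) = (fst (prod_decode (e 0)), y)"
        using prod_encode_inverse[of "(fst (prod_decode (e 0)), y)"] by simp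
      then show "y = snd (prod_decode (e 0))" by (metis snd_conv)
    qed simp
  qed
qed

lemma rec_fun_mod:
  assumes "rec_fun f" "rec_fun g"
  shows "rec_fun (\<lambda>e. f e mod Suc (g e))"
proof -
  have "rec_fun (\<lambda>e. e 0 mod Suc (e (Suc 0)))"
  proof (rule rec_fun_bounded_the)
    show "dec (\<lambda>e. e 0 < Suc (e (Suc (Suc 0))) \<and>
        (\<exists>q<Suc (e (Suc 0)). q * Suc (e (Suc (Suc 0))) + e 0 = e (Suc 0)))"
      by (intro dec_conj dec_bex dec_eq dec_less rec_fun_add rec_fun_mult rec_fun_Suc rec_fun_var)
    show "rec_fun (\<lambda>e. Suc (e (Suc 0)))" by (intro rec_fun_var rec_fun_Suc)
    show "(y < Suc (e (Suc 0)) \<and> (\<exists>q<Suc (e 0). q * Suc (e (Suc 0)) + y = e 0)) \<longleftrightarrow>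
        y = e 0 mod Suc (e (Suc 0))" for e :: "nat \<Rightarrow> nat" and y
    proof (intro iffI conjI)
      assume y: "y = e 0 mod Suc (e (Suc 0))"
      have "e 0 div Suc (e (Suc 0)) < Suc (e 0)"
        by (simp add: le_imp_less_Suc)
      moreover have "e 0 div Suc (e (Suc 0)) * Suc (e (Suc 0)) + y = e 0"
        unfolding y by (rule div_mult_mod_eq)
      ultimately show "\<exists>q<Suc (e 0). q * Suc (e (Suc 0)) + y = e 0" by blast
      show "y < Suc (e (Suc 0))" unfolding y by simp
    next
      assume "y < Suc (e (Suc 0)) \<and> (\<exists>q<Suc (e 0). q * Suc (e (Suc 0)) + y = e 0)"
      then obtain q where q: "y < Suc (e (Suc 0))" "q * Suc (e (Suc 0)) + y = e 0" by blast
      have "(q * Suc (e (Suc 0)) + y) mod Suc (e (Suc 0)) = y"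
        by (simp only: mod_mult_self3 mod_less[OF q(1)])
      then show "y = e 0 mod Suc (e (Suc 0))" unfolding q(2) by simp
    qed
  qed simp
  from rec_fun_subst2[OF this assms] show ?thesis .
qed

text \<open>Every number codes an infinite sequence: read it as a pair, output the first component,
  continue with the second. No length is stored, so access is total, and every finite list is an
  initial segment of a coded sequence.\<close>

definition seq_nth :: "nat \<Rightarrow> nat \<Rightarrow> nat" where
  "seq_nth p j = fst (prod_decode (((\<lambda>x. snd (prod_decode x)) ^^ j) p))"

lemma seq_nth_cons_0: "seq_nth (prod_encode (x, p)) 0 = x"
  by (simp add: seq_nth_def)

lemma seq_nth_cons_Suc: "seq_nth (prod_encode (x, p)) (Suc j) = seq_nth p j"
  unfolding seq_nth_def funpow_Suc_right comp_def prod_encode_inverse snd_conv ..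

lemma seq_nth_surj: "\<exists>p. \<forall>j<n. seq_nth p j = f j"
proof (induction n arbitrary: f)
  case (Suc n)
  obtain p where p: "\<forall>j<n. seq_nth p j = f (Suc j)" using Suc[of "\<lambda>j. f (Suc j)"] by (elim exE)
  have "seq_nth (prod_encode (f 0, p)) j = f j" if "j < Suc n" for j
  proof (cases j)
    case 0
    show ?thesis unfolding 0 by (rule seq_nth_cons_0)
  next
    case (Suc i)
    with p that have "seq_nth p i = f (Suc i)" by blast
    then show ?thesis unfolding Suc seq_nth_cons_Suc .
  qed
  then show ?case by (intro exI[of _ "prod_encode (f 0, p)"]) simp
qed simp

lemma rec_fun_seq_nth: "rec_fun f \<Longrightarrow> rec_fun g \<Longrightarrow> rec_fun (\<lambda>e. seq_nth (f e) (g e))"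
proof (rule rec_fun_subst2[where h = seq_nth])
  have "rec_nat p (\<lambda>_ r. snd (prod_decode r)) j = ((\<lambda>x. snd (prod_decode x)) ^^ j) p" for p j :: nat
    by (induction j) auto
  moreover have "rec_fun (\<lambda>e. fst (prod_decode (rec_nat (e 0) (\<lambda>_ r. snd (prod_decode r)) (e (Suc 0)))))"
    by (intro rec_fun_fst rec_fun_rec_nat rec_fun_snd rec_fun_var)
  ultimately show "rec_fun (\<lambda>e. seq_nth (e 0) (e (Suc 0)))" by (simp add: seq_nth_def)
qed

section \<open>Semidecidable predicates\<close>

lemma sig1_dec: "dec P \<Longrightarrow> sig1 P"
  unfolding sig1_def
  by (rule exI[where x = "\<lambda>t. P"]) (use dec_rename[of P Suc] in simp)

lemma sig1_subst:
  assumes "sig1 P" "\<And>i. rec_fun (G i)"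
  shows "sig1 (\<lambda>e. P (\<lambda>i. G i e))"
proof -
  obtain Q where Q: "dec (\<lambda>e. Q (e 0) (\<lambda>i. e (Suc i)))" "\<And>e. P e \<longleftrightarrow> (\<exists>t. Q t e)"
    using assms(1) unfolding sig1_def by blast
  let ?G = "\<lambda>i e. case i of 0 \<Rightarrow> e 0 | Suc j \<Rightarrow> G j (\<lambda>i. e (Suc i))"
  have "rec_fun (?G i)" for i
    by (cases i) (auto intro: rec_fun_rename assms(2))
  from dec_subst[where G = ?G, OF Q(1) this]
  have "dec (\<lambda>e. Q (e 0) (\<lambda>i. G i (\<lambda>i. e (Suc i))))" by simp
  then show ?thesis unfolding sig1_def Q(2)
    by (intro exI[where x = "\<lambda>t e. Q t (\<lambda>i. G i e)"]) simp
qed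

lemma sig1_rename: "sig1 P \<Longrightarrow> sig1 (\<lambda>e. P (\<lambda>i. e (p i)))"
  by (rule sig1_subst) auto

lemma sig1_conj:
  assumes "sig1 P" "sig1 Q"
  shows "sig1 (\<lambda>e. P e \<and> Q e)"
proof -
  obtain P' where P: "dec (\<lambda>e. P' (e 0) (\<lambda>i. e (Suc i)))" "\<And>e. P e \<longleftrightarrow> (\<exists>t. P' t e)"
    using assms(1) unfolding sig1_def by blast
  obtain Q' where Q: "dec (\<lambda>e. Q' (e 0) (\<lambda>i. e (Suc i)))" "\<And>e. Q e \<longleftrightarrow> (\<exists>t. Q' t e)"
    using assms(2) unfolding sig1_def by blast
  let ?F = "\<lambda>i e. case i of 0 \<Rightarrow> fst (prod_decode (e 0)) | Suc j \<Rightarrow> e (Suc j)"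
  let ?S = "\<lambda>i e. case i of 0 \<Rightarrow> snd (prod_decode (e 0)) | Suc j \<Rightarrow> e (Suc j)"
  have 1: "rec_fun (?F i)" for i
    by (cases i) (auto intro: rec_fun_fst)
  have 2: "rec_fun (?S i)" for i
    by (cases i) (auto intro: rec_fun_snd)
  have "dec (\<lambda>e. P' (fst (prod_decode (e 0))) (\<lambda>i. e (Suc i)) \<and> Q' (snd (prod_decode (e 0))) (\<lambda>i. e (Suc i)))"
    using dec_conj[OF dec_subst[where G = ?F, OF P(1) 1] dec_subst[where G = ?S, OF Q(1) 2]] by simp
  moreover have "P e \<and> Q e \<longleftrightarrow> (\<exists>t. P' (fst (prod_decode t)) e \<and> Q' (snd (prod_decode t)) e)" for e
  proof
    assume "P e \<and> Q e"
    then obtain t u where "P' t e" "Q' u e" unfolding P Q by blast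
    then show "\<exists>t. P' (fst (prod_decode t)) e \<and> Q' (snd (prod_decode t)) e"
      by (intro exI[of _ "prod_encode (t, u)"]) simp
  qed (auto simp: P Q)
  ultimately show ?thesis unfolding sig1_def
    by (intro exI[where x = "\<lambda>t e. P' (fst (prod_decode t)) e \<and> Q' (snd (prod_decode t)) e"]) simp
qed

lemma sig1_ex:
  assumes "sig1 (\<lambda>e. P (e 0) (\<lambda>i. e (Suc i)))"
  shows "sig1 (\<lambda>e. \<exists>y. P y e)"
proof -
  obtain Q where Q: "dec (\<lambda>e. Q (e 0) (\<lambda>i. e (Suc i)))"
      "\<And>e. P (e 0) (\<lambda>i. e (Suc i)) \<longleftrightarrow> (\<exists>t. Q t e)"
    using assms unfolding sig1_def by blast
  have P: "P y e \<longleftrightarrow> (\<exists>t. Q t (case_nat y e))" for y e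
    using Q(2)[of "case_nat y e"] by simp
  define G where "G = (\<lambda>i e. case i of 0 \<Rightarrow> fst (prod_decode (e 0)) 
        | Suc j \<Rightarrow> (case j of 0 \<Rightarrow> snd (prod_decode (e 0)) | Suc l \<Rightarrow> e (Suc l :: nat)))"
  have G: "rec_fun (G i)" for i
  proof (cases i)
    case 0
    then show ?thesis by (auto simp: G_def intro: rec_fun_fst)
  next
    case (Suc j)
    then show ?thesis by (cases j) (auto simp: G_def intro: rec_fun_snd)
  qed
  have "(\<lambda>i. G (Suc i) e) = case_nat (snd (prod_decode (e 0))) (\<lambda>i. e (Suc i))" for e
    by (auto simp: G_def fun_eq_iff split: nat.split)
  with dec_subst[where G = G, OF Q(1) G]
  have "dec (\<lambda>e. Q (fst (prod_decode (e 0))) (case_nat (snd (prod_decode (e 0))) (\<lambda>i. e (Suc i))))"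
    by (simp add: G_def)
  moreover have "(\<exists>y. P y e) \<longleftrightarrow> (\<exists>t. Q (fst (prod_decode t)) (case_nat (snd (prod_decode t)) e))" for e
  proof
    assume "\<exists>y. P y e"
    then obtain y t where "Q t (case_nat y e)" unfolding P by blast
    then show "\<exists>t. Q (fst (prod_decode t)) (case_nat (snd (prod_decode t)) e)"
      by (intro exI[of _ "prod_encode (t, y)"]) simp
  qed (auto simp: P)
  ultimately show ?thesis unfolding sig1_def
    by (intro exI[where x = "\<lambda>t e. Q (fst (prod_decode t)) (case_nat (snd (prod_decode t)) e)"]) simp
qed

text \<open>Finitely many witnesses have a common bound \<open>b\<close>. It becomes the single
  witness and leaves a bounded quantifier over the individual ones.\<close>

lemma sig1_ball:
  assumes "sig1 (\<lambda>e. P (e 0) (\<lambda>i. e (Suc i)))" "rec_fun n"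
  shows "sig1 (\<lambda>e. \<forall>j<n e. P j e)"
proof -
  obtain Q where Q: "dec (\<lambda>e. Q (e 0) (\<lambda>i. e (Suc i)))"
      "\<And>e. P (e 0) (\<lambda>i. e (Suc i)) \<longleftrightarrow> (\<exists>t. Q t e)"
    using assms unfolding sig1_def by blast
  have P: "P y e \<longleftrightarrow> (\<exists>t. Q t (case_nat y e))" for y e
    using Q(2)[of "case_nat y e"] by simp
  \<comment> \<open>Below the two bounded quantifiers variable 0 is the witness \<open>t\<close>, 1
    the index \<open>j\<close> and 2 the bound \<open>b\<close>; \<open>Q\<close> must skip variable
    2.\<close>
  define p where "p = (\<lambda>i. case i of 0 \<Rightarrow> 0 | Suc j \<Rightarrow> (case j of 0 \<Rightarrow> Suc 0 | Suc l \<Rightarrow> Suc (Suc (Suc l))))"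
  have "(\<lambda>i. e (p (Suc i))) = case_nat (e (Suc 0)) (\<lambda>i. e (Suc (Suc (Suc i))))" for e :: "nat \<Rightarrow> nat"
    by (auto simp: p_def fun_eq_iff split: nat.split)
  with dec_rename[OF Q(1), of p]
  have "dec (\<lambda>e. Q (e 0) (case_nat (e (Suc 0)) (\<lambda>i. e (Suc (Suc (Suc i))))))"
    by (simp add: p_def)
  then have "dec (\<lambda>e. \<forall>j<n (\<lambda>i. e (Suc i)). \<exists>t<e 0. Q t (case_nat j (\<lambda>i. e (Suc i))))"
    by (intro dec_ball dec_bex rec_fun_var rec_fun_rename[OF assms(2)])
  moreover have "(\<forall>j<n e. P j e) \<longleftrightarrow> (\<exists>b. \<forall>j<n e. \<exists>t<b. Q t (case_nat j e))" for e
  proof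
    assume "\<forall>j<n e. P j e"
    then obtain t where t: "\<And>j. j < n e \<Longrightarrow> Q (t j) (case_nat j e)" unfolding P by metis
    have "t j < Suc (\<Sum>j<n e. t j)" if "j < n e" for j
      using that by (simp add: le_imp_less_Suc member_le_sum)
    then show "\<exists>b. \<forall>j<n e. \<exists>t<b. Q t (case_nat j e)" using t by blast
  qed (auto simp: P)
  ultimately show ?thesis unfolding sig1_def
    by (intro exI[where x = "\<lambda>b e. \<forall>j<n e. \<exists>t<b. Q t (case_nat j e)"]) simp
qed

lemma sig1_imp:
  assumes "dec P" "sig1 Q"
  shows "sig1 (\<lambda>e. P e \<longrightarrow> Q e)"
proof -
  obtain Q' where Q: "dec (\<lambda>e. Q' (e 0) (\<lambda>i. e (Suc i)))" "\<And>e. Q e \<longleftrightarrow> (\<exists>t. Q' t e)"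
    using assms(2) unfolding sig1_def by blast
  have "dec (\<lambda>e. P (\<lambda>i. e (Suc i)) \<longrightarrow> Q' (e 0) (\<lambda>i. e (Suc i)))"
    by (intro dec_imp Q dec_rename[OF assms(1)])
  then show ?thesis unfolding sig1_def Q(2)
    by (intro exI[where x = "\<lambda>t e. P e \<longrightarrow> Q' t e"]) simp
qed

section \<open>Graphs of partial recursive functions\<close>

lemma map_upt_Suc_conv: "map e [0..<Suc n] = e 0 # map (\<lambda>i. e (Suc i)) [0..<n]"
  by (simp add: upt_conv_Cons flip: map_Suc_upt del: upt_Suc)

text \<open>Induction over \<open>gs\<close> replaces the quantifier over the list \<open>ys\<close>
  by one numerical quantifier for each program; the values found become the first variables of the
  environment.\<close>

lemma sig1_those:
  assumes "\<And>g. g \<in> set gs \<Longrightarrow> sig1 (\<lambda>e. recf_eval g (map (\<lambda>i. e (Suc i)) [0..<k]) = Some (e 0))"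
    and "sig1 (\<lambda>e. P (map e [0..<length gs]) (\<lambda>i. e (length gs + i)))"
  shows "sig1 (\<lambda>e. \<exists>ys. those (map (\<lambda>g. recf_eval g (map e [0..<k])) gs) = Some ys \<and> P ys e)"
  using assms
proof (induction gs arbitrary: P)
  case Nil
  then show ?case by simp
next
  case (Cons g gs)
  let ?n = "length gs"
  have 1: "sig1 (\<lambda>e. recf_eval g (map (\<lambda>i. e (Suc i)) [0..<k]) = Some (e 0))"
    using Cons.prems by simp
  have "sig1 (\<lambda>e. \<exists>y. recf_eval g (map (\<lambda>i. e (?n + i)) [0..<k]) = Some y \<and>
      P (y # map e [0..<?n]) (\<lambda>i. e (?n + i)))"
  proof (intro sig1_ex sig1_conj)
    show "sig1 (\<lambda>e. recf_eval g (map (\<lambda>i. e (Suc (?n + i))) [0..<k]) = Some (e 0))"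
      using sig1_rename[OF 1, of "\<lambda>i. case i of 0 \<Rightarrow> 0 | Suc j \<Rightarrow> Suc (?n + j)"] by simp
    have *: "map e [0..<Suc ?n] = e 0 # map (\<lambda>i. e (Suc i)) [0..<?n]" for e :: "nat \<Rightarrow> nat"
      by (rule map_upt_Suc_conv)
    show "sig1 (\<lambda>e. P (e 0 # map (\<lambda>i. e (Suc i)) [0..<?n]) (\<lambda>i. e (Suc (?n + i))))"
      using Cons.prems(2) unfolding length_Cons * by simp
  qed
  from Cons.IH[OF _ this] Cons.prems(1)
  have "sig1 (\<lambda>e. \<exists>ys. those (map (\<lambda>g. recf_eval g (map e [0..<k])) gs) = Some ys \<and>
      (\<exists>y. recf_eval g (map e [0..<k]) = Some y \<and> P (y # ys) e))" by simp
  moreover have "(\<exists>ys. those (map (\<lambda>g. recf_eval g (map e [0..<k])) gs) = Some ys \<and>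
      (\<exists>y. recf_eval g (map e [0..<k]) = Some y \<and> P (y # ys) e)) \<longleftrightarrow>
     (\<exists>ys. those (map (\<lambda>g. recf_eval g (map e [0..<k])) (g # gs)) = Some ys \<and> P ys e)" for e
    by (auto split: option.split)
  ultimately show ?case by simp
qed

text \<open>The coded sequence \<open>p\<close> is the history of the computation. In this form a
  recursion with partial steps takes one unbounded and one bounded quantifier.\<close>

lemma rec_nat_bind_eq_Some:
  "rec_nat b (\<lambda>m r. Option.bind r (\<lambda>y. g m y)) n = Some y \<longleftrightarrow>
    (\<exists>p. b = Some (seq_nth p 0) \<and> (\<forall>m<n. g m (seq_nth p m) = Some (seq_nth p (Suc m))) \<and> seq_nth p n = y)"
  (is "?R n = Some y \<longleftrightarrow> ?E")
proof
  assume n: "?R n = Some y"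
  \<comment> \<open>An undefined stage makes all later stages undefined, so definedness descends
    from \<open>n\<close>.\<close>
  have def: "?R m \<noteq> None" if "m \<le> n" for m
    using that n by (induction rule: inc_induct) (auto simp: bind_eq_None_conv)
  obtain p where p: "\<And>m. m < Suc n \<Longrightarrow> seq_nth p m = the (?R m)"
    using seq_nth_surj[of "Suc n" "\<lambda>m. the (?R m)"] by blast
  have v: "?R m = Some (seq_nth p m)" if "m \<le> n" for m
    using that def[OF that] p by auto
  have "g m (seq_nth p m) = Some (seq_nth p (Suc m))" if "m < n" for m
    using v[of m] v[of "Suc m"] that by simp
  moreover have "b = Some (seq_nth p 0)" using v[of 0] by simp
  moreover have "seq_nth p n = y" using v[of n] n by simp
  ultimately show ?E by blast
next
  assume ?E
  then obtain p where p: "b = Some (seq_nth p 0)"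
    "\<And>m. m < n \<Longrightarrow> g m (seq_nth p m) = Some (seq_nth p (Suc m))" "seq_nth p n = y" by blast
  have "?R m = Some (seq_nth p m)" if "m \<le> n" for m
    using that by (induction m) (auto simp: p)
  with p(3) show "?R n = Some y" by auto
qed

text \<open>Being defined and nonzero is expressed as having a successor as value. This removes
  \<open>LEAST\<close> and leaves a positive existential condition, to which the closure rules for
  \<open>sig1\<close> apply.\<close>

lemma Minimize_eq_Some:
  "recf_eval (Minimize f) xs = Some y \<longleftrightarrow>
    recf_eval f (y # xs) = Some 0 \<and> (\<forall>m<y. \<exists>z. recf_eval f (m # xs) = Some (Suc z))" (is "?L \<longleftrightarrow> ?R")
proof
  assume ?L
  then have ex: "\<exists>n. recf_eval f (n # xs) = Some 0 \<and> (\<forall>m<n. recf_eval f (m # xs) \<noteq> None)"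
    and y: "y = (LEAST n. recf_eval f (n # xs) = Some 0)"
    unfolding recf_eval.simps by (metis option.distinct(1) option.inject)+
  from ex obtain n where n: "recf_eval f (n # xs) = Some 0" "\<forall>m<n. recf_eval f (m # xs) \<noteq> None" by blast
  have "recf_eval f (y # xs) = Some 0" unfolding y using n(1) by (rule LeastI)
  moreover have "y \<le> n" unfolding y using n(1) by (rule Least_le)
  moreover have "\<exists>z. recf_eval f (m # xs) = Some (Suc z)" if "m < y" for m
  proof -
    have "recf_eval f (m # xs) \<noteq> Some 0" using that not_less_Least unfolding y by blast
    moreover have "recf_eval f (m # xs) \<noteq> None" using n(2) that \<open>y \<le> n\<close> by auto
    ultimately show ?thesis by (metis not0_implies_Suc option.exhaust)
  qed
  ultimately show ?R by blast
next
  assume R: ?R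
  then have "\<exists>n. recf_eval f (n # xs) = Some 0 \<and> (\<forall>m<n. recf_eval f (m # xs) \<noteq> None)"
    by (intro exI[of _ y]) auto
  moreover have "(LEAST n. recf_eval f (n # xs) = Some 0) = y"
  proof (rule Least_equality)
    fix m assume m: "recf_eval f (m # xs) = Some 0"
    show "y \<le> m"
    proof (rule ccontr)
      assume "\<not> y \<le> m"
      with R obtain z where "recf_eval f (m # xs) = Some (Suc z)" by (auto simp: not_le)
      with m show False by simp
    qed
  qed (use R in simp)
  ultimately show ?L unfolding recf_eval.simps by (simp only: if_True simp_thms)
qed

text \<open>Induction over the program replaces a universal machine with a step counter. The result
  allows partial enumerations of balls inside a search whose individual tests are total.\<close>

lemma sig1_recf_graph: "sig1 (\<lambda>e. recf_eval f (map (\<lambda>i. e (Suc i)) [0..<k]) = Some (e 0))"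
proof (induction f arbitrary: k)
  case Zero
  have "dec (\<lambda>e. 0 = e 0)" by (intro dec_eq rec_fun_var rec_fun_const)
  then show ?case by (auto intro: sig1_dec)
next
  case Succ
  show ?case
  proof (cases k)
    case 0
    have "dec (\<lambda>e. (0::nat) = 1)" by (intro dec_eq rec_fun_const)
    then show ?thesis using 0 by (auto intro: sig1_dec)
  next
    case (Suc n)
    have "dec (\<lambda>e. Suc (e (Suc 0)) = e 0)" by (intro dec_eq rec_fun_var rec_fun_Suc)
    then show ?thesis using Suc by (auto intro: sig1_dec simp: map_upt_Suc_conv simp del: upt_Suc)
  qed
next
  case (Proj i)
  have "dec (\<lambda>e. e (Suc i) = e 0)" "dec (\<lambda>e. (0::nat) = 1)"
    by (intro dec_eq rec_fun_var rec_fun_const)+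
  then show ?case by (cases "i < k") (auto intro: sig1_dec)
next
  case (Comp f gs)
  \<comment> \<open>Each \<open>g\<close> is composed with shifted projections, because variable 0
    now holds the proposed output and is not an argument.\<close>
  have "sig1 (\<lambda>e. \<exists>ys. those (map (\<lambda>g. recf_eval g (map e [0..<Suc k])) (map (\<lambda>g. Comp g (map (\<lambda>i. Proj (Suc i)) [0..<k])) gs)) = Some ys \<and> recf_eval f ys = Some (e 0))"
  proof (rule sig1_those)
    fix g' assume "g' \<in> set (map (\<lambda>g. Comp g (map (\<lambda>i. Proj (Suc i)) [0..<k])) gs)"
    then obtain g where g: "g \<in> set gs" "g' = Comp g (map (\<lambda>i. Proj (Suc i)) [0..<k])" by auto
    have "those (map (\<lambda>g. recf_eval g (map e [0..<Suc k])) (map (\<lambda>i. Proj (Suc i)) [0..<k]))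
      = Some (map (\<lambda>i. e (Suc i)) [0..<k])" for e :: "nat \<Rightarrow> nat"
      unfolding map_map comp_def by (rule those_map_Some) (auto simp del: upt_Suc)
    then have "recf_eval g' (map e [0..<Suc k]) = recf_eval g (map (\<lambda>i. e (Suc i)) [0..<k])" for e
      unfolding g(2) by simp
    then show "sig1 (\<lambda>e. recf_eval g' (map (\<lambda>i. e (Suc i)) [0..<Suc k]) = Some (e 0))"
      using sig1_rename[OF Comp(2)[OF g(1), of k], of "\<lambda>i. case i of 0 \<Rightarrow> 0 | Suc j \<Rightarrow> Suc (Suc j)"]
      by (simp del: upt_Suc)
  next
    show "sig1 (\<lambda>e. recf_eval f (map e [0..<length (map (\<lambda>g. Comp g (map (\<lambda>i. Proj (Suc i)) [0..<k])) gs)])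
        = Some (e (length (map (\<lambda>g. Comp g (map (\<lambda>i. Proj (Suc i)) [0..<k])) gs) + 0)))"
      using sig1_rename[OF Comp(1)[of "length gs"], of "\<lambda>i. case i of 0 \<Rightarrow> length gs | Suc j \<Rightarrow> j"]
      by simp
  qed
  moreover have "(map (\<lambda>g. recf_eval g (map e [0..<Suc k])) (map (\<lambda>g. Comp g (map (\<lambda>i. Proj (Suc i)) [0..<k])) gs))
     = map (\<lambda>g. recf_eval g (map (\<lambda>i. e (Suc i)) [0..<k])) gs" for e :: "nat \<Rightarrow> nat"
  proof -
    have "those (map (\<lambda>g. recf_eval g (map e [0..<Suc k])) (map (\<lambda>i. Proj (Suc i)) [0..<k]))
      = Some (map (\<lambda>i. e (Suc i)) [0..<k])"
      unfolding map_map comp_def by (rule those_map_Some) (auto simp del: upt_Suc)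
    then show ?thesis by simp
  qed
  ultimately show ?case by (simp add: bind_eq_Some_conv del: upt_Suc map_map)
next
  case (PrimRec f g)
  show ?case
  proof (cases k)
    case 0
    have "dec (\<lambda>e. (0::nat) = 1)" by (intro dec_eq rec_fun_const)
    then show ?thesis using 0 by (auto intro: sig1_dec)
  next
    case (Suc k')
    have "recf_eval (PrimRec f g) (map (\<lambda>i. e (Suc i)) [0..<k]) = Some (e 0) \<longleftrightarrow>
      (\<exists>p. recf_eval f (map (\<lambda>i. e (Suc (Suc i))) [0..<k']) = Some (seq_nth p 0) \<and>
        (\<forall>m<e (Suc 0). recf_eval g (m # seq_nth p m # map (\<lambda>i. e (Suc (Suc i))) [0..<k']) = Some (seq_nth p (Suc m)))
        \<and> seq_nth p (e (Suc 0)) = e 0)" for e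
    proof -
      have "map (\<lambda>i. e (Suc i)) [0..<k] = e (Suc 0) # map (\<lambda>i. e (Suc (Suc i))) [0..<k']"
        unfolding Suc by (rule map_upt_Suc_conv)
      then show ?thesis
        using rec_nat_bind_eq_Some[of "recf_eval f (map (\<lambda>i. e (Suc (Suc i))) [0..<k'])"
          "\<lambda>m y. recf_eval g (m # y # map (\<lambda>i. e (Suc (Suc i))) [0..<k'])"] by simp
    qed
    moreover have "sig1 (\<lambda>e. \<exists>p. recf_eval f (map (\<lambda>i. e (Suc (Suc i))) [0..<k']) = Some (seq_nth p 0) \<and>
        (\<forall>m<e (Suc 0). recf_eval g (m # seq_nth p m # map (\<lambda>i. e (Suc (Suc i))) [0..<k']) = Some (seq_nth p (Suc m)))
        \<and> seq_nth p (e (Suc 0)) = e 0)"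
    proof (intro sig1_ex sig1_conj sig1_ball rec_fun_var)
      let ?G = "\<lambda>i e. case i of 0 \<Rightarrow> seq_nth (e 0) 0 | Suc j \<Rightarrow> e (Suc (Suc (Suc j)))"
      have "rec_fun (?G i)" for i
        by (cases i) (auto intro: rec_fun_seq_nth)
      from sig1_subst[where G = ?G, OF PrimRec(1)[of k'] this]
      show "sig1 (\<lambda>e. recf_eval f (map (\<lambda>i. e (Suc (Suc (Suc i)))) [0..<k']) = Some (seq_nth (e 0) 0))"
        by simp
      let ?G = "\<lambda>i e. if i = 0 then seq_nth (e (Suc 0)) (Suc (e 0)) else if i = Suc 0 then e 0
          else if i = Suc (Suc 0) then seq_nth (e (Suc 0)) (e 0) else e (Suc i)"
      have "rec_fun (?G i)" for i
        by (cases "i = 0"; cases "i = Suc 0"; cases "i = Suc (Suc 0)") (auto intro: rec_fun_seq_nth rec_fun_Suc)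
      from sig1_subst[where G = ?G, OF PrimRec(2)[of "Suc (Suc k')"] this]
      show "sig1 (\<lambda>e. recf_eval g (e 0 # seq_nth (e (Suc 0)) (e 0) # map (\<lambda>i. e (Suc (Suc (Suc (Suc i))))) [0..<k'])
          = Some (seq_nth (e (Suc 0)) (Suc (e 0))))"
        by (simp add: map_upt_Suc_conv del: upt_Suc)
      show "sig1 (\<lambda>e. seq_nth (e 0) (e (Suc (Suc 0))) = e (Suc 0))"
        by (intro sig1_dec dec_eq rec_fun_seq_nth rec_fun_var)
    qed
    ultimately show ?thesis by simp
  qed
next
  case (Minimize f)
  have "sig1 (\<lambda>e. recf_eval f (e 0 # map (\<lambda>i. e (Suc i)) [0..<k]) = Some 0 \<and>
     (\<forall>m<e 0. \<exists>z. recf_eval f (m # map (\<lambda>i. e (Suc i)) [0..<k]) = Some (Suc z)))"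
  proof (intro sig1_ex sig1_conj sig1_ball rec_fun_var)
    let ?G = "\<lambda>i e. case i of 0 \<Rightarrow> 0 | Suc j \<Rightarrow> e j"
    have "rec_fun (?G i)" for i
      by (cases i) auto
    from sig1_subst[where G = ?G, OF Minimize[of "Suc k"] this]
    show "sig1 (\<lambda>e. recf_eval f (e 0 # map (\<lambda>i. e (Suc i)) [0..<k]) = Some 0)"
      by (simp add: map_upt_Suc_conv del: upt_Suc)
    let ?G = "\<lambda>i e. if i = 0 then Suc (e 0) else if i = Suc 0 then e (Suc 0) else e (Suc i)"
    have "rec_fun (?G i)" for i
      by (cases "i = 0"; cases "i = Suc 0") (auto intro: rec_fun_Suc)
    from sig1_subst[where G = ?G, OF Minimize[of "Suc k"] this]
    show "sig1 (\<lambda>e. recf_eval f (e (Suc 0) # map (\<lambda>i. e (Suc (Suc (Suc i)))) [0..<k]) = Some (Suc (e 0)))"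
      by (simp add: map_upt_Suc_conv del: upt_Suc)
  qed
  then show ?case unfolding Minimize_eq_Some .
qed

text \<open>The search runs over codes of pairs of a witness and a value, so one minimization of a
  decidable test finds a value together with its certificate. Totality of \<open>P\<close> makes it
  halt.\<close>

lemma sig1_uniformize:
  assumes "sig1 (\<lambda>e. P (e 0) (e (Suc 0)))" and total: "\<And>n. \<exists>y. P n y"
    and h: "rec_fun (\<lambda>e. h (e 0) (e (Suc 0)))"
  shows "\<exists>\<phi>. partial_recursive 1 \<phi> \<and> (\<forall>n. \<exists>y. P n y \<and> \<phi> [n] = Some (h n y))"
proof -
  obtain Q where Q: "dec (\<lambda>e. Q (e 0) (\<lambda>i. e (Suc i)))" "\<And>e. P (e 0) (e (Suc 0)) \<longleftrightarrow> (\<exists>t. Q t e)"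
    using assms(1) unfolding sig1_def by blast
  \<comment> \<open>The equivalence for \<open>P\<close> holds in every environment. Filling all
    variables after the first with the value makes the test depend on \<open>z\<close> and
    \<open>n\<close> alone.\<close>
  define R where "R z n \<longleftrightarrow> Q (fst (prod_decode z)) (\<lambda>i. if i = 0 then n else snd (prod_decode z))" for z n
  have P: "\<exists>z. R z n" for n
  proof -
    obtain y where "P n y" using total by blast
    then obtain t where "Q t (\<lambda>i. if i = 0 then n else y)"
      using Q(2)[of "\<lambda>i. if i = 0 then n else y"] by auto
    then have "R (prod_encode (t, y)) n" by (simp add: R_def cong: if_cong)
    then show ?thesis ..
  qed
  have RP: "P n (snd (prod_decode z))" if "R z n" for z n
    using that Q(2)[of "\<lambda>i. if i = 0 then n else snd (prod_decode z)"] by (auto simp: R_def)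
  let ?G = "\<lambda>i e. if i = 0 then fst (prod_decode (e 0)) else if i = Suc 0 then e (Suc 0) else snd (prod_decode (e 0))"
  have "rec_fun (?G i)" for i
    by (cases "i = 0"; cases "i = Suc 0") (auto intro: rec_fun_fst rec_fun_snd)
  from dec_subst[where G = ?G, OF Q(1) this]
  have "dec (\<lambda>e. R (e 0) (e (Suc 0)))" by (simp add: R_def)
  then have "rec_fun (\<lambda>e. of_bool (\<not> R (e 0) (e (Suc 0))))"
    using dec_not[of "\<lambda>e. R (e 0) (e (Suc 0))"] unfolding dec_def by blast
  then obtain r K where r: "\<And>k e. k \<ge> K \<Longrightarrow> recf_eval r (map e [0..<k]) = Some (of_bool (\<not> R (e 0) (e (Suc 0))))"
    unfolding rec_fun_def by blast
  have "rec_fun (\<lambda>e. h (e (Suc 0)) (snd (prod_decode (e 0))))"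
    by (rule rec_fun_subst2[OF h]) (intro rec_fun_snd rec_fun_var)+
  then obtain s L where s: "\<And>k e. k \<ge> L \<Longrightarrow> recf_eval s (map e [0..<k]) = Some (h (e (Suc 0)) (snd (prod_decode (e 0))))"
    unfolding rec_fun_def by blast
  define k where "k = K + L"
  \<comment> \<open>\<open>Minimize\<close> supplies only \<open>z\<close> and \<open>n\<close>,
    while the programs are known to be correct on long lists; zeros fill the remaining
    places.\<close>
  define pad where "pad = Proj 0 # Proj 1 # replicate k Zero"
  have pad: "those (map (\<lambda>g. recf_eval g [z, n]) pad) = Some (map (case_nat z (case_nat n (\<lambda>_. 0))) [0..<Suc (Suc k)])" for z n
  proof -
    have "those (map (\<lambda>g. recf_eval g [z, n]) (replicate k Zero)) = Some (replicate k 0)"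
      by (induction k) auto
    moreover have "map (\<lambda>_. 0 :: nat) [0..<k] = replicate k 0"
      by (simp add: map_replicate_const)
    ultimately show ?thesis unfolding pad_def map_case_nat_upt by simp
  qed
  define f where "f = Comp (Comp s pad) [Minimize (Comp r pad), Proj 0]"
  have rp: "recf_eval (Comp r pad) [z, n] = Some (of_bool (\<not> R z n))" for z n
    unfolding recf_eval.simps pad using r[of "Suc (Suc k)"] by (simp add: k_def del: upt_Suc)
  have sp: "recf_eval (Comp s pad) [z, n] = Some (h n (snd (prod_decode z)))" for z n
    unfolding recf_eval.simps pad using s[of "Suc (Suc k)"] by (simp add: k_def del: upt_Suc)
  have "\<exists>y. P n y \<and> recf_eval f [n] = Some (h n y)" for n
  proof -
    define z where "z = (LEAST z. R z n)"
    have z: "R z n" unfolding z_def using P by (rule LeastI_ex)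
    have nz: "\<not> R m n" if "m < z" for m using that not_less_Least unfolding z_def by blast
    have "recf_eval (Minimize (Comp r pad)) [n] = Some z"
      unfolding Minimize_eq_Some rp by (simp add: z nz)
    then have "recf_eval f [n] = Some (h n (snd (prod_decode z)))"
      unfolding f_def recf_eval.simps(4)[of "Comp s pad"] using sp by simp
    with RP[OF z] show ?thesis by blast
  qed
  then show ?thesis unfolding partial_recursive_def
    by (intro exI[of _ "recf_eval f"]) blast
qed

section \<open>Functions of bounded variation and monotone branches\<close>

text \<open>A function \<open>F\<close> that dominates \<open>f\<close> is increasing and plays the role of the variation function:
  the variation of \<open>f\<close> on \<open>[a, b]\<close> is at most \<open>F b - F a\<close>.\<close>

definition dominated :: "real set \<Rightarrow> (real \<Rightarrow> real) \<Rightarrow> (real \<Rightarrow> real) \<Rightarrow> bool" where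
  "dominated A f F \<longleftrightarrow> (\<forall>x\<in>A. \<forall>y\<in>A. x \<le> y \<longrightarrow> \<bar>f y - f x\<bar> \<le> F y - F x)"

lemma dominatedD: "dominated A f F \<Longrightarrow> x \<in> A \<Longrightarrow> y \<in> A \<Longrightarrow> x \<le> y \<Longrightarrow> \<bar>f y - f x\<bar> \<le> F y - F x"
  by (auto simp: dominated_def)

lemma dominated_mono: "dominated A f F \<Longrightarrow> x \<in> A \<Longrightarrow> y \<in> A \<Longrightarrow> x \<le> y \<Longrightarrow> F x \<le> F y"
  using dominatedD[of A f F x y] by linarith

lemma dominated_subset: "dominated A f F \<Longrightarrow> B \<subseteq> A \<Longrightarrow> dominated B f F"
  by (auto simp: dominated_def)

lemma dominated_cong:
  "(\<And>x. x \<in> A \<Longrightarrow> f x = g x) \<Longrightarrow> (\<And>x. x \<in> A \<Longrightarrow> F x = G x) \<Longrightarrow> dominated A f F \<longleftrightarrow> dominated A g G"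
  by (auto simp: dominated_def)

lemma dominated_bounded:
  assumes "dominated A f F" "\<And>x. x \<in> A \<Longrightarrow> \<bar>F x\<bar> \<le> K"
  obtains B where "B \<ge> 0" "\<And>x. x \<in> A \<Longrightarrow> \<bar>f x\<bar> \<le> B"
proof (cases "A = {}")
  case False
  then obtain u where u: "u \<in> A" by blast
  have "\<bar>f x\<bar> \<le> \<bar>f u\<bar> + 2 * K" if "x \<in> A" for x
  proof -
    have "\<bar>f x - f u\<bar> \<le> \<bar>F x - F u\<bar>"
      using dominatedD[OF assms(1) that u] dominatedD[OF assms(1) u that] by linarith
    with assms(2)[OF that] assms(2)[OF u] show ?thesis by linarith
  qed
  moreover have "0 \<le> \<bar>f u\<bar> + 2 * K" using assms(2)[OF u] by linarith
  ultimately show ?thesis by (rule that[rotated])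
qed (use that[of 0] in simp)

lemma abs_prod_diff_le:
  fixes a b c d :: real
  assumes "\<bar>b\<bar> \<le> K" "\<bar>c\<bar> \<le> L" "\<bar>a - c\<bar> \<le> u" "\<bar>b - d\<bar> \<le> v"
  shows "\<bar>a * b - c * d\<bar> \<le> K * u + L * v"
proof -
  have "a * b - c * d = b * (a - c) + c * (b - d)" by (simp add: algebra_simps)
  then have "\<bar>a * b - c * d\<bar> \<le> \<bar>b\<bar> * \<bar>a - c\<bar> + \<bar>c\<bar> * \<bar>b - d\<bar>"
    by (metis abs_mult abs_triangle_ineq)
  also have "\<dots> \<le> K * u + L * v"
    using assms by (intro add_mono mult_mono) auto
  finally show ?thesis .
qed

text \<open>\<open>F x\<close> is the supremum of the variations along finite chains in
  \<open>A\<close> that end at \<open>x\<close>. Prolonging such a chain to a point \<open>y\<close>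
  above \<open>x\<close> yields the domination; the chain of length 0 makes the supremum
  nonnegative.\<close>

lemma bounded_variation_on_dominated:
  assumes "bounded_variation_on A h"
  obtains F K where "dominated A h F" "\<And>x. x \<in> A \<Longrightarrow> \<bar>F x\<bar> \<le> K"
proof -
  define V where "V n c = (\<Sum>i<n. \<bar>h (c (Suc i)) - h (c i)\<bar>)" for n :: nat and c :: "nat \<Rightarrow> real"
  define C where "C x = {V n c | n c. (\<forall>i\<le>n. c i \<in> A) \<and> (\<forall>i<n. c i \<le> c (Suc i)) \<and> c n = x}" for x
  obtain B where B: "\<And>n c. (\<forall>i\<le>n. c i \<in> A) \<and> (\<forall>i<n. c i \<le> c (Suc i)) \<Longrightarrow> V n c \<le> B"
    using assms unfolding bounded_variation_on_def V_def by blast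
  have C_le: "v \<le> B" if "v \<in> C x" for v x using that B unfolding C_def by blast
  have bdd: "bdd_above (C x)" for x using C_le by (rule bdd_aboveI)
  have zero: "0 \<in> C x" if "x \<in> A" for x
    unfolding C_def by (intro CollectI exI[of _ 0] exI[of _ "\<lambda>_. x"]) (simp add: that V_def)
  have "dominated A h (\<lambda>x. Sup (C x))"
    unfolding dominated_def
  proof (intro ballI impI)
    fix x y assume xy: "x \<in> A" "y \<in> A" "x \<le> y"
    have "Sup (C x) \<le> Sup (C y) - \<bar>h y - h x\<bar>"
    proof (rule cSup_least)
      show "C x \<noteq> {}" using zero[OF xy(1)] by blast
      fix v assume "v \<in> C x"
      then obtain n c where c: "v = V n c" "\<forall>i\<le>n. c i \<in> A" "\<forall>i<n. c i \<le> c (Suc i)" "c n = x"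
        unfolding C_def by blast
      define c' where "c' = c(Suc n := y)"
      have "V (Suc n) c' = v + \<bar>h y - h x\<bar>"
        unfolding V_def c(1) c'_def using c(4) by simp
      moreover have "V (Suc n) c' \<in> C y"
        unfolding C_def
      proof (intro CollectI exI[of _ "Suc n"] exI[of _ c'] conjI allI impI)
        show "c' i \<in> A" if "i \<le> Suc n" for i using that c(2) xy by (auto simp: c'_def le_Suc_eq)
        show "c' i \<le> c' (Suc i)" if "i < Suc n" for i
          using that c(3,4) xy by (auto simp: c'_def less_Suc_eq)
      qed (auto simp: c'_def)
      ultimately show "v \<le> Sup (C y) - \<bar>h y - h x\<bar>"
        using cSup_upper[OF _ bdd, of "V (Suc n) c'" y] by simp
    qed
    then show "\<bar>h y - h x\<bar> \<le> Sup (C y) - Sup (C x)" by simp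
  qed
  moreover have "\<bar>Sup (C x)\<bar> \<le> B" if "x \<in> A" for x
  proof -
    have "0 \<le> Sup (C x)" using cSup_upper[OF zero[OF that] bdd] .
    moreover have "Sup (C x) \<le> B" using zero[OF that] C_le by (intro cSup_least) auto
    ultimately show ?thesis by simp
  qed
  ultimately show ?thesis using that by blast
qed

section \<open>Gaps between the points of a finite set\<close>

definition comps :: "real set \<Rightarrow> (real \<times> real) set" where
  "comps Z = {(a, b). a \<in> Z \<and> b \<in> Z \<and> a < b \<and> {a<..<b} \<inter> Z = {}}"

lemma compsD:
  assumes "(a, b) \<in> comps Z"
  shows "a \<in> Z" "b \<in> Z" "a < b" "{a<..<b} \<inter> Z = {}"
  using assms by (auto simp: comps_def)

lemma finite_comps: "finite Z \<Longrightarrow> finite (comps Z)"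
  by (rule finite_subset[of _ "Z \<times> Z"]) (auto simp: comps_def)

lemma comps_subset: "Z \<subseteq> {0..1} \<Longrightarrow> (a, b) \<in> comps Z \<Longrightarrow> {a<..<b} \<subseteq> {0..1} - Z"
proof
  fix x assume Z: "Z \<subseteq> {0..1}" and ab: "(a, b) \<in> comps Z" and x: "x \<in> {a<..<b}"
  note ab = compsD[OF ab]
  have "0 \<le> a" "b \<le> 1" using Z ab(1,2) by auto
  then show "x \<in> {0..1} - Z" using x ab(4) by auto
qed

lemma comps_cover:
  assumes "finite Z" "0 \<in> Z" "1 \<in> Z" "x \<in> {0..1} - Z"
  obtains a b where "(a, b) \<in> comps Z" "x \<in> {a<..<b}"
proof -
  define L where "L = Z \<inter> {..<x}"
  define R where "R = Z \<inter> {x<..}"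
  have "x \<noteq> 0" "x \<noteq> 1" using assms by auto
  then have LR: "0 \<in> L" "1 \<in> R" using assms unfolding L_def R_def by auto
  have fin: "finite L" "finite R" using assms(1) unfolding L_def R_def by auto
  have "Max L \<in> L" "Min R \<in> R" using LR fin by (auto intro: Max_in Min_in)
  moreover have "{Max L<..<Min R} \<inter> Z = {}"
  proof (rule ccontr)
    assume "{Max L<..<Min R} \<inter> Z \<noteq> {}"
    then obtain z where z: "z \<in> Z" "Max L < z" "z < Min R" by auto
    have "z \<noteq> x" using z assms by auto
    then have "z \<in> L \<or> z \<in> R" using z unfolding L_def R_def by auto
    then show False using Max_ge[OF fin(1), of z] Min_le[OF fin(2), of z] z by auto
  qed
  ultimately have "(Max L, Min R) \<in> comps Z" "x \<in> {Max L<..<Min R}"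
    unfolding comps_def L_def R_def by auto
  then show ?thesis by (rule that)
qed

lemma comps_ordered:
  assumes "(a, b) \<in> comps Z" "(c, d) \<in> comps Z" "a < c"
  shows "b \<le> c"
  using compsD[OF assms(1)] compsD[OF assms(2)] assms(3) by (metis disjoint_iff greaterThanLessThan_iff not_le)

lemma comps_same_left:
  assumes "(a, b) \<in> comps Z" "(a, d) \<in> comps Z"
  shows "b = d"
  using compsD[OF assms(1)] compsD[OF assms(2)] by (metis disjoint_iff greaterThanLessThan_iff linorder_neqE)

lemma comps_disjoint:
  assumes "(a, b) \<in> comps Z" "(c, d) \<in> comps Z" "x \<in> {a<..<b}" "x \<in> {c<..<d}"
  shows "(a, b) = (c, d)"
proof -
  have "\<not> a < c" using comps_ordered[OF assms(1,2)] assms(3,4) by auto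
  moreover have "\<not> c < a" using comps_ordered[OF assms(2,1)] assms(3,4) by auto
  ultimately have "a = c" by simp
  then show ?thesis using comps_same_left assms(1,2) by blast
qed

text \<open>The interval with the largest left end is removed. All others lie to the left of it, so
  the induction continues with \<open>hi\<close> lowered to that end; monotonicity of
  \<open>F\<close> accounts for the spaces in between.\<close>

lemma sum_ordered_intervals_le:
  fixes F :: "real \<Rightarrow> real"
  assumes "finite C" "\<And>a b. (a, b) \<in> C \<Longrightarrow> lo \<le> a \<and> a < b \<and> b \<le> hi"
    and "\<And>a b c d. (a, b) \<in> C \<Longrightarrow> (c, d) \<in> C \<Longrightarrow> (a, b) \<noteq> (c, d) \<Longrightarrow> b \<le> c \<or> d \<le> a"
    and "\<And>x y. lo \<le> x \<Longrightarrow> x \<le> y \<Longrightarrow> y \<le> hi \<Longrightarrow> F x \<le> F y" "lo \<le> hi"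
  shows "(\<Sum>(a, b)\<in>C. F b - F a) \<le> F hi - F lo"
  using assms
proof (induction "card C" arbitrary: C hi)
  case 0
  then show ?case by auto
next
  case (Suc n)
  then have "C \<noteq> {}" by auto
  then have "Max (fst ` C) \<in> fst ` C" using Suc.prems(1) by (intro Max_in) auto
  then obtain a b where ab: "(a, b) \<in> C" and m: "Max (fst ` C) = a" by force
  have mx: "c \<le> a" if "(c, d) \<in> C" for c d
  proof -
    have "c \<in> fst ` C" using that by force
    then show ?thesis using Max_ge[of "fst ` C" c] Suc.prems(1) m by simp
  qed
  have *: "d \<le> a" if "(c, d) \<in> C - {(a, b)}" for c d
    using Suc.prems(3)[OF ab, of c d] that mx[of c d] Suc.prems(2)[OF ab] by force
  have "(\<Sum>(a, b)\<in>C - {(a, b)}. F b - F a) \<le> F a - F lo"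
  proof (rule Suc.hyps(1))
    show "n = card (C - {(a, b)})" using Suc.hyps(2) ab Suc.prems(1) by simp
    show "lo \<le> a" using Suc.prems(2)[OF ab] by simp
    show "lo \<le> c \<and> c < d \<and> d \<le> a" if "(c, d) \<in> C - {(a, b)}" for c d
      using *[OF that] Suc.prems(2)[of c d] that by auto
    show "F x \<le> F y" if "lo \<le> x" "x \<le> y" "y \<le> a" for x y
      using Suc.prems(4)[of x y] that Suc.prems(2)[OF ab] by simp
  qed (use Suc.prems(1,3) in auto)
  moreover have "(\<Sum>(a, b)\<in>C. F b - F a) = (F b - F a) + (\<Sum>(a, b)\<in>C - {(a, b)}. F b - F a)"
    using ab Suc.prems(1) by (subst sum.remove[of C "(a, b)"]) auto
  moreover have "F b \<le> F hi" using Suc.prems(2)[OF ab] Suc.prems(4)[of b hi] by simp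
  ultimately show ?case by linarith
qed

lemma sum_comps_le:
  assumes "finite Z" "Z \<subseteq> {0..1}" "\<And>x y. 0 \<le> x \<Longrightarrow> x \<le> y \<Longrightarrow> y \<le> 1 \<Longrightarrow> F x \<le> F y"
  shows "(\<Sum>(a, b)\<in>comps Z. F b - F a) \<le> F 1 - (F 0 :: real)"
proof (rule sum_ordered_intervals_le)
  show "finite (comps Z)" by (rule finite_comps) fact
  show "0 \<le> a \<and> a < b \<and> b \<le> 1" if "(a, b) \<in> comps Z" for a b
    using compsD[OF that] assms(2) by auto
  show "b \<le> c \<or> d \<le> a" if "(a, b) \<in> comps Z" "(c, d) \<in> comps Z" "(a, b) \<noteq> (c, d)" for a b c d
    using comps_ordered[OF that(1,2)] comps_ordered[OF that(2,1)] that comps_same_left[of a b Z d]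
    by (cases a c rule: linorder_cases) auto
qed (use assms(3) in auto)

text \<open>\<open>T\<close> maps \<open>{a<..<b}\<close> monotonically, and the weight \<open>1/|T'|\<close> of the transfer operator is
  bounded away from 0 and has bounded variation there.\<close>

definition branch :: "(real \<Rightarrow> real) \<Rightarrow> real \<Rightarrow> real \<Rightarrow> bool" where
  "branch T a b \<longleftrightarrow>
     (\<forall>x\<in>{a<..<b}. (T has_real_derivative deriv T x) (at x) \<and> deriv T x \<noteq> 0) \<and>
     (mono_on {a<..<b} T \<or> antimono_on {a<..<b} T) \<and>
     (\<exists>\<gamma>>0. \<forall>x\<in>{a<..<b}. \<gamma> \<le> inverse \<bar>deriv T x\<bar>) \<and>
     (\<exists>F K. dominated {a<..<b} (\<lambda>x. inverse \<bar>deriv T x\<bar>) F \<and> (\<forall>x\<in>{a<..<b}. \<bar>F x\<bar> \<le> K))"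

text \<open>The condition is on all intervals that avoid \<open>Z\<close>, not just on its gaps, so
  that enlarging \<open>Z\<close> inside \<open>{0..1}\<close> by finitely many points preserves it
  at once.\<close>

definition piecewise_branches :: "(real \<Rightarrow> real) \<Rightarrow> real set \<Rightarrow> bool" where
  "piecewise_branches T Z \<longleftrightarrow> finite Z \<and> 0 \<in> Z \<and> 1 \<in> Z \<and> Z \<subseteq> {0..1} \<and>
     (\<forall>a b. a < b \<and> {a<..<b} \<subseteq> {0..1} - Z \<longrightarrow> branch T a b)"

lemma piecewise_branchesD:
  assumes "piecewise_branches T Z"
  shows "finite Z" "0 \<in> Z" "1 \<in> Z" "Z \<subseteq> {0..1}"
    "(a, b) \<in> comps Z \<Longrightarrow> branch T a b"
  using assms comps_subset[of Z a b] compsD(3)[of a b Z] unfolding piecewise_branches_def by auto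

section \<open>Monotone branches of maps, compositions and iterates\<close>

lemma branch_inj:
  assumes "branch T a b" "x \<in> {a<..<b}" "y \<in> {a<..<b}" "x < y"
  shows "T x \<noteq> T y"
proof -
  have "(T has_real_derivative deriv T z) (at z)" if "x \<le> z" "z \<le> y" for z
    using assms that unfolding branch_def by auto
  from MVT2[OF assms(4) this] obtain z where "x < z" "z < y" "T y - T x = (y - x) * deriv T z" by blast
  moreover have "deriv T z \<noteq> 0" using assms calculation unfolding branch_def by auto
  ultimately show ?thesis using assms(4) by auto
qed

text \<open>The sign \<open>s\<close> turns both orientations into strict increase, so that
  increasing and decreasing branches can largely be treated together.\<close>

lemma branch_sign:
  assumes "branch T a b"
  obtains s :: real where "s = 1 \<or> s = -1"
    "\<And>x y. x \<in> {a<..<b} \<Longrightarrow> y \<in> {a<..<b} \<Longrightarrow> x < y \<Longrightarrow> s * T x < s * T y"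
proof (cases "mono_on {a<..<b} T")
  case True
  have "T x < T y" if "x \<in> {a<..<b}" "y \<in> {a<..<b}" "x < y" for x y
    using mono_onD[OF True that(1,2)] that(3) branch_inj[OF assms that] by simp
  then show ?thesis using that[of 1] by simp
next
  case False
  then have "antimono_on {a<..<b} T" using assms unfolding branch_def by blast
  then have "T x \<ge> T y" if "x \<in> {a<..<b}" "y \<in> {a<..<b}" "x < y" for x y
    using that by (auto simp: monotone_on_def)
  then have "T x > T y" if "x \<in> {a<..<b}" "y \<in> {a<..<b}" "x < y" for x y
    using that branch_inj[OF assms that] by (simp add: order_less_le)
  then show ?thesis using that[of "-1"] by simp
qed

lemma branch_inj_on: "branch T a b \<Longrightarrow> inj_on T {a<..<b}"
  by (rule linorder_inj_onI) (use branch_inj in auto)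

lemma branch_continuous: "branch T a b \<Longrightarrow> continuous_on {a<..<b} T"
  unfolding branch_def by (metis DERIV_isCont continuous_at_imp_continuous_on)

lemma has_real_derivative_I:
  assumes "(T has_real_derivative D) (at x)" "x \<in> {0..1::real}"
  shows "differentiable_I T x" "deriv_I T x = D"
proof -
  have d: "(T has_vector_derivative D) (at x within cbox 0 1)"
    using assms(1) unfolding has_real_derivative_iff_has_vector_derivative
    by (rule has_vector_derivative_at_within)
  then show "differentiable_I T x" using differentiableI_vector by simp
  show "deriv_I T x = D"
    using vector_derivative_within_cbox[OF _ _ d] assms(2) by simp
qed

text \<open>The break points are the end points of the pieces. Expansion for \<open>n = 1\<close>
  makes the derivative nonzero, and continuity of the extended derivative on the compact closure
  bounds it above, that is, the weight below.\<close>

lemma piecewise_expanding_branches: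
  assumes "piecewise_expanding T"
  shows "\<exists>Z. piecewise_branches T Z"
proof -
  obtain P where P: "finite P" "partition_on {0..1} P" "\<And>J. J \<in> P \<Longrightarrow> is_interval J"
    "\<And>J. J \<in> P \<Longrightarrow> \<exists>g. (\<forall>x\<in>J. g x = T x) \<and> C1_monotone_on (closure J) g"
    "bounded_variation_on {x \<in> {0..1}. differentiable_I T x} (\<lambda>x. inverse \<bar>deriv_I T x\<bar>)"
    using conjunct1[OF assms[unfolded piecewise_expanding_def]] by (elim exE conjE) (simp only: Ball_def)
  obtain C \<sigma> where C: "0 < C" "1 < \<sigma>" "\<And>n x. n \<ge> 1 \<Longrightarrow> x \<in> {0..1} \<Longrightarrow> differentiable_I (T ^^ n) x \<Longrightarrow>
      C * \<sigma> ^ n < \<bar>deriv_I (T ^^ n) x\<bar>"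
    using conjunct1[OF conjunct2[OF assms[unfolded piecewise_expanding_def]]] by (elim exE conjE) simp
  define Z where "Z = {0, 1} \<union> Inf ` P \<union> Sup ` P"
  have J: "J \<noteq> {}" "J \<subseteq> {0..1}" "bdd_below J" "bdd_above J" if "J \<in> P" for J
  proof -
    show "J \<noteq> {}" using that P(2) unfolding partition_on_def by auto
    show *: "J \<subseteq> {0..1}" using that P(2) unfolding partition_on_def by auto
    show "bdd_below J" "bdd_above J" using bdd_below_mono[OF _ *] bdd_above_mono[OF _ *] by auto
  qed
  have JI: "Inf J \<in> {0..1}" "Sup J \<in> {0..1}" if "J \<in> P" for J
  proof -
    obtain x where x: "x \<in> J" using J(1)[OF \<open>J \<in> P\<close>] by (meson ex_in_conv)
    have "Inf J \<le> x" "x \<le> Sup J" using cInf_lower[OF x] cSup_upper[OF x] J[OF \<open>J \<in> P\<close>] by auto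
    moreover have "0 \<le> Inf J" "Sup J \<le> 1"
      using J(1,2)[OF \<open>J \<in> P\<close>] by (fastforce intro!: cInf_greatest cSup_least)+
    ultimately show "Inf J \<in> {0..1}" "Sup J \<in> {0..1}" using J(2)[OF \<open>J \<in> P\<close>] x by auto
  qed
  have "branch T a b" if ab: "a < b" "{a<..<b} \<subseteq> {0..1} - Z" for a b
  proof -
    define u where "u = (a + b) / 2"
    have u: "u \<in> {a<..<b}" using ab(1) by (simp add: u_def field_simps)
    then have "u \<in> \<Union> P" using P(2) ab(2) unfolding partition_on_def by auto
    then obtain J where "J \<in> P" "u \<in> J" by (elim UnionE)
    note J = J[OF \<open>J \<in> P\<close>]
    have le: "Inf J \<le> u" "u \<le> Sup J" using cInf_lower[OF \<open>u \<in> J\<close>] cSup_upper[OF \<open>u \<in> J\<close>] J by auto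
    have "Inf J \<in> Z" "Sup J \<in> Z" using \<open>J \<in> P\<close> by (auto simp: Z_def)
    then have "Inf J \<notin> {a<..<b}" "Sup J \<notin> {a<..<b}" using ab by auto
    then have ends: "Inf J \<le> a" "b \<le> Sup J" using le u by auto
    have sub: "{a<..<b} \<subseteq> J"
    proof
      fix x assume "x \<in> {a<..<b}"
      then have "Inf J < x" "x < Sup J" using ends by auto
      then obtain v w where "v \<in> J" "v < x" "w \<in> J" "x < w"
        using cInf_lessD[OF J(1), of x] less_cSupD[OF J(1), of x] by blast
      then show "x \<in> J" using mem_is_interval_1_I[OF P(3)[OF \<open>J \<in> P\<close>]] by (meson less_imp_le)
    qed
    obtain g g' where g: "\<And>x. x \<in> J \<Longrightarrow> g x = T x"
      "\<And>x. x \<in> closure J \<Longrightarrow> (g has_real_derivative g' x) (at x within closure J)"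
      "continuous_on (closure J) g'" "mono_on (closure J) g \<or> antimono_on (closure J) g"
      using P(4)[OF \<open>J \<in> P\<close>] unfolding C1_monotone_on_def by blast
    have cl: "{a<..<b} \<subseteq> closure J" using sub closure_subset by blast
    have D: "(T has_real_derivative g' x) (at x)" if x: "x \<in> {a<..<b}" for x
    proof -
      have "(g has_real_derivative g' x) (at x within {a<..<b})"
        using g(2)[of x] cl x by (meson DERIV_subset subsetD)
      then have "(g has_real_derivative g' x) (at x)" using at_within_open[OF x open_greaterThanLessThan] by simp
      then show ?thesis
        by (rule has_field_derivative_transform_within_open[where S = "{a<..<b}"])
          (use x sub g(1) in auto)
    qed
    have dT: "deriv T x = g' x" if "x \<in> {a<..<b}" for x using D[OF that] by (rule DERIV_imp_deriv)
    have I: "x \<in> {0..1}" if "x \<in> {a<..<b}" for x using that ab(2) by auto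
    have dI: "differentiable_I T x" "deriv_I T x = deriv T x" if "x \<in> {a<..<b}" for x
      using has_real_derivative_I[OF D[OF that] I[OF that]] dT[OF that] by auto
    have nz: "deriv T x \<noteq> 0" if "x \<in> {a<..<b}" for x
    proof -
      have "C * \<sigma> < \<bar>deriv T x\<bar>" using C(3)[of 1 x] dI[OF that] I[OF that] by simp
      moreover have "0 < C * \<sigma>" using C by simp
      ultimately show ?thesis by auto
    qed
    have "compact (closure J)"
      using bounded_subset[OF bounded_closed_interval[of 0 1] J(2)] compact_closure by blast
    then have "compact (g' ` closure J)" using g(3) by (intro compact_continuous_image)
    then obtain M where M: "M > 0" "\<And>x. x \<in> closure J \<Longrightarrow> \<bar>g' x\<bar> \<le> M"
      using compact_imp_bounded bounded_pos by (metis imageI real_norm_def)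
    have low: "inverse M \<le> inverse \<bar>deriv T x\<bar>" if "x \<in> {a<..<b}" for x
      using M(2)[of x] that cl nz[OF that] dT[OF that] by (intro le_imp_inverse_le) auto
    obtain F K where FK: "dominated {x \<in> {0..1}. differentiable_I T x} (\<lambda>x. inverse \<bar>deriv_I T x\<bar>) F"
      "\<And>x. x \<in> {x \<in> {0..1}. differentiable_I T x} \<Longrightarrow> \<bar>F x\<bar> \<le> K"
      using bounded_variation_on_dominated[OF P(5)] by blast
    have "dominated {a<..<b} (\<lambda>x. inverse \<bar>deriv_I T x\<bar>) F"
      by (rule dominated_subset[OF FK(1)]) (use dI I in auto)
    then have "dominated {a<..<b} (\<lambda>x. inverse \<bar>deriv T x\<bar>) F"
      by (subst dominated_cong[where g = "\<lambda>x. inverse \<bar>deriv_I T x\<bar>" and G = F]) (use dI in auto)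
    moreover have "\<forall>x\<in>{a<..<b}. \<bar>F x\<bar> \<le> K" using FK(2) dI I by auto
    moreover have "mono_on {a<..<b} T \<or> antimono_on {a<..<b} T"
    proof (use g(4) in \<open>elim disjE\<close>)
      assume "mono_on (closure J) g"
      then have "mono_on {a<..<b} T"
        using cl sub g(1) unfolding monotone_on_def by (metis (no_types, opaque_lifting) subsetD)
      then show ?thesis ..
    next
      assume "antimono_on (closure J) g"
      then have "antimono_on {a<..<b} T"
        using cl sub g(1) unfolding monotone_on_def by (metis (no_types, opaque_lifting) subsetD)
      then show ?thesis ..
    qed
    moreover have "\<exists>\<gamma>>0. \<forall>x\<in>{a<..<b}. \<gamma> \<le> inverse \<bar>deriv T x\<bar>"
      using low M(1) by (intro exI[of _ "inverse M"]) auto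
    moreover have "\<forall>x\<in>{a<..<b}. (T has_real_derivative deriv T x) (at x) \<and> deriv T x \<noteq> 0"
      using D dT nz by auto
    ultimately show ?thesis unfolding branch_def by blast
  qed
  moreover have "finite Z" using P(1) by (simp add: Z_def)
  moreover have "Z \<subseteq> {0..1}" using JI by (auto simp: Z_def)
  ultimately show ?thesis unfolding piecewise_branches_def
    by (intro exI[of _ Z]) (auto simp: Z_def)
qed

text \<open>By the chain rule the weights multiply, and so do their lower bounds.\<close>

lemma branch_compose:
  assumes S: "branch S a b" and T: "branch T c d" and im: "S ` {a<..<b} \<subseteq> {c<..<d}"
  shows "branch (T \<circ> S) a b"
proof -
  obtain s where s: "s = 1 \<or> s = -1"
    "\<And>x y. x \<in> {a<..<b} \<Longrightarrow> y \<in> {a<..<b} \<Longrightarrow> x < y \<Longrightarrow> s * S x < s * S y"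
    using branch_sign[OF S] by blast
  have im': "S x \<in> {c<..<d}" if "x \<in> {a<..<b}" for x using im that by blast
  have dS: "(S has_real_derivative deriv S x) (at x)" "deriv S x \<noteq> 0" if "x \<in> {a<..<b}" for x
    using S that unfolding branch_def by auto
  have dT: "(T has_real_derivative deriv T x) (at x)" "deriv T x \<noteq> 0" if "x \<in> {c<..<d}" for x
    using T that unfolding branch_def by auto
  have D: "((T \<circ> S) has_real_derivative deriv T (S x) * deriv S x) (at x)" if "x \<in> {a<..<b}" for x
    by (rule DERIV_chain[OF dT(1)[OF im'[OF that]] dS(1)[OF that]])
  have d: "deriv (T \<circ> S) x = deriv T (S x) * deriv S x" if "x \<in> {a<..<b}" for x
    by (rule DERIV_imp_deriv[OF D[OF that]])
  obtain \<gamma>S where gS: "\<gamma>S > 0" "\<And>x. x \<in> {a<..<b} \<Longrightarrow> \<gamma>S \<le> inverse \<bar>deriv S x\<bar>"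
    using S unfolding branch_def by blast
  obtain \<gamma>T where gT: "\<gamma>T > 0" "\<And>x. x \<in> {c<..<d} \<Longrightarrow> \<gamma>T \<le> inverse \<bar>deriv T x\<bar>"
    using T unfolding branch_def by blast
  note g = gS gT
  have low: "\<gamma>T * \<gamma>S \<le> inverse \<bar>deriv (T \<circ> S) x\<bar>" if "x \<in> {a<..<b}" for x
    using mult_mono[OF g(4)[OF im'[OF that]] g(2)[OF that]] g(1,3) by (simp add: d[OF that] abs_mult)
  obtain FS KS where FS: "dominated {a<..<b} (\<lambda>x. inverse \<bar>deriv S x\<bar>) FS" "\<And>x. x \<in> {a<..<b} \<Longrightarrow> \<bar>FS x\<bar> \<le> KS"
    using S unfolding branch_def by blast
  obtain FT KT where FT: "dominated {c<..<d} (\<lambda>x. inverse \<bar>deriv T x\<bar>) FT" "\<And>x. x \<in> {c<..<d} \<Longrightarrow> \<bar>FT x\<bar> \<le> KT"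
    using T unfolding branch_def by blast
  obtain BS where BS: "BS \<ge> 0" "\<And>x. x \<in> {a<..<b} \<Longrightarrow> \<bar>inverse \<bar>deriv S x\<bar>\<bar> \<le> BS"
    using dominated_bounded[OF FS] by blast
  obtain BT where BT: "BT \<ge> 0" "\<And>x. x \<in> {c<..<d} \<Longrightarrow> \<bar>inverse \<bar>deriv T x\<bar>\<bar> \<le> BT"
    using dominated_bounded[OF FT] by blast
  \<comment> \<open>The product rule for variations: each dominating function is scaled by a bound
    on the other factor. For decreasing \<open>S\<close> the function \<open>FT (S x)\<close>
    decreases, which the sign \<open>s\<close> corrects.\<close>
  define F where "F x = BS * (s * FT (S x)) + BT * FS x" for x
  have "dominated {a<..<b} (\<lambda>x. inverse \<bar>deriv (T \<circ> S) x\<bar>) F"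
    unfolding dominated_def
  proof (intro ballI impI)
    fix x y assume xy: "x \<in> {a<..<b}" "y \<in> {a<..<b}" "x \<le> y"
    have sle: "s * S x \<le> s * S y" using s(2)[OF xy(1,2)] xy(3) by (cases "x = y") auto
    have 1: "\<bar>inverse \<bar>deriv T (S y)\<bar> - inverse \<bar>deriv T (S x)\<bar>\<bar> \<le> s * FT (S y) - s * FT (S x)"
      using s(1)
    proof
      assume "s = 1"
      then show ?thesis using dominatedD[OF FT(1) im'[OF xy(1)] im'[OF xy(2)]] sle by simp
    next
      assume "s = -1"
      then show ?thesis using dominatedD[OF FT(1) im'[OF xy(2)] im'[OF xy(1)]] sle
        by (simp add: abs_minus_commute)
    qed
    have "\<bar>inverse \<bar>deriv T (S y)\<bar> * inverse \<bar>deriv S y\<bar> - inverse \<bar>deriv T (S x)\<bar> * inverse \<bar>deriv S x\<bar>\<bar>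
       \<le> BS * (s * FT (S y) - s * FT (S x)) + BT * (FS y - FS x)"
      by (rule abs_prod_diff_le[OF BS(2)[OF xy(2)] BT(2)[OF im'[OF xy(1)]] 1 dominatedD[OF FS(1) xy]])
    then show "\<bar>inverse \<bar>deriv (T \<circ> S) y\<bar> - inverse \<bar>deriv (T \<circ> S) x\<bar>\<bar> \<le> F y - F x"
      unfolding d[OF xy(1)] d[OF xy(2)] F_def by (simp add: abs_mult algebra_simps)
  qed
  moreover have "\<bar>F x\<bar> \<le> BS * KT + BT * KS" if "x \<in> {a<..<b}" for x
  proof -
    have "\<bar>F x\<bar> \<le> \<bar>BS * (s * FT (S x))\<bar> + \<bar>BT * FS x\<bar>" unfolding F_def by (rule abs_triangle_ineq)
    also have "\<dots> = BS * \<bar>FT (S x)\<bar> + BT * \<bar>FS x\<bar>" using s(1) BS(1) BT(1) by (auto simp: abs_mult)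
    also have "\<dots> \<le> BS * KT + BT * KS"
      using FT(2)[OF im'[OF that]] FS(2)[OF that] BS(1) BT(1) by (intro add_mono mult_left_mono) auto
    finally show ?thesis .
  qed
  moreover have "mono_on {a<..<b} (T \<circ> S) \<or> antimono_on {a<..<b} (T \<circ> S)"
  proof -
    have "(mono_on {c<..<d} T \<or> antimono_on {c<..<d} T) \<and> (mono_on {a<..<b} S \<or> antimono_on {a<..<b} S)"
      using S T unfolding branch_def by blast
    then show ?thesis using im' unfolding monotone_on_def comp_def by (elim conjE disjE) blast+
  qed
  ultimately show ?thesis
    unfolding branch_def using low g(1,3) D d dS dT im'
    by (intro conjI exI[of _ "\<gamma>T * \<gamma>S"] exI[of _ F] exI[of _ "BS * KT + BT * KS"]) auto
qed

text \<open>The new break points are the preimages of \<open>Y\<close>, finitely many because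
  \<open>S\<close> is injective on each gap of \<open>Z\<close>. An interval that avoids them has a
  connected image off \<open>Y\<close>, hence inside one gap of \<open>Y\<close>.\<close>

lemma piecewise_branches_compose:
  assumes S: "piecewise_branches S Z" and T: "piecewise_branches T Y" and SI: "S \<in> {0..1} \<rightarrow> {0..1}"
  shows "\<exists>Z'. piecewise_branches (T \<circ> S) Z'"
proof -
  note Z = piecewise_branchesD[OF S]
  note Y = piecewise_branchesD[OF T]
  define X where "X = {x \<in> {0..1} - Z. S x \<in> Y}"
  have "X \<subseteq> (\<Union>(a, b)\<in>comps Z. S -` Y \<inter> {a<..<b})"
  proof
    fix x assume x: "x \<in> X"
    then obtain a b where "(a, b) \<in> comps Z" "x \<in> {a<..<b}"
      using comps_cover[OF Z(1-3)] unfolding X_def by blast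
    with x show "x \<in> (\<Union>(a, b)\<in>comps Z. S -` Y \<inter> {a<..<b})" unfolding X_def by blast
  qed
  moreover have "finite (\<Union>(a, b)\<in>comps Z. S -` Y \<inter> {a<..<b})"
    using finite_vimage_IntI[OF Y(1) branch_inj_on[OF Z(5)]] finite_comps[OF Z(1)] by auto
  ultimately have "finite X" by (rule finite_subset)
  moreover have "branch (T \<circ> S) a b" if ab: "a < b" "{a<..<b} \<subseteq> {0..1} - (Z \<union> X)" for a b
  proof -
    have bS: "branch S a b" using S ab unfolding piecewise_branches_def by blast
    have SY: "S x \<in> {0..1} - Y" if "x \<in> {a<..<b}" for x
      using that ab(2) SI unfolding X_def by blast
    define u where "u = (a + b) / 2"
    have u: "u \<in> {a<..<b}" using ab(1) by (simp add: u_def field_simps)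
    obtain c d where cd: "(c, d) \<in> comps Y" "S u \<in> {c<..<d}" using comps_cover[OF Y(1-3) SY[OF u]] by blast
    have conn: "is_interval (S ` {a<..<b})"
      using connected_continuous_image[OF branch_continuous[OF bS]] by (simp add: is_interval_connected_1)
    have notin: "c \<notin> S ` {a<..<b}" "d \<notin> S ` {a<..<b}" using compsD[OF cd(1)] SY by blast+
    have "S x \<in> {c<..<d}" if x: "x \<in> {a<..<b}" for x
    proof (rule ccontr)
      assume "S x \<notin> {c<..<d}"
      then consider "S x \<le> c" | "d \<le> S x" by fastforce
      then show False
        using mem_is_interval_1_I[OF conn imageI[OF x] imageI[OF u], of c]
          mem_is_interval_1_I[OF conn imageI[OF u] imageI[OF x], of d] cd(2) notin by cases auto
    qed
    then show ?thesis by (intro branch_compose[OF bS Y(5)[OF cd(1)]]) blast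
  qed
  ultimately show ?thesis
    using Z(1-4) unfolding piecewise_branches_def X_def[symmetric]
    by (intro exI[of _ "Z \<union> X"]) (auto simp: X_def)
qed

lemma funpow_unit_interval:
  fixes T :: "real \<Rightarrow> real"
  assumes "T \<in> {0..1} \<rightarrow> {0..1}"
  shows "T ^^ n \<in> {0..1} \<rightarrow> {0..1}"
  by (induction n) (use assms in auto)

lemma piecewise_branches_funpow:
  assumes "piecewise_branches T Z" "T \<in> {0..1} \<rightarrow> {0..1}"
  shows "\<exists>Z'. piecewise_branches (T ^^ Suc n) Z'"
proof (induction n)
  case 0
  then show ?case using assms(1) by auto
next
  case (Suc n)
  then obtain Z' where "piecewise_branches (T ^^ Suc n) Z'" by blast
  from piecewise_branches_compose[OF this assms(1) funpow_unit_interval[OF assms(2)]]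
  show ?case unfolding funpow.simps(2)[of "Suc n"] .
qed

lemma measurable_funpow:
  assumes "T \<in> measurable M M"
  shows "T ^^ n \<in> measurable M M"
proof (induction n)
  case 0
  show ?case unfolding funpow.simps(1) id_def by (rule measurable_ident_sets) simp
next
  case (Suc n)
  show ?case unfolding funpow.simps(2) by (rule measurable_comp[OF Suc assms])
qed

text \<open>As \<open>F\<close> is increasing, the points at which \<open>F x / \<delta>\<close> has
  a given integer part form an interval, and boundedness of \<open>F\<close> leaves finitely many of
  them. The cuts are made at their right ends; large jumps of \<open>F\<close> then sit at cut
  points.\<close>

lemma dominated_level_points:
  assumes dom: "dominated {a<..<b} f F" and K: "\<And>x. x \<in> {a<..<b} \<Longrightarrow> \<bar>F x\<bar> \<le> K" and "\<delta> > 0" "a < b"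
  obtains Y where "finite Y" "Y \<subseteq> {a..b}"
    "\<And>x y. a < x \<Longrightarrow> x \<le> y \<Longrightarrow> y < b \<Longrightarrow> {x..y} \<inter> Y = {} \<Longrightarrow> F y - F x \<le> \<delta>"
proof -
  define level where "level x = \<lfloor>F x / \<delta>\<rfloor>" for x
  define t where "t j = Sup {x \<in> {a<..<b}. level x \<le> j}" for j
  define N where "N = \<lfloor>K / \<delta>\<rfloor>"
  define Lo where "Lo = \<lfloor>- K / \<delta>\<rfloor>"
  \<comment> \<open>\<open>Sup\<close> of an empty set is unspecified; the intersection discards
    such values outside \<open>{a..b}\<close>.\<close>
  define Y where "Y = (t ` {Lo..N}) \<inter> {a..b}"
  have "F y - F x \<le> \<delta>" if xy: "a < x" "x \<le> y" "y < b" "{x..y} \<inter> Y = {}" for x y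
  proof (cases "level x = level y")
    case True
    then have "F y / \<delta> - F x / \<delta> \<le> 1" unfolding level_def by linarith
    then show ?thesis using \<open>\<delta> > 0\<close> by (simp add: field_simps)
  next
    case False
    have mem: "x \<in> {a<..<b}" "y \<in> {a<..<b}" using xy by auto
    have "F x \<le> F y" using dominated_mono[OF dom mem xy(2)] .
    then have "level x \<le> level y" unfolding level_def using \<open>\<delta> > 0\<close> by (intro floor_mono divide_right_mono) auto
    with False have lt: "level x < level y" by simp
    have up: "z \<le> y" if "z \<in> {x \<in> {a<..<b}. level x \<le> level x'}" "level x' < level y" for z x'
    proof (rule ccontr)
      assume "\<not> z \<le> y"
      then have "F y \<le> F z" using dominated_mono[OF dom mem(2), of z] that by auto
      then have "level y \<le> level z" unfolding level_def using \<open>\<delta> > 0\<close> by (intro floor_mono divide_right_mono) auto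
      with that show False by auto
    qed
    have "x \<le> t (level x)" unfolding t_def
      by (rule cSup_upper) (use mem in \<open>auto intro!: bdd_aboveI[of _ b]\<close>)
    moreover have "t (level x) \<le> y" unfolding t_def
      by (rule cSup_least) (use mem up[OF _ lt] in auto)
    moreover have "level x \<in> {Lo..N}"
    proof -
      have "- K / \<delta> \<le> F x / \<delta>" "F x / \<delta> \<le> K / \<delta>"
        using K[OF mem(1)] \<open>\<delta> > 0\<close> by (intro divide_right_mono; linarith)+
      then show ?thesis unfolding level_def Lo_def N_def by (simp add: floor_mono)
    qed
    ultimately have "t (level x) \<in> {x..y} \<inter> Y" using xy unfolding Y_def by auto
    with xy(4) show ?thesis by blast
  qed
  moreover have "finite Y" "Y \<subseteq> {a..b}" unfolding Y_def by auto
  ultimately show ?thesis using that by blast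
qed

text \<open>Over a closed gap the variation of the weight, set to 0 at the break points, is its
  variation inside plus a jump at either end. Cutting at level points bounds the former, the
  hypothesis \<open>small\<close> the latter.\<close>

lemma refine_branches:
  assumes Z: "piecewise_branches S Z" and small: "\<And>x. x \<in> {0..1} - Z \<Longrightarrow> inverse \<bar>deriv S x\<bar> \<le> 1 / 16"
  obtains Z' where "piecewise_branches S Z'" "\<And>x. x \<in> {0..1} - Z' \<Longrightarrow> inverse \<bar>deriv S x\<bar> \<le> 1 / 16"
    "\<And>a b. (a, b) \<in> comps Z' \<Longrightarrow>
       \<exists>F. dominated {a..b} (\<lambda>x. if x \<in> Z' then 0 else inverse \<bar>deriv S x\<bar>) F \<and> F b - F a \<le> 1 / 4"
proof -
  note D = piecewise_branchesD[OF Z]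
  define Q where "Q = (\<lambda>(a, b) (F, Y). dominated {a<..<b} (\<lambda>x. inverse \<bar>deriv S x\<bar>) F \<and> finite Y \<and> Y \<subseteq> {a..b} \<and>
     (\<forall>x y. a < x \<longrightarrow> x \<le> y \<longrightarrow> y < b \<longrightarrow> {x..y} \<inter> Y = {} \<longrightarrow> F y - F x \<le> 1 / 16))"
  have "\<exists>q. Q c q" if cZ: "c \<in> comps Z" for c
  proof -
    obtain a b where c: "c = (a, b)" by force
    obtain F K where F: "dominated {a<..<b} (\<lambda>x. inverse \<bar>deriv S x\<bar>) F" "\<And>x. x \<in> {a<..<b} \<Longrightarrow> \<bar>F x\<bar> \<le> K"
      using D(5)[OF cZ[unfolded c]] unfolding branch_def by blast
    have d: "(0::real) < 1 / 16" by simp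
    obtain Y where "finite Y" "Y \<subseteq> {a..b}"
      "\<And>x y. a < x \<Longrightarrow> x \<le> y \<Longrightarrow> y < b \<Longrightarrow> {x..y} \<inter> Y = {} \<Longrightarrow> F y - F x \<le> 1 / 16"
      using dominated_level_points[OF F d compsD(3)[OF cZ[unfolded c]]] by blast
    then show ?thesis unfolding Q_def c using F(1) by (intro exI[of _ "(F, Y)"]) auto
  qed
  then obtain q where q: "\<And>c. c \<in> comps Z \<Longrightarrow> Q c (q c)" by metis
  define Z' where "Z' = Z \<union> (\<Union>c\<in>comps Z. snd (q c))"
  have fin: "finite Z'" unfolding Z'_def using D(1) finite_comps[OF D(1)] q by (fastforce simp: Q_def split: prod.splits)
  have sub: "Z' \<subseteq> {0..1}"
  proof -
    have "snd (q (a, b)) \<subseteq> {0..1}" if "(a, b) \<in> comps Z" for a b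
    proof -
      have "snd (q (a, b)) \<subseteq> {a..b}" using q[OF that] by (auto simp: Q_def split: prod.splits)
      moreover have "{a..b} \<subseteq> {0..1}" using compsD[OF that] D(4) by auto
      ultimately show ?thesis by blast
    qed
    then show ?thesis unfolding Z'_def using D(4) by fast
  qed
  have pb: "piecewise_branches S Z'"
    using Z fin sub unfolding piecewise_branches_def Z'_def by (auto simp: subset_iff)
  have small': "inverse \<bar>deriv S x\<bar> \<le> 1 / 16" if "x \<in> {0..1} - Z'" for x
    using small[of x] that unfolding Z'_def by auto
  have "\<exists>F. dominated {a..b} (\<lambda>x. if x \<in> Z' then 0 else inverse \<bar>deriv S x\<bar>) F \<and> F b - F a \<le> 1 / 4"
    if ab: "(a, b) \<in> comps Z'" for a b
  proof -
    note A = compsD[OF ab]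
    define u where "u = (a + b) / 2"
    have u: "u \<in> {a<..<b}" using A(3) by (simp add: u_def field_simps)
    have uZ: "u \<in> {0..1} - Z" using comps_subset[OF sub ab] u unfolding Z'_def by blast
    obtain c d where cd: "(c, d) \<in> comps Z" "u \<in> {c<..<d}" using comps_cover[OF D(1-3) uZ] by blast
    have "c \<notin> {a<..<b}" "d \<notin> {a<..<b}" using compsD[OF cd(1)] A(4) unfolding Z'_def by blast+
    then have le: "c \<le> a" "b \<le> d" using u cd(2) by auto
    obtain F Y where FY: "q (c, d) = (F, Y)" by force
    have Q: "dominated {c<..<d} (\<lambda>x. inverse \<bar>deriv S x\<bar>) F"
      "\<And>x y. c < x \<Longrightarrow> x \<le> y \<Longrightarrow> y < d \<Longrightarrow> {x..y} \<inter> Y = {} \<Longrightarrow> F y - F x \<le> 1 / 16"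
      using q[OF cd(1)] unfolding FY Q_def by auto
    have YZ: "Y \<subseteq> Z'" unfolding Z'_def using cd(1) FY by force
    have osc: "F y - F x \<le> 1 / 16" if "a < x" "x \<le> y" "y < b" for x y
    proof (rule Q(2))
      have "{x..y} \<subseteq> {a<..<b}" using that by auto
      then show "{x..y} \<inter> Y = {}" using A(4) YZ by blast
    qed (use that le in auto)
    have notZ: "x \<notin> Z'" if "a < x" "x < b" for x using A(4) that by auto
    have G: "0 \<le> inverse \<bar>deriv S x\<bar> \<and> inverse \<bar>deriv S x\<bar> \<le> 1 / 16" if "a < x" "x < b" for x
      using small'[of x] comps_subset[OF sub ab] that by auto
    \<comment> \<open>At either end the margin 1/8 absorbs a difference of at most 1/16 between
      \<open>F x\<close> and \<open>F u\<close> and a jump of the weight by at most 1/16; the two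
      margins add up to 1/4.\<close>
    define H where "H x = (if x = a then F u - 1 / 8 else if x = b then F u + 1 / 8 else F x)" for x
    have near: "\<bar>F x - F u\<bar> \<le> 1 / 16" if "a < x" "x < b" for x
    proof -
      have mono: "F v \<le> F w" if "a < v" "v \<le> w" "w < b" for v w
        using dominated_mono[OF Q(1), of v w] that le by auto
      show ?thesis
        using osc[of x u] osc[of u x] mono[of x u] mono[of u x] that u by (cases "x \<le> u") auto
    qed
    have "dominated {a..b} (\<lambda>x. if x \<in> Z' then 0 else inverse \<bar>deriv S x\<bar>) H"
      unfolding dominated_def
    proof (intro ballI impI)
      fix x y assume xy: "x \<in> {a..b}" "y \<in> {a..b}" "x \<le> y"
      consider "x = y" | "x = a" "y = b" | "x = a" "a < y" "y < b" | "a < x" "x < b" "y = b"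
        | "a < x" "y < b" "x < y"
        using xy by fastforce
      then show "\<bar>(if y \<in> Z' then 0 else inverse \<bar>deriv S y\<bar>) - (if x \<in> Z' then 0 else inverse \<bar>deriv S x\<bar>)\<bar> \<le> H y - H x"
      proof cases
        case 1
        then show ?thesis by simp
      next
        case 2
        then show ?thesis using A by (simp add: H_def)
      next
        case 3
        then show ?thesis using A notZ[OF 3(2,3)] G[OF 3(2,3)] near[OF 3(2,3)] abs_le_D2[OF near[OF 3(2,3)]] by (simp add: H_def)
      next
        case 4
        then show ?thesis using A notZ[OF 4(1,2)] G[OF 4(1,2)] abs_le_D1[OF near[OF 4(1,2)]] by (simp add: H_def)
      next
        case 5
        then show ?thesis using dominatedD[OF Q(1), of x y] le notZ[of x] notZ[of y] by (simp add: H_def)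
      qed
    qed
    moreover have "H b - H a \<le> 1 / 4" using A(3) by (simp add: H_def)
    ultimately show ?thesis by blast
  qed
  with pb small' show ?thesis by (rule that)
qed

section \<open>The transfer operator\<close>

lemma space_lebesgue_I: "space lebesgue_I = {0..1}"
  by (simp add: space_restrict_space)

lemma sets_lebesgue_I_eq: "sets lebesgue_I = sets borel_I"
  by (rule sets_restrict_space_cong) simp

lemma sets_lebesgue_I_iff: "A \<in> sets lebesgue_I \<longleftrightarrow> A \<in> sets borel \<and> A \<subseteq> {0..1}"
  unfolding sets_lebesgue_I_eq by (subst sets_restrict_space_iff) auto

lemma emeasure_lebesgue_I: "A \<subseteq> {0..1} \<Longrightarrow> emeasure lebesgue_I A = emeasure lborel A"
  by (rule emeasure_restrict_space) auto

lemma measure_lebesgue_I: "A \<subseteq> {0..1} \<Longrightarrow> measure lebesgue_I A = measure lborel A"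
  by (rule measure_restrict_space) auto

lemma prob_space_lebesgue_I: "prob_space lebesgue_I"
  by (rule prob_spaceI) (simp add: space_lebesgue_I emeasure_lebesgue_I)

interpretation lebI: prob_space lebesgue_I
  by (rule prob_space_lebesgue_I)

abbreviation mass :: "(real \<Rightarrow> real) \<Rightarrow> real set \<Rightarrow> real" where
  "mass f A \<equiv> set_lebesgue_integral lebesgue_I A f"

definition bv :: "(real \<Rightarrow> real) \<Rightarrow> real \<Rightarrow> bool" where
  "bv f V \<longleftrightarrow> (\<exists>F. dominated {0..1} f F \<and> F 1 - F 0 \<le> V)"

lemma bv_le: "bv f V \<Longrightarrow> V \<le> W \<Longrightarrow> bv f W"
  unfolding bv_def by force

lemma bv_bounded:
  assumes "bv f V"
  obtains B where "B \<ge> 0" "\<And>x. x \<in> {0..1} \<Longrightarrow> \<bar>f x\<bar> \<le> B"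
proof -
  obtain F where F: "dominated {0..1} f F" using assms unfolding bv_def by blast
  have "\<bar>F x\<bar> \<le> \<bar>F 0\<bar> + \<bar>F 1\<bar>" if "x \<in> {0..1}" for x
    using dominated_mono[OF F, of 0 x] dominated_mono[OF F, of x 1] that by auto
  from dominated_bounded[OF F this] that show ?thesis by blast
qed

text \<open>Jordan decomposition: \<open>f\<close> is the difference of the increasing functions
  \<open>F\<close> and \<open>F - f\<close>.\<close>

lemma bv_measurable:
  assumes "bv f V"
  shows "f \<in> borel_measurable lebesgue_I"
proof -
  obtain F where F: "dominated {0..1} f F" using assms unfolding bv_def by blast
  have "mono_on {0..1} F" using dominated_mono[OF F] by (intro mono_onI)
  moreover have "mono_on {0..1} (\<lambda>x. F x - f x)"
  proof (rule mono_onI)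
    fix x y :: real assume "x \<in> {0..1}" "y \<in> {0..1}" "x \<le> y"
    from dominatedD[OF F this] show "F x - f x \<le> F y - f y" by linarith
  qed
  ultimately have "F \<in> borel_measurable borel_I" "(\<lambda>x. F x - f x) \<in> borel_measurable borel_I"
    by (auto intro: borel_measurable_mono_on_fnc)
  then have "(\<lambda>x. F x - (F x - f x)) \<in> borel_measurable borel_I"
    by (rule borel_measurable_diff)
  then show ?thesis by (simp add: measurable_cong_sets[OF sets_lebesgue_I_eq refl])
qed

lemma bv_integrable: "bv f V \<Longrightarrow> integrable lebesgue_I f"
proof -
  assume f: "bv f V"
  obtain B where "\<And>x. x \<in> {0..1} \<Longrightarrow> \<bar>f x\<bar> \<le> B" using bv_bounded[OF f] by blast
  then show ?thesis
    by (intro lebI.integrable_const_bound[of _ B] AE_I2 bv_measurable[OF f]) (simp add: space_lebesgue_I)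
qed

lemma integrable_imp_set_integrable:
  "integrable lebesgue_I f \<Longrightarrow> A \<in> sets lebesgue_I \<Longrightarrow> set_integrable lebesgue_I A (f :: real \<Rightarrow> real)"
  unfolding set_integrable_def by (rule integrable_mult_indicator)

lemma bv_set_integrable: "bv f V \<Longrightarrow> A \<in> sets lebesgue_I \<Longrightarrow> set_integrable lebesgue_I A f"
  by (intro integrable_imp_set_integrable bv_integrable)

lemma bv_const: "bv (\<lambda>_. c) 0"
  unfolding bv_def dominated_def by (rule exI[of _ "\<lambda>_. 0"]) simp

lemma bv_max: "bv f V \<Longrightarrow> bv (\<lambda>x. max 0 (f x)) V"
  unfolding bv_def dominated_def
  by (smt (verit, best))

lemma bv_affine:
  assumes "bv f V" "r \<ge> 0"
  shows "bv (\<lambda>x. r * (f x - c)) (r * V)"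
proof -
  obtain F where F: "dominated {0..1} f F" "F 1 - F 0 \<le> V" using assms unfolding bv_def by blast
  have "dominated {0..1} (\<lambda>x. r * (f x - c)) (\<lambda>x. r * F x)"
    unfolding dominated_def
  proof (intro ballI impI)
    fix x y :: real assume xy: "x \<in> {0..1}" "y \<in> {0..1}" "x \<le> y"
    have "\<bar>r * (f y - c) - r * (f x - c)\<bar> = r * \<bar>f y - f x\<bar>"
      using assms(2) by (simp add: abs_mult flip: right_diff_distrib)
    also have "\<dots> \<le> r * (F y - F x)"
      using dominatedD[OF F(1) xy] assms(2) by (rule mult_left_mono)
    finally show "\<bar>r * (f y - c) - r * (f x - c)\<bar> \<le> r * F y - r * F x"
      by (simp add: right_diff_distrib)
  qed
  moreover have "r * F 1 - r * F 0 \<le> r * V"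
    using mult_left_mono[OF F(2) assms(2)] by (simp add: right_diff_distrib)
  ultimately show ?thesis unfolding bv_def by blast
qed

section \<open>Integrals over subsets of the unit interval\<close>

lemma mass_mono:
  assumes "integrable lebesgue_I f" "integrable lebesgue_I g" "A \<in> sets lebesgue_I" "\<And>x. x \<in> A \<Longrightarrow> f x \<le> g x"
  shows "mass f A \<le> mass g A"
  by (rule set_integral_mono) (use assms integrable_imp_set_integrable in auto)

lemma mass_const: "A \<in> sets lebesgue_I \<Longrightarrow> mass (\<lambda>_. c) A = c * measure lebesgue_I A"
  by (subst set_integral_const) (auto simp: lebI.emeasure_eq_measure)

lemma mass_nonneg:
  assumes "integrable lebesgue_I f" "A \<in> sets lebesgue_I" "\<And>x. x \<in> A \<Longrightarrow> 0 \<le> f x"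
  shows "0 \<le> mass f A"
  using mass_mono[of "\<lambda>_. 0" f A] assms mass_const[OF assms(2), of 0] by simp

lemma mass_mono_set:
  assumes "integrable lebesgue_I f" "A \<in> sets lebesgue_I" "B \<in> sets lebesgue_I" "A \<subseteq> B" "\<And>x. x \<in> B \<Longrightarrow> 0 \<le> f x"
  shows "mass f A \<le> mass f B"
proof -
  have "mass f (A \<union> (B - A)) = mass f A + mass f (B - A)"
    by (rule set_integral_Un) (use assms integrable_imp_set_integrable in auto)
  moreover have "0 \<le> mass f (B - A)" by (rule mass_nonneg) (use assms in auto)
  moreover have "A \<union> (B - A) = B" using assms(4) by blast
  ultimately show ?thesis by simp
qed

lemma mass_affine:
  assumes "integrable lebesgue_I f" "A \<in> sets lebesgue_I"
  shows "mass (\<lambda>x. c + r * f x) A = c * measure lebesgue_I A + r * mass f A"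
proof -
  have "mass (\<lambda>x. c + r * f x) A = mass (\<lambda>x. c) A + mass (\<lambda>x. r * f x) A"
    by (rule set_integral_add) (use assms integrable_imp_set_integrable in auto)
  then show ?thesis using mass_const[OF assms(2)] by simp
qed

text \<open>Passage to gauge integrals on the line, in which the change of variables formula behind
  \<open>mass_branch\<close> is stated.\<close>

lemma mass_absolutely_integrable:
  assumes "set_integrable lebesgue_I A f" "A \<in> sets lebesgue_I"
  shows "f absolutely_integrable_on A" "integral A f = mass f A"
proof -
  have A: "A \<in> sets borel" "A \<subseteq> {0..1}" using assms(2) sets_lebesgue_I_iff by auto
  have ind: "indicat_real {0..1} x * (indicat_real A x * f x) = indicat_real A x * f x" for x
    using A(2) by (auto split: split_indicator)
  have 1: "set_integrable lborel A f"
    using assms(1) unfolding set_integrable_def by (subst (asm) integrable_restrict_space) (auto simp: ind)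
  then show "f absolutely_integrable_on A"
    unfolding set_integrable_def by (subst integrable_completion) auto
  show "integral A f = mass f A"
    unfolding set_borel_integral_eq_integral(2)[OF 1, symmetric]
    unfolding set_lebesgue_integral_def by (subst integral_restrict_space) (auto simp: ind)
qed

lemma dominated_sum:
  assumes "\<And>c. c \<in> C \<Longrightarrow> dominated A (f c) (F c)"
  shows "dominated A (\<lambda>y. \<Sum>c\<in>C. f c y) (\<lambda>y. \<Sum>c\<in>C. F c y)"
  unfolding dominated_def
proof (intro ballI impI)
  fix x y assume xy: "x \<in> A" "y \<in> A" "x \<le> y"
  have "\<bar>(\<Sum>c\<in>C. f c y) - (\<Sum>c\<in>C. f c x)\<bar> \<le> (\<Sum>c\<in>C. \<bar>f c y - f c x\<bar>)"
    unfolding sum_subtractf[symmetric] by (rule sum_abs)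
  also have "\<dots> \<le> (\<Sum>c\<in>C. F c y - F c x)"
    using dominatedD[OF assms xy] by (intro sum_mono)
  finally show "\<bar>(\<Sum>c\<in>C. f c y) - (\<Sum>c\<in>C. f c x)\<bar> \<le> (\<Sum>c\<in>C. F c y) - (\<Sum>c\<in>C. F c x)"
    by (simp add: sum_subtractf)
qed

lemma dominated_mult:
  assumes "dominated A f F" "dominated A g G" "\<And>x. x \<in> A \<Longrightarrow> \<bar>f x\<bar> \<le> K" "\<And>x. x \<in> A \<Longrightarrow> \<bar>g x\<bar> \<le> L"
  shows "dominated A (\<lambda>x. f x * g x) (\<lambda>x. L * F x + K * G x)"
  unfolding dominated_def
proof (intro ballI impI)
  fix x y assume xy: "x \<in> A" "y \<in> A" "x \<le> y"
  have "\<bar>f y * g y - f x * g x\<bar> \<le> L * (F y - F x) + K * (G y - G x)"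
    by (rule abs_prod_diff_le[OF assms(4)[OF xy(2)] assms(3)[OF xy(1)] dominatedD[OF assms(1) xy] dominatedD[OF assms(2) xy]])
  then show "\<bar>f y * g y - f x * g x\<bar> \<le> L * F y + K * G y - (L * F x + K * G x)"
    by (simp add: algebra_simps)
qed

lemma finite_null: "finite Y \<Longrightarrow> AE x in lebesgue_I. x \<notin> Y"
proof -
  assume "finite Y"
  then have "AE x in lborel. x \<notin> Y" by (intro AE_not_in finite_imp_null_set_lborel)
  then show ?thesis by (subst AE_restrict_space_iff) auto
qed

locale branched_map =
  fixes S :: "real \<Rightarrow> real" and Z :: "real set"
  assumes pb: "piecewise_branches S Z"
    and S_in: "S \<in> {0..1} \<rightarrow> {0..1}"
    and S_meas: "S \<in> measurable lebesgue_I lebesgue_I"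
begin

lemmas Z = piecewise_branchesD[OF pb]

text \<open>The value 0 at the break points lets a branch that is not onto end with a zero term, and
  it moves the resulting jump into the variation of the weight.\<close>

definition weight :: "real \<Rightarrow> real" where
  "weight x = (if x \<in> Z then 0 else inverse \<bar>deriv S x\<bar>)"

definition orient :: "real \<Rightarrow> real \<Rightarrow> real" where
  "orient a b = (SOME s. (s = 1 \<or> s = -1) \<and> (\<forall>x\<in>{a<..<b}. \<forall>y\<in>{a<..<b}. x < y \<longrightarrow> s * S x < s * S y))"

text \<open>The inverse branch is extended to a monotone function with the values \<open>a\<close> and \<open>b\<close> off the
  image, where the weight vanishes: no indicator function of the image is needed.\<close>

definition inv_branch :: "real \<Rightarrow> real \<Rightarrow> real \<Rightarrow> real" where
  "inv_branch a b y = Sup ({a} \<union> {x \<in> {a<..<b}. orient a b * S x \<le> orient a b * y})"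

text \<open>The Perron-Frobenius operator, the sum of \<open>f / |S'|\<close> over preimages,
  arranged by branches. Each summand is \<open>weight x * f x\<close> along a monotone path through
  one closed gap, the form that suits variation estimates.\<close>

definition transfer :: "(real \<Rightarrow> real) \<Rightarrow> real \<Rightarrow> real" where
  "transfer f y = (\<Sum>(a, b)\<in>comps Z. weight (inv_branch a b y) * f (inv_branch a b y))"

section \<open>Inverse branches\<close>

lemma weight_nonneg: "0 \<le> weight x"
  by (simp add: weight_def)

lemma comps_I:
  assumes "(a, b) \<in> comps Z"
  shows "{a..b} \<subseteq> {0..1}"
proof -
  have "a \<in> {0..1}" "b \<in> {0..1}" using compsD(1,2)[OF assms] Z(4) by blast+
  then show ?thesis by auto
qed

lemma comps_not_Z: "(a, b) \<in> comps Z \<Longrightarrow> x \<in> {a<..<b} \<Longrightarrow> x \<notin> Z"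
  using compsD(4)[of a b Z] by blast

lemma orient:
  assumes "(a, b) \<in> comps Z"
  shows "orient a b = 1 \<or> orient a b = -1"
    and "\<And>x y. x \<in> {a<..<b} \<Longrightarrow> y \<in> {a<..<b} \<Longrightarrow> x < y \<Longrightarrow> orient a b * S x < orient a b * S y"
proof -
  have "\<exists>s. (s = 1 \<or> s = -1) \<and> (\<forall>x\<in>{a<..<b}. \<forall>y\<in>{a<..<b}. x < y \<longrightarrow> s * S x < s * S y)"
    using branch_sign[OF Z(5)[OF assms]] by metis
  from someI_ex[OF this, folded orient_def]
  show "orient a b = 1 \<or> orient a b = -1"
    "\<And>x y. x \<in> {a<..<b} \<Longrightarrow> y \<in> {a<..<b} \<Longrightarrow> x < y \<Longrightarrow> orient a b * S x < orient a b * S y" by blast+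
qed

lemma inv_branch_bdd:
  assumes "(a, b) \<in> comps Z"
  shows "bdd_above ({a} \<union> {x \<in> {a<..<b}. orient a b * S x \<le> orient a b * y})"
  by (rule bdd_aboveI[of _ b]) (use compsD(3)[OF assms] in auto)

lemma inv_branch_in:
  assumes "(a, b) \<in> comps Z"
  shows "inv_branch a b y \<in> {a..b}"
proof -
  have "a \<le> inv_branch a b y"
    unfolding inv_branch_def by (rule cSup_upper[OF _ inv_branch_bdd[OF assms]]) simp
  moreover have "inv_branch a b y \<le> b"
    unfolding inv_branch_def by (rule cSup_least) (use compsD(3)[OF assms] in auto)
  ultimately show ?thesis by simp
qed

lemma inv_branch_mono:
  assumes "(a, b) \<in> comps Z" "orient a b * y \<le> orient a b * z"
  shows "inv_branch a b y \<le> inv_branch a b z"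
  unfolding inv_branch_def
  by (rule cSup_subset_mono[OF _ inv_branch_bdd[OF assms(1)]]) (use assms(2) in auto)

lemma inv_branch_image:
  assumes ab: "(a, b) \<in> comps Z" and x: "x \<in> {a<..<b}"
  shows "inv_branch a b (S x) = x"
  unfolding inv_branch_def
proof (rule cSup_eq_maximum)
  show "x \<in> {a} \<union> {u \<in> {a<..<b}. orient a b * S u \<le> orient a b * S x}" using x by simp
  fix u assume u: "u \<in> {a} \<union> {u \<in> {a<..<b}. orient a b * S u \<le> orient a b * S x}"
  show "u \<le> x"
  proof (rule ccontr)
    assume "\<not> u \<le> x"
    then have "u \<in> {a<..<b}" "x < u" using u x by auto
    with orient(2)[OF ab x, of u] u show False by auto
  qed
qed

text \<open>The image of the gap is connected, so a point \<open>y\<close> off the image lies on one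
  side of all of it. The set under the supremum then consists of \<open>a\<close> alone or contains
  the whole gap.\<close>

lemma inv_branch_off:
  assumes ab: "(a, b) \<in> comps Z" and y: "y \<notin> S ` {a<..<b}"
  shows "inv_branch a b y = a \<or> inv_branch a b y = b"
proof -
  define s where "s = orient a b"
  have s: "s = 1 \<or> s = -1" unfolding s_def by (rule orient(1)[OF ab])
  let ?X = "{x \<in> {a<..<b}. s * S x \<le> s * y}"
  show ?thesis
  proof (cases "?X = {}")
    case True
    then have "inv_branch a b y = Sup {a}" unfolding inv_branch_def s_def by (simp only: Un_empty_right)
    then show ?thesis by simp
  next
    case False
    then obtain u where u: "u \<in> {a<..<b}" "s * S u \<le> s * y" by blast
    have conn: "is_interval (S ` {a<..<b})"
      using connected_continuous_image[OF branch_continuous[OF Z(5)[OF ab]]] by (simp add: is_interval_connected_1)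
    have "s * S x \<le> s * y" if x: "x \<in> {a<..<b}" for x
    proof (rule ccontr)
      assume "\<not> s * S x \<le> s * y"
      with u(2) s have "S u \<le> y \<and> y \<le> S x \<or> S x \<le> y \<and> y \<le> S u" by auto
      then show False
        using mem_is_interval_1_I[OF conn imageI[OF u(1)] imageI[OF x]]
          mem_is_interval_1_I[OF conn imageI[OF x] imageI[OF u(1)]] y by blast
    qed
    then have "?X = {a<..<b}" by blast
    moreover have "{a} \<union> {a<..<b} = {a..<b}" using compsD(3)[OF ab] by auto
    ultimately have "inv_branch a b y = Sup {a..<b}" unfolding inv_branch_def s_def by simp
    also have "\<dots> = b" using compsD(3)[OF ab] by simp
    finally show ?thesis by simp
  qed
qed

lemma inv_branch_inside_iff:
  assumes ab: "(a, b) \<in> comps Z"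
  shows "inv_branch a b y \<in> {a<..<b} \<longleftrightarrow> y \<in> S ` {a<..<b}"
proof
  assume "inv_branch a b y \<in> {a<..<b}"
  then have "inv_branch a b y \<noteq> a" "inv_branch a b y \<noteq> b" by auto
  then show "y \<in> S ` {a<..<b}" using inv_branch_off[OF ab] by blast
qed (auto simp: inv_branch_image[OF ab])

lemma weight_inv_branch_off:
  assumes ab: "(a, b) \<in> comps Z" and y: "y \<notin> S ` {a<..<b}"
  shows "weight (inv_branch a b y) = 0"
  using inv_branch_off[OF assms] compsD(1,2)[OF ab] by (auto simp: weight_def)

lemma inv_branch_measurable:
  assumes ab: "(a, b) \<in> comps Z"
  shows "inv_branch a b \<in> borel_measurable borel"
  using orient(1)[OF ab]
proof
  assume "orient a b = 1"
  then have "mono (inv_branch a b)" using inv_branch_mono[OF ab] by (intro monoI) simp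
  then show ?thesis by (rule borel_measurable_mono)
next
  assume "orient a b = -1"
  then have "mono (\<lambda>y. - inv_branch a b y)" using inv_branch_mono[OF ab] by (intro monoI) simp
  then have "(\<lambda>y. - inv_branch a b y) \<in> borel_measurable borel" by (rule borel_measurable_mono)
  then have "(\<lambda>y. - (- inv_branch a b y)) \<in> borel_measurable borel" by (rule borel_measurable_uminus)
  then show ?thesis by simp
qed

lemma weight_dominated:
  assumes ab: "(a, b) \<in> comps Z"
  obtains G where "dominated {a..b} weight G"
proof -
  obtain F K where F: "dominated {a<..<b} (\<lambda>x. inverse \<bar>deriv S x\<bar>) F" "\<And>x. x \<in> {a<..<b} \<Longrightarrow> \<bar>F x\<bar> \<le> K"
    using Z(5)[OF ab] unfolding branch_def by blast
  obtain B where B: "B \<ge> 0" "\<And>x. x \<in> {a<..<b} \<Longrightarrow> \<bar>inverse \<bar>deriv S x\<bar>\<bar> \<le> B"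
    using dominated_bounded[OF F] by blast
  note A = compsD[OF ab]
  have "(a + b) / 2 \<in> {a<..<b}" using A(3) by (simp add: field_simps)
  from F(2)[OF this] have K: "0 \<le> K" by linarith
  have FK: "F x \<le> K" "- K \<le> F x" "weight x = inverse \<bar>deriv S x\<bar>" "\<bar>weight x\<bar> \<le> B"
    if "a < x" "x < b" for x
    using F(2)[of x] B(2)[of x] comps_not_Z[OF ab, of x] that by (auto simp: weight_def)
  have W: "weight a = 0" "weight b = 0" using A(1,2) by (simp_all add: weight_def)
  \<comment> \<open>\<open>K\<close> bounds the values of \<open>F\<close> and \<open>B\<close> the
    jump of the weight to 0; the end values leave room for both.\<close>
  define H where "H x = (if x = a then - K - B else if x = b then K + B else F x)" for x
  have "dominated {a..b} weight H"
    unfolding dominated_def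
  proof (intro ballI impI)
    fix x y assume xy: "x \<in> {a..b}" "y \<in> {a..b}" "x \<le> y"
    consider "x = y" | "x = a" "y = b" | "x = a" "a < y" "y < b" | "a < x" "x < b" "y = b"
      | "a < x" "y < b" "x < y"
      using xy by fastforce
    then show "\<bar>weight y - weight x\<bar> \<le> H y - H x"
    proof cases
      case 1
      then show ?thesis by simp
    next
      case 2
      then show ?thesis using A(3) W K B(1) by (simp add: H_def)
    next
      case 3
      then show ?thesis using FK(2,4)[OF 3(2,3)] W by (simp add: H_def)
    next
      case 4
      then show ?thesis using FK(1,4)[OF 4(1,2)] W A(3) by (simp add: H_def)
    next
      case 5
      then show ?thesis using dominatedD[OF F(1), of x y] FK(3)[of x] FK(3)[of y] by (simp add: H_def)
    qed
  qed
  then show ?thesis by (rule that)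
qed

text \<open>Composition with a monotone map into the closed gap does not increase the variation. On
  a decreasing branch \<open>H\<close> decreases along the inverse, and \<open>orient\<close>
  restores the direction.\<close>

lemma branch_term_dominated:
  assumes ab: "(a, b) \<in> comps Z" and dom: "dominated {a..b} (\<lambda>x. weight x * f x) H"
  shows "dominated A (\<lambda>y. weight (inv_branch a b y) * f (inv_branch a b y))
      (\<lambda>y. orient a b * H (inv_branch a b y))"
    and "orient a b * H (inv_branch a b 1) - orient a b * H (inv_branch a b 0) \<le> H b - H a"
proof -
  have in': "inv_branch a b y \<in> {a..b}" for y by (rule inv_branch_in[OF ab])
  show "dominated A (\<lambda>y. weight (inv_branch a b y) * f (inv_branch a b y)) (\<lambda>y. orient a b * H (inv_branch a b y))"
    unfolding dominated_def
  proof (intro ballI impI)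
    fix x y :: real assume "x \<le> y"
    show "\<bar>weight (inv_branch a b y) * f (inv_branch a b y) - weight (inv_branch a b x) * f (inv_branch a b x)\<bar>
      \<le> orient a b * H (inv_branch a b y) - orient a b * H (inv_branch a b x)"
      using orient(1)[OF ab]
    proof
      assume "orient a b = 1"
      then show ?thesis using dominatedD[OF dom in' in' inv_branch_mono[OF ab, of x y]] \<open>x \<le> y\<close> by simp
    next
      assume "orient a b = -1"
      then show ?thesis using dominatedD[OF dom in' in' inv_branch_mono[OF ab, of y x]] \<open>x \<le> y\<close> by simp
    qed
  qed
  have mono: "H x \<le> H y" if "x \<in> {a..b}" "y \<in> {a..b}" "x \<le> y" for x y
    using dominated_mono[OF dom that] .
  have "H a \<le> H (inv_branch a b y)" "H (inv_branch a b y) \<le> H b" for y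
    using in'[of y] compsD(3)[OF ab] by (intro mono; simp)+
  from this[of 0] this[of 1] show "orient a b * H (inv_branch a b 1) - orient a b * H (inv_branch a b 0) \<le> H b - H a"
    using orient(1)[OF ab] by auto
qed

lemma branch_term_bv:
  assumes ab: "(a, b) \<in> comps Z" and f: "bv f V"
  obtains H where "dominated {a..b} (\<lambda>x. weight x * f x) H"
proof -
  obtain F where F: "dominated {0..1} f F" using f unfolding bv_def by blast
  obtain B where B: "\<And>x. x \<in> {0..1} \<Longrightarrow> \<bar>f x\<bar> \<le> B" using bv_bounded[OF f] by blast
  obtain G where G: "dominated {a..b} weight G" using weight_dominated[OF ab] .
  have "\<bar>G x\<bar> \<le> \<bar>G a\<bar> + \<bar>G b\<bar>" if "x \<in> {a..b}" for x
    using dominated_mono[OF G, of a x] dominated_mono[OF G, of x b] that by auto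
  then obtain L where L: "\<And>x. x \<in> {a..b} \<Longrightarrow> \<bar>weight x\<bar> \<le> L" using dominated_bounded[OF G] by metis
  have "dominated {a..b} (\<lambda>x. weight x * f x) (\<lambda>x. B * G x + L * F x)"
    by (rule dominated_mult[OF G dominated_subset[OF F comps_I[OF ab]] L]) (use B comps_I[OF ab] in auto)
  then show ?thesis by (rule that)
qed

lemma transfer_dominated:
  assumes "\<And>a b. (a, b) \<in> comps Z \<Longrightarrow> dominated {a..b} (\<lambda>x. weight x * f x) (H a b)"
  shows "bv (transfer f) (\<Sum>(a, b)\<in>comps Z. H a b b - H a b a)"
proof -
  let ?F = "\<lambda>y. \<Sum>(a, b)\<in>comps Z. orient a b * H a b (inv_branch a b y)"
  have "dominated {0..1} (transfer f) ?F"
    unfolding transfer_def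
    by (rule dominated_sum) (auto intro: branch_term_dominated(1) assms)
  moreover have "?F 1 - ?F 0 \<le> (\<Sum>(a, b)\<in>comps Z. H a b b - H a b a)"
    unfolding sum_subtractf[symmetric]
    by (rule sum_mono) (use branch_term_dominated(2)[OF _ assms] in auto)
  ultimately show ?thesis unfolding bv_def by blast
qed

lemma transfer_bv:
  assumes "bv f V"
  shows "\<exists>W. bv (transfer f) W"
proof -
  have "\<forall>a b. \<exists>H. (a, b) \<in> comps Z \<longrightarrow> dominated {a..b} (\<lambda>x. weight x * f x) H"
    using branch_term_bv[OF _ assms] by blast
  then have "\<exists>H. \<forall>a b. (a, b) \<in> comps Z \<longrightarrow> dominated {a..b} (\<lambda>x. weight x * f x) (H a b)"
    by (simp only: choice_iff)
  then show ?thesis using transfer_dominated by blast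
qed

lemma transfer_nonneg:
  assumes "\<And>x. x \<in> {0..1} \<Longrightarrow> 0 \<le> f x"
  shows "0 \<le> transfer f y"
proof -
  have "0 \<le> weight (inv_branch a b y) * f (inv_branch a b y)" if "(a, b) \<in> comps Z" for a b
    using inv_branch_in[OF that, of y] comps_I[OF that] by (intro mult_nonneg_nonneg weight_nonneg assms) blast
  then show ?thesis unfolding transfer_def by (intro sum_nonneg) auto
qed

lemma transfer_lower:
  assumes "\<And>x. x \<in> {0..1} \<Longrightarrow> 0 \<le> f x" and x: "x \<in> {0..1} - Z"
  shows "weight x * f x \<le> transfer f (S x)"
proof -
  obtain a b where ab: "(a, b) \<in> comps Z" "x \<in> {a<..<b}" using comps_cover[OF Z(1-3) x] by blast
  let ?t = "\<lambda>(a, b). weight (inv_branch a b (S x)) * f (inv_branch a b (S x))"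
  have "0 \<le> ?t (c, d)" if "(c, d) \<in> comps Z" for c d
    using inv_branch_in[OF that, of "S x"] comps_I[OF that] by (auto intro!: mult_nonneg_nonneg weight_nonneg assms)
  then have "?t (a, b) \<le> transfer f (S x)"
    unfolding transfer_def by (intro member_le_sum finite_comps Z(1) ab(1)) auto
  then show ?thesis using inv_branch_image[OF ab] by simp
qed

section \<open>Duality between the transfer operator and preimages\<close>

lemma preimage_sets: "A \<in> sets lebesgue_I \<Longrightarrow> S -` A \<inter> {0..1} \<in> sets lebesgue_I"
  using measurable_sets[OF S_meas] by (simp only: space_lebesgue_I)

lemma mass_branch:
  assumes f: "bv f V" and A: "A \<in> sets lebesgue_I" and ab: "(a, b) \<in> comps Z"
  shows "mass f (S -` A \<inter> {a<..<b}) = mass (\<lambda>y. weight (inv_branch a b y) * f (inv_branch a b y)) A"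
proof -
  let ?w = "\<lambda>y. weight (inv_branch a b y) * f (inv_branch a b y)"
  define X where "X = S -` A \<inter> {a<..<b}"
  define Y where "Y = S ` X"
  have ab01: "{a<..<b} \<subseteq> {0..1}" using comps_I[OF ab] by force
  have Xeq: "X = (S -` A \<inter> {0..1}) \<inter> {a<..<b}" unfolding X_def using ab01 by blast
  have X: "X \<in> sets lebesgue_I" unfolding Xeq
    by (rule sets.Int[OF preimage_sets[OF A]]) (use ab01 sets_lebesgue_I_iff in auto)
  have Yeq: "Y = A \<inter> (inv_branch a b -` {a<..<b} \<inter> space borel)"
    unfolding Y_def X_def using inv_branch_inside_iff[OF ab] by auto
  have Y: "Y \<in> sets lebesgue_I"
    using A measurable_sets[OF inv_branch_measurable[OF ab], of "{a<..<b}"]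
    unfolding Yeq sets_lebesgue_I_iff by auto
  obtain H where H: "dominated {a..b} (\<lambda>x. weight x * f x) H" using branch_term_bv[OF ab f] .
  have w: "bv ?w (H b - H a)" unfolding bv_def using branch_term_dominated[OF ab H] by blast
  have D: "(S has_field_derivative deriv S x) (at x within X)" "deriv S x \<noteq> 0" if "x \<in> X" for x
    using Z(5)[OF ab] that unfolding branch_def X_def by (auto intro: has_field_derivative_at_within)
  have inj: "inj_on S X" using branch_inj_on[OF Z(5)[OF ab]] unfolding X_def by (rule inj_on_subset) blast
  have Xleb: "X \<in> sets lebesgue" using X sets_lebesgue_I_iff by (auto intro: sets_completionI_sets)
  \<comment> \<open>The weight cancels the Jacobian, so \<open>f\<close> takes the form required by
    the substitution \<open>y = S x\<close>.\<close>
  have eq: "\<bar>deriv S x\<bar> * ?w (S x) = f x" if "x \<in> X" for x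
  proof -
    have x: "x \<in> {a<..<b}" using that unfolding X_def by blast
    show ?thesis using D(2)[OF that] comps_not_Z[OF ab x] unfolding inv_branch_image[OF ab x] weight_def by simp
  qed
  note fX = mass_absolutely_integrable[OF bv_set_integrable[OF f X] X]
  have "(\<lambda>x. \<bar>deriv S x\<bar> * ?w (S x)) absolutely_integrable_on X"
    using fX(1) eq by (subst set_integrable_cong[OF refl refl]) auto
  moreover have "integral X (\<lambda>x. \<bar>deriv S x\<bar> * ?w (S x)) = mass f X"
    using fX(2) eq by (subst Henstock_Kurzweil_Integration.integral_cong[of X _ f]) auto
  ultimately have "integral Y ?w = mass f X"
    using has_absolute_integral_change_of_variables_1'[where f = ?w and b = "mass f X", OF Xleb D(1) inj]
    unfolding Y_def by blast
  then have "mass ?w Y = mass f X"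
    using mass_absolutely_integrable(2)[OF bv_set_integrable[OF w Y] Y] by simp
  \<comment> \<open>Points of \<open>A\<close> outside the image of the gap contribute nothing,
    because the weight vanishes there.\<close>
  moreover have "mass ?w Y = mass ?w A"
  proof -
    have "indicator Y y *\<^sub>R ?w y = indicator A y *\<^sub>R ?w y" for y
    proof (cases "y \<in> A - Y")
      case True
      then have "y \<notin> S ` {a<..<b}" unfolding Y_def X_def by blast
      then show ?thesis using weight_inv_branch_off[OF ab] by simp
    qed (use Yeq in \<open>auto split: split_indicator\<close>)
    then show ?thesis
      unfolding set_lebesgue_integral_def by (intro Bochner_Integration.integral_cong refl)
  qed
  ultimately show ?thesis unfolding X_def by simp
qed

text \<open>Summation of \<open>mass_branch\<close> over the gaps, which cover the unit interval up
  to the null set \<open>Z\<close>.\<close>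

lemma mass_transfer:
  assumes f: "bv f V" and A: "A \<in> sets lebesgue_I"
  shows "mass (transfer f) A = mass f (S -` A \<inter> {0..1})"
proof -
  let ?B = "\<lambda>(a, b). S -` A \<inter> {a<..<b}"
  let ?w = "\<lambda>(a, b) y. weight (inv_branch a b y) * f (inv_branch a b y)"
  have B: "?B c \<in> sets lebesgue_I" if c: "c \<in> comps Z" for c
  proof -
    obtain a b where ab: "c = (a, b)" by force
    have ab01: "{a<..<b} \<subseteq> {0..1}" using comps_I c ab by force
    have eq: "?B c = (S -` A \<inter> {0..1}) \<inter> {a<..<b}" unfolding ab using ab01 by auto
    show ?thesis unfolding eq
      by (rule sets.Int[OF preimage_sets[OF A]]) (use ab01 sets_lebesgue_I_iff in auto)
  qed
  \<comment> \<open>Bounded variation of each summand provides its integrability; \<open>V'\<close>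
    just names some bound.\<close>
  have w: "bv (?w c) (V' c)" if "c \<in> comps Z" "V' = (\<lambda>(a, b). let H = SOME H. dominated {a..b} (\<lambda>x. weight x * f x) H in H b - H a)" for c V'
  proof -
    obtain a b where c: "c = (a, b)" by force
    have "\<exists>H. dominated {a..b} (\<lambda>x. weight x * f x) H" using branch_term_bv[OF _ f] that c by metis
    from branch_term_dominated[OF _ someI_ex[OF this]] that c show ?thesis unfolding bv_def Let_def by auto
  qed
  have "mass f (S -` A \<inter> {0..1}) = (LINT x|lebesgue_I. (\<Sum>c\<in>comps Z. indicator (?B c) x *\<^sub>R f x))"
    unfolding set_lebesgue_integral_def
  proof (rule integral_cong_AE)
    show "(\<lambda>x. indicator (S -` A \<inter> {0..1}) x *\<^sub>R f x) \<in> borel_measurable lebesgue_I"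
      using preimage_sets[OF A] bv_measurable[OF f] by measurable
    show "(\<lambda>x. \<Sum>c\<in>comps Z. indicator (?B c) x *\<^sub>R f x) \<in> borel_measurable lebesgue_I"
      using B bv_measurable[OF f] by (intro borel_measurable_sum borel_measurable_scaleR borel_measurable_indicator)
    show "AE x in lebesgue_I. indicator (S -` A \<inter> {0..1}) x *\<^sub>R f x = (\<Sum>c\<in>comps Z. indicator (?B c) x *\<^sub>R f x)"
      using finite_null[OF Z(1)] AE_space
    proof eventually_elim
      case (elim x)
      then have x: "x \<in> {0..1} - Z" by (simp add: space_lebesgue_I)
      obtain a b where ab: "(a, b) \<in> comps Z" "x \<in> {a<..<b}" using comps_cover[OF Z(1-3) x] by blast
      have "indicator (?B c) x *\<^sub>R f x = 0" if "c \<in> comps Z - {(a, b)}" for c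
        using comps_disjoint[OF ab(1) _ ab(2)] that by (auto split: split_indicator)
      then have "(\<Sum>c\<in>comps Z - {(a, b)}. indicator (?B c) x *\<^sub>R f x) = 0" by (rule sum.neutral[OF ballI])
      then have "(\<Sum>c\<in>comps Z. indicator (?B c) x *\<^sub>R f x) = indicator (?B (a, b)) x *\<^sub>R f x"
        using sum.remove[OF finite_comps[OF Z(1)] ab(1), of "\<lambda>c. indicator (?B c) x *\<^sub>R f x"] by simp
      then show ?case using ab(2) x by (auto split: split_indicator)
    qed
  qed
  also have "\<dots> = (\<Sum>c\<in>comps Z. mass f (?B c))"
    unfolding set_lebesgue_integral_def
    by (rule Bochner_Integration.integral_sum) (use bv_set_integrable[OF f B] in \<open>auto simp: set_integrable_def\<close>)
  also have "\<dots> = (\<Sum>c\<in>comps Z. mass (?w c) A)"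
    by (rule sum.cong) (use mass_branch[OF f A] in auto)
  also have "\<dots> = (LINT x|lebesgue_I. (\<Sum>c\<in>comps Z. indicator A x *\<^sub>R ?w c x))"
    unfolding set_lebesgue_integral_def
    by (rule Bochner_Integration.integral_sum[symmetric])
      (use bv_set_integrable[OF w[OF _ refl] A] in \<open>simp add: set_integrable_def\<close>)
  also have "\<dots> = mass (transfer f) A"
    unfolding set_lebesgue_integral_def transfer_def by (simp add: sum_distrib_left case_prod_unfold)
  finally show ?thesis by simp
qed

text \<open>Nonsingularity: by duality the measure of the preimage is the integral of
  \<open>transfer (\<lambda>_. 1)\<close> over the null set \<open>A\<close>.\<close>

lemma preimage_null:
  assumes "A \<in> null_sets lebesgue_I"
  shows "S -` A \<inter> {0..1} \<in> null_sets lebesgue_I"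
proof -
  have A: "A \<in> sets lebesgue_I" using assms by auto
  have "measure lebesgue_I (S -` A \<inter> {0..1}) = mass (transfer (\<lambda>_. 1)) A"
    using mass_transfer[OF bv_const A, of 1] mass_const[OF preimage_sets[OF A], of 1] by simp
  also have "\<dots> = 0"
    unfolding set_lebesgue_integral_def
    by (rule integral_eq_zero_AE) (use AE_not_in[OF assms] in \<open>auto elim: eventually_mono\<close>)
  finally have "emeasure lebesgue_I (S -` A \<inter> {0..1}) = 0" by (simp add: lebI.emeasure_eq_measure)
  then show ?thesis using preimage_sets[OF A] by auto
qed

lemma iterate_in: "x \<in> {0..1} \<Longrightarrow> (S ^^ k) x \<in> {0..1}"
  using funpow_unit_interval[OF S_in, of k] by auto

lemma iterate_preimage_Suc:
  "(S ^^ Suc k) -` A \<inter> {0..1} = (S ^^ k) -` (S -` A \<inter> {0..1}) \<inter> {0..1}"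
  using iterate_in by auto

lemma iterate_preimage_add:
  "(S ^^ (j + k)) -` A \<inter> {0..1} = (S ^^ k) -` ((S ^^ j) -` A \<inter> {0..1}) \<inter> {0..1}"
  using iterate_in by (auto simp: funpow_add)

lemma iterate_preimage_sets: "A \<in> sets lebesgue_I \<Longrightarrow> (S ^^ k) -` A \<inter> {0..1} \<in> sets lebesgue_I"
proof (induction k arbitrary: A)
  case 0
  then show ?case by (auto simp: sets_lebesgue_I_iff)
next
  case (Suc k)
  then show ?case unfolding iterate_preimage_Suc using preimage_sets by blast
qed

end

section \<open>Exponential convergence\<close>

lemma finite_pos_lower_bound:
  assumes "finite C" "\<And>c. c \<in> C \<Longrightarrow> 0 < (g c :: real)"
  obtains \<delta> where "0 < \<delta>" "\<delta> \<le> 1" "\<And>c. c \<in> C \<Longrightarrow> \<delta> \<le> g c"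
proof
  let ?\<delta> = "Min (insert 1 (g ` C))"
  show "0 < ?\<delta>" using assms by (subst Min_gr_iff) auto
  show "?\<delta> \<le> 1" using assms(1) by (intro Min_le) auto
  show "?\<delta> \<le> g c" if "c \<in> C" for c using assms(1) that by (intro Min_le) auto
qed

definition prob_density :: "real \<Rightarrow> (real \<Rightarrow> real) \<Rightarrow> bool" where
  "prob_density V f \<longleftrightarrow> (\<forall>x\<in>{0..1}. 0 \<le> f x) \<and> bv f V \<and> mass f {0..1} = 1"

lemma interval_sets_lebesgue_I [simp]:
  "0 \<le> a \<Longrightarrow> b \<le> 1 \<Longrightarrow> {a..b} \<in> sets lebesgue_I"
  "0 \<le> a \<Longrightarrow> b \<le> 1 \<Longrightarrow> {a<..b} \<in> sets lebesgue_I"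
  "0 \<le> a \<Longrightarrow> b \<le> 1 \<Longrightarrow> {a<..<b} \<in> sets lebesgue_I"
  unfolding sets_lebesgue_I_iff by auto

lemma mass_singleton:
  assumes "bv f V" "a \<in> {0..1}"
  shows "mass f {a..a} = 0"
proof -
  obtain B where B: "\<And>x. x \<in> {0..1} \<Longrightarrow> \<bar>f x\<bar> \<le> B" using bv_bounded[OF assms(1)] by blast
  have s: "{a..a} \<in> sets lebesgue_I" using assms(2) by (intro interval_sets_lebesgue_I) auto
  have m: "measure lebesgue_I {a..a} = 0" using assms(2) by (simp add: measure_lebesgue_I)
  have "mass f {a..a} \<le> mass (\<lambda>_. B) {a..a}"
    by (rule mass_mono[OF bv_integrable[OF assms(1)] _ s]) (use B assms(2) in \<open>auto simp: abs_le_iff\<close>)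
  moreover have "mass (\<lambda>_. - B) {a..a} \<le> mass f {a..a}"
    by (rule mass_mono[OF _ bv_integrable[OF assms(1)] s]) (use B[OF assms(2)] in \<open>auto simp: abs_le_iff\<close>)
  ultimately show ?thesis using mass_const[OF s, of B] mass_const[OF s, of "- B"] m by simp
qed

lemma mass_split:
  assumes "bv f V" "0 \<le> a" "a \<le> b" "b \<le> c" "c \<le> 1"
  shows "mass f {a<..c} = mass f {a<..b} + mass f {b<..c}"
proof -
  have "{a<..c} = {a<..b} \<union> {b<..c}" using assms by auto
  moreover have "mass f ({a<..b} \<union> {b<..c}) = mass f {a<..b} + mass f {b<..c}"
    by (rule set_integral_Un) (use assms in \<open>auto intro!: bv_set_integrable[OF assms(1)]\<close>)
  ultimately show ?thesis by simp
qed

lemma mass_Ioc: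
  assumes "bv f V"
  shows "mass f {0<..1} = mass f {0..1}"
proof -
  have "{0..1} = {0..0} \<union> {0<..1::real}" by auto
  moreover have "mass f ({0..0} \<union> {0<..1}) = mass f {0..0} + mass f {0<..1}"
    by (rule set_integral_Un) (auto intro!: bv_set_integrable[OF assms] interval_sets_lebesgue_I(1) simp del: atLeastAtMost_singleton)
  ultimately show ?thesis using mass_singleton[OF assms, of 0] by simp
qed

lemma measure_lebesgue_I_Ioc: "0 \<le> a \<Longrightarrow> a \<le> b \<Longrightarrow> b \<le> 1 \<Longrightarrow> measure lebesgue_I {a<..b} = b - a"
  by (subst measure_lebesgue_I) auto

text \<open>Otherwise \<open>f\<close> is below 1/2 at some point of every cell, hence at most 1/2
  plus its variation on that cell. As the cells have length 1/L, the total mass would be at most 1/2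
  + V/L \<le> 3/4.\<close>

lemma prob_density_large_cell:
  assumes f: "prob_density V f" and L: "V \<le> real L / 4" "L > 0"
  shows "\<exists>j<L. \<forall>x\<in>{real j / L..real (Suc j) / L}. 1 / 2 \<le> f x"
proof (rule ccontr)
  assume "\<not> ?thesis"
  then have ex: "\<exists>x\<in>{real j / L..real (Suc j) / L}. f x < 1 / 2" if "j < L" for j using that by force
  have fb: "bv f V" "mass f {0..1} = 1" using f unfolding prob_density_def by auto
  obtain F where F: "dominated {0..1} f F" "F 1 - F 0 \<le> V" using fb(1) unfolding bv_def by blast
  have cell: "mass f {real j / L<..real (Suc j) / L} \<le> (1 / 2 + (F (real (Suc j) / L) - F (real j / L))) / L"
    if j: "j < L" for j
  proof -
    define a b where "a = real j / L" and "b = real (Suc j) / L"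
    have ab: "0 \<le> a" "a \<le> b" "b \<le> 1" "b - a = 1 / L"
      using j L(2) by (auto simp: a_def b_def divide_simps)
    obtain u where u: "u \<in> {a..b}" "f u < 1 / 2" using ex[OF j] unfolding a_def b_def by blast
    have "f x \<le> 1 / 2 + (F b - F a)" if x: "x \<in> {a<..b}" for x
    proof -
      have I: "x \<in> {0..1}" "u \<in> {0..1}" "a \<in> {0..1}" "b \<in> {0..1}" using ab u x by auto
      have m: "F a \<le> F x" "F x \<le> F b" "F a \<le> F u" "F u \<le> F b"
        using dominated_mono[OF F(1)] I u x by auto
      have "\<bar>f x - f u\<bar> \<le> \<bar>F x - F u\<bar>"
        using dominatedD[OF F(1) I(1,2)] dominatedD[OF F(1) I(2,1)] by linarith
      then show ?thesis using m u(2) by linarith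
    qed
    then have "mass f {a<..b} \<le> mass (\<lambda>_. 1 / 2 + (F b - F a)) {a<..b}"
      using ab by (intro mass_mono bv_integrable[OF fb(1)]) auto
    also have "\<dots> = (1 / 2 + (F b - F a)) * (1 / L)"
      using ab by (subst mass_const) (auto simp: measure_lebesgue_I_Ioc)
    finally show ?thesis unfolding a_def b_def by simp
  qed
  have "mass f {0<..real n / L} \<le> (real n / 2 + (F (real n / L) - F 0)) / L" if "n \<le> L" for n
    using that
  proof (induction n)
    case 0
    then show ?case by (simp add: set_lebesgue_integral_def)
  next
    case (Suc n)
    have "mass f {0<..real (Suc n) / L} = mass f {0<..real n / L} + mass f {real n / L<..real (Suc n) / L}"
      using Suc.prems L(2) by (intro mass_split[OF fb(1)]) (auto simp: divide_simps)
    also have "\<dots> \<le> (real n / 2 + (F (real n / L) - F 0)) / L + (1 / 2 + (F (real (Suc n) / L) - F (real n / L))) / L"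
      using Suc.IH cell[of n] Suc.prems by (intro add_mono) auto
    also have "\<dots> = (real (Suc n) / 2 + (F (real (Suc n) / L) - F 0)) / L"
      unfolding add_divide_distrib[symmetric] by (rule arg_cong[where f = "\<lambda>t. t / real L"]) simp
    finally show ?case .
  qed
  from this[of L] have "1 \<le> (real L / 2 + (F 1 - F 0)) / L"
    using L(2) mass_Ioc[OF fb(1)] fb(2) by simp
  also have "\<dots> \<le> (real L / 2 + real L / 4) / L"
    using F(2) L by (intro divide_right_mono) auto
  also have "\<dots> < 1" using L(2) by (simp add: field_simps)
  finally show False by simp
qed

text \<open>The two constants produce the factor 1/4 + 1/16 = 5/16 in the Lasota-Yorke inequality.
  \<open>covering\<close> speaks of all large \<open>n\<close>, so that one iterate can serve
  finitely many intervals.\<close>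

locale expanding_map = branched_map +
  assumes weight_small: "x \<in> {0..1} \<Longrightarrow> weight x \<le> 1 / 16"
    and weight_variation: "(a, b) \<in> comps Z \<Longrightarrow> \<exists>G. dominated {a..b} weight G \<and> G b - G a \<le> 1 / 4"
    and covering: "0 \<le> a \<Longrightarrow> a < b \<Longrightarrow> b \<le> 1 \<Longrightarrow> \<exists>n0. \<forall>n\<ge>n0. (S ^^ n) ` {a..b} = {0..1}"
begin

definition lasota_yorke :: "real \<Rightarrow> bool" where
  "lasota_yorke B \<longleftrightarrow> 0 \<le> B \<and> (\<forall>f V. (\<forall>x\<in>{0..1}. 0 \<le> f x) \<longrightarrow> bv f V \<longrightarrow>
     bv (transfer f) (V / 2 + B * mass f {0..1}))"

text \<open>By the product rule a gap contributes at most 1/4 of the supremum of \<open>f\<close>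
  plus 1/16 of its variation there. The supremum is at most the variation on the gap plus the mean,
  and the shortest gap \<open>\<delta>\<close> bounds the mean by the mass, which gives
  \<open>B\<close>.\<close>

lemma lasota_yorke: "\<exists>B. lasota_yorke B"
proof -
  have "0 < snd c - fst c" if "c \<in> comps Z" for c
    using compsD(3)[of "fst c" "snd c" Z] that by simp
  then obtain \<delta> where \<delta>: "0 < \<delta>" "\<And>c. c \<in> comps Z \<Longrightarrow> \<delta> \<le> snd c - fst c"
    using finite_pos_lower_bound[OF finite_comps[OF Z(1)], of "\<lambda>c. snd c - fst c"] by metis
  define B where "B = 1 / (4 * \<delta>)"
  have B: "0 \<le> B" using \<delta>(1) by (simp add: B_def)
  obtain G where G: "\<And>a b. (a, b) \<in> comps Z \<Longrightarrow> dominated {a..b} weight (G a b) \<and> G a b b - G a b a \<le> 1 / 4"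
    using weight_variation by metis
  have "bv (transfer f) (V / 2 + B * mass f {0..1})" if nonneg: "\<And>x. x \<in> {0..1} \<Longrightarrow> 0 \<le> f x" and f: "bv f V" for f V
  proof -
    obtain F where F: "dominated {0..1} f F" "F 1 - F 0 \<le> V" using f unfolding bv_def by blast
    define s where "s a b = (F b - F a) + mass f {a<..b} / (b - a)" for a b
    define H where "H a b = (\<lambda>x. s a b * G a b x + (1 / 16) * F x)" for a b
    define m where "m t = mass f {0<..t}" for t
    \<comment> \<open>The contribution of each gap is at most the increment of this increasing
      function across it, so the sum is at most the total increment.\<close>
    define \<Phi> where "\<Phi> t = (5 / 16) * F t + B * m t" for t
    have bound: "dominated {a..b} (\<lambda>x. weight x * f x) (H a b) \<and> H a b b - H a b a \<le> \<Phi> b - \<Phi> a"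
      if ab: "(a, b) \<in> comps Z" for a b
    proof -
      have I: "0 \<le> a" "a < b" "b \<le> 1" using comps_I[OF ab] compsD(3)[OF ab] by auto
      have iF: "F a \<le> F b" using dominated_mono[OF F(1), of a b] I by auto
      have mass0: "0 \<le> mass f {a<..b}" using I nonneg by (intro mass_nonneg bv_integrable[OF f]) auto
      have s0: "0 \<le> s a b" unfolding s_def using iF mass0 I by simp
      have fs: "\<bar>f x\<bar> \<le> s a b" if x: "x \<in> {a..b}" for x
      proof -
        have "f x \<le> f y + (F b - F a)" if y: "y \<in> {a<..b}" for y
        proof -
          have J: "x \<in> {0..1}" "y \<in> {0..1}" "a \<in> {0..1}" "b \<in> {0..1}" using I x y by auto
          have "F a \<le> F x" "F x \<le> F b" "F a \<le> F y" "F y \<le> F b"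
            using dominated_mono[OF F(1)] J x y by auto
          then show ?thesis
            using dominatedD[OF F(1) J(1,2)] dominatedD[OF F(1) J(2,1)] by linarith
        qed
        then have "mass (\<lambda>_. f x) {a<..b} \<le> mass (\<lambda>y. (F b - F a) + 1 * f y) {a<..b}"
          using I bv_integrable[OF f] by (intro mass_mono) (auto simp: add.commute)
        also have "\<dots> = (F b - F a) * (b - a) + mass f {a<..b}"
          using I by (subst mass_affine[OF bv_integrable[OF f]]) (auto simp: measure_lebesgue_I_Ioc)
        finally have "f x * (b - a) \<le> (F b - F a) * (b - a) + mass f {a<..b}"
          using I by (subst (asm) mass_const) (auto simp: measure_lebesgue_I_Ioc)
        then have "f x \<le> s a b" unfolding s_def using I by (simp add: field_simps)
        moreover have "0 \<le> f x" using nonneg x I by auto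
        ultimately show ?thesis by simp
      qed
      have "dominated {a..b} (\<lambda>x. weight x * f x) (H a b)"
        unfolding H_def
        by (rule dominated_mult[OF conjunct1[OF G[OF ab]] dominated_subset[OF F(1) comps_I[OF ab]] _ fs])
          (use weight_nonneg weight_small comps_I[OF ab] in \<open>auto simp: subset_iff\<close>)
      moreover have "H a b b - H a b a \<le> \<Phi> b - \<Phi> a"
      proof -
        have "H a b b - H a b a = s a b * (G a b b - G a b a) + (F b - F a) / 16"
          unfolding H_def by (simp add: algebra_simps diff_divide_distrib)
        also have "\<dots> \<le> s a b * (1 / 4) + (F b - F a) / 16"
          using G[OF ab] s0 by (intro add_mono mult_left_mono) auto
        also have "\<dots> = (5 / 16) * (F b - F a) + mass f {a<..b} / (4 * (b - a))"
        proof -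
          have "mass f {a<..b} / (4 * (b - a)) = (mass f {a<..b} / (b - a)) * (1 / 4)" by simp
          then show ?thesis unfolding s_def by (simp only:) (simp add: algebra_simps diff_divide_distrib)
        qed
        also have "\<dots> \<le> (5 / 16) * (F b - F a) + mass f {a<..b} / (4 * \<delta>)"
          using \<delta>(2)[OF ab] \<delta>(1) I mass0 by (intro add_left_mono divide_left_mono) auto
        also have "mass f {a<..b} = m b - m a"
          using mass_split[OF f, of 0 a b] I unfolding m_def by simp
        finally show ?thesis unfolding \<Phi>_def B_def by (simp add: algebra_simps diff_divide_distrib)
      qed
      ultimately show ?thesis ..
    qed
    have "bv (transfer f) (\<Sum>(a, b)\<in>comps Z. H a b b - H a b a)"
      by (rule transfer_dominated) (use bound in blast)
    moreover have "(\<Sum>(a, b)\<in>comps Z. H a b b - H a b a) \<le> (\<Sum>(a, b)\<in>comps Z. \<Phi> b - \<Phi> a)"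
      by (rule sum_mono) (use bound in auto)
    moreover have "(\<Sum>(a, b)\<in>comps Z. \<Phi> b - \<Phi> a) \<le> \<Phi> 1 - \<Phi> 0"
    proof (rule sum_comps_le[OF Z(1) Z(4)])
      fix x y :: real assume xy: "0 \<le> x" "x \<le> y" "y \<le> 1"
      have "F x \<le> F y" using dominated_mono[OF F(1)] xy by auto
      moreover have "m x \<le> m y" unfolding m_def
        using xy nonneg by (intro mass_mono_set bv_integrable[OF f]) auto
      ultimately show "\<Phi> x \<le> \<Phi> y" unfolding \<Phi>_def using B by (intro add_mono mult_left_mono) auto
    qed
    moreover have "\<Phi> 1 - \<Phi> 0 \<le> V / 2 + B * mass f {0..1}"
    proof -
      have "m 0 = 0" unfolding m_def by (simp add: set_lebesgue_integral_def)
      moreover have "m 1 = mass f {0..1}" unfolding m_def by (rule mass_Ioc[OF f])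
      moreover have "F 0 \<le> F 1" using dominated_mono[OF F(1)] by auto
      ultimately show ?thesis unfolding \<Phi>_def using F(2) by (simp add: algebra_simps)
    qed
    ultimately show ?thesis by (rule bv_le[OF _ order_trans[OF _ order_trans]])
  qed
  with B show ?thesis unfolding lasota_yorke_def by blast
qed

lemma prob_density_transfer:
  assumes "lasota_yorke B" "prob_density V f"
  shows "prob_density (V / 2 + B) (transfer f)"
proof -
  have f: "\<forall>x\<in>{0..1}. 0 \<le> f x" "bv f V" "mass f {0..1} = 1" using assms(2) unfolding prob_density_def by auto
  have "bv (transfer f) (V / 2 + B * mass f {0..1})"
    using assms(1) f(1,2) unfolding lasota_yorke_def by blast
  then have "bv (transfer f) (V / 2 + B)" unfolding f(3) by simp
  moreover have "mass (transfer f) {0..1} = 1"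
  proof -
    have "S -` {0..1} \<inter> {0..1} = {0..1}" using S_in by auto
    then show ?thesis using mass_transfer[OF f(2), of "{0..1}"] f(3) by simp
  qed
  ultimately show ?thesis unfolding prob_density_def using transfer_nonneg f(1) by blast
qed

text \<open>\<open>2 * B\<close> is the fixed point of V -> V / 2 + B, so the contribution of the
  initial variation is halved at each step.\<close>

lemma prob_density_iterate:
  assumes "lasota_yorke B" "prob_density V f"
  shows "prob_density (V / 2 ^ k + 2 * B) ((transfer ^^ k) f)"
proof (induction k)
  case 0
  have "V \<le> V / 2 ^ 0 + 2 * B" using assms(1) unfolding lasota_yorke_def by simp
  then show ?case using assms(2) bv_le[of f V] unfolding prob_density_def by simp
next
  case (Suc k)
  have "(V / 2 ^ k + 2 * B) / 2 + B = V / 2 ^ Suc k + 2 * B" by (simp add: field_simps)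
  with prob_density_transfer[OF assms(1) Suc] show ?case by (simp only: funpow.simps(2) comp_def)
qed

lemma transfer_iterate_bv: "bv f V \<Longrightarrow> \<exists>W. bv ((transfer ^^ k) f) W"
  by (induction k) (use transfer_bv in auto)

lemma mass_iterate:
  assumes "bv f V" "A \<in> sets lebesgue_I"
  shows "mass ((transfer ^^ k) f) A = mass f ((S ^^ k) -` A \<inter> {0..1})"
  using assms(2)
proof (induction k arbitrary: A)
  case 0
  then have "A \<inter> {0..1} = A" using sets_lebesgue_I_iff by blast
  then show ?case by simp
next
  case (Suc k)
  obtain W where "bv ((transfer ^^ k) f) W" using transfer_iterate_bv[OF assms(1)] by blast
  from mass_transfer[OF this Suc.prems]
  have "mass ((transfer ^^ Suc k) f) A = mass ((transfer ^^ k) f) (S -` A \<inter> {0..1})" by simp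
  also have "\<dots> = mass f ((S ^^ k) -` (S -` A \<inter> {0..1}) \<inter> {0..1})"
    by (rule Suc.IH[OF preimage_sets[OF Suc.prems]])
  finally show ?case unfolding iterate_preimage_Suc .
qed

section \<open>Lower bounds and the Doeblin condition\<close>

lemma weight_lower:
  obtains \<gamma> where "0 < \<gamma>" "\<gamma> \<le> 1" "\<And>x. x \<in> {0..1} - Z \<Longrightarrow> \<gamma> \<le> weight x"
proof -
  have "\<exists>\<gamma>>0. \<forall>x\<in>{fst c<..<snd c}. \<gamma> \<le> weight x" if c: "c \<in> comps Z" for c
  proof -
    obtain a b where ab: "c = (a, b)" by force
    obtain \<gamma> where "\<gamma> > 0" "\<forall>x\<in>{a<..<b}. \<gamma> \<le> inverse \<bar>deriv S x\<bar>"
      using Z(5)[of a b] c unfolding ab branch_def by blast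
    then show ?thesis using comps_not_Z[of a b] c unfolding ab weight_def by (intro exI[of _ \<gamma>]) simp
  qed
  then obtain g where g: "\<And>c. c \<in> comps Z \<Longrightarrow> g c > 0 \<and> (\<forall>x\<in>{fst c<..<snd c}. g c \<le> weight x)" by metis
  obtain \<gamma> where \<gamma>: "0 < \<gamma>" "\<gamma> \<le> 1" "\<And>c. c \<in> comps Z \<Longrightarrow> \<gamma> \<le> g c"
    using finite_pos_lower_bound[OF finite_comps[OF Z(1)], of g] g by metis
  have "\<gamma> \<le> weight x" if x: "x \<in> {0..1} - Z" for x
  proof -
    obtain a b where ab: "(a, b) \<in> comps Z" "x \<in> {a<..<b}" using comps_cover[OF Z(1-3) x] by blast
    then show ?thesis using \<gamma>(3)[OF ab(1)] g[OF ab(1)] by force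
  qed
  with \<gamma>(1,2) show ?thesis by (rule that)
qed

lemma transfer_iterate_nonneg:
  assumes "\<And>x. x \<in> {0..1} \<Longrightarrow> 0 \<le> f x" "x \<in> {0..1}"
  shows "0 \<le> (transfer ^^ k) f x"
  using assms(2)
proof (induction k arbitrary: x)
  case (Suc k)
  have "0 \<le> transfer ((transfer ^^ k) f) x" by (rule transfer_nonneg) (rule Suc.IH)
  then show ?case by simp
qed (use assms in simp)

text \<open>Of all the preimages of \<open>(S ^^ k) x\<close> only \<open>x\<close> is kept. Its
  orbit avoids \<open>Z\<close>, where the weight vanishes, so each step contributes a factor of at
  least \<open>\<gamma>\<close>.\<close>

lemma transfer_iterate_lower:
  assumes \<gamma>: "0 < \<gamma>" "\<And>x. x \<in> {0..1} - Z \<Longrightarrow> \<gamma> \<le> weight x"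
    and f: "\<And>x. x \<in> {0..1} \<Longrightarrow> 0 \<le> f x" and x: "x \<in> {0..1}" "\<And>i. i < k \<Longrightarrow> (S ^^ i) x \<notin> Z"
  shows "\<gamma> ^ k * f x \<le> (transfer ^^ k) f ((S ^^ k) x)"
  using x(2)
proof (induction k)
  case (Suc k)
  let ?y = "(S ^^ k) x"
  have y: "?y \<in> {0..1} - Z" using iterate_in[OF x(1)] Suc.prems[of k] by simp
  have "\<gamma> ^ Suc k * f x = \<gamma> * (\<gamma> ^ k * f x)" by simp
  also have "\<dots> \<le> weight ?y * (transfer ^^ k) f ?y"
    using Suc y \<gamma> f[OF x(1)] weight_nonneg by (intro mult_mono) auto
  also have "\<dots> \<le> transfer ((transfer ^^ k) f) (S ?y)"
    by (rule transfer_lower[OF transfer_iterate_nonneg y]) (use f in auto)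
  finally show ?case by simp
qed simp

text \<open>\<open>S ^^ k\<close> maps the cell on which \<open>f\<close> is at least 1/2 onto the
  unit interval, so every point has a preimage there. The grid depends on \<open>V\<close> only;
  therefore \<open>k\<close> and \<open>c\<close> serve all densities \<open>f\<close> at
  once.\<close>

lemma doeblin:
  assumes "0 \<le> V"
  obtains k :: nat and c :: real where "k \<ge> 2" "0 < c" "c \<le> 1 / 2"
    "\<And>f. prob_density V f \<Longrightarrow> \<exists>Y. finite Y \<and> (\<forall>y\<in>{0..1} - Y. c \<le> (transfer ^^ k) f y)"
proof -
  obtain \<gamma> where \<gamma>: "0 < \<gamma>" "\<gamma> \<le> 1" "\<And>x. x \<in> {0..1} - Z \<Longrightarrow> \<gamma> \<le> weight x" using weight_lower by blast
  define L where "L = nat \<lceil>4 * V\<rceil> + 1"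
  have L: "V \<le> real L / 4" "L > 0"
  proof -
    have "4 * V \<le> real (nat \<lceil>4 * V\<rceil>)" by (rule real_nat_ceiling_ge)
    then show "V \<le> real L / 4" "L > 0" by (simp_all add: L_def)
  qed
  have "\<exists>n0. \<forall>n\<ge>n0. (S ^^ n) ` {real j / L..real (Suc j) / L} = {0..1}" if "j < L" for j
    using that L(2) by (intro covering) (auto simp: divide_simps)
  then obtain n0 where n0: "\<And>j n. j < L \<Longrightarrow> n \<ge> n0 j \<Longrightarrow> (S ^^ n) ` {real j / L..real (Suc j) / L} = {0..1}"
    by metis
  \<comment> \<open>The sum dominates every \<open>n0 j\<close>; the summand 2 makes
    \<open>2 ^ k\<close> at least 4, as the splitting below requires.\<close>
  define k where "k = 2 + (\<Sum>j<L. n0 j)"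
  have k: "n0 j \<le> k" if "j < L" for j
    using member_le_sum[of j "{..<L}" n0] that unfolding k_def by simp
  have "\<exists>Y. finite Y \<and> (\<forall>y\<in>{0..1} - Y. \<gamma> ^ k / 2 \<le> (transfer ^^ k) f y)" if f: "prob_density V f" for f
  proof -
    obtain j where j: "j < L" "\<And>x. x \<in> {real j / L..real (Suc j) / L} \<Longrightarrow> 1 / 2 \<le> f x"
      using prob_density_large_cell[OF f L] by blast
    \<comment> \<open>The points reached from a break point in 1 to \<open>k\<close> steps. For a
      point off \<open>Y\<close>, the first \<open>k\<close> points of every orbit leading to it
      avoid \<open>Z\<close>.\<close>
    define Y where "Y = (\<Union>i<k. (S ^^ (k - i)) ` Z)"
    have "\<gamma> ^ k / 2 \<le> (transfer ^^ k) f y" if y: "y \<in> {0..1} - Y" for y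
    proof -
      obtain x where x: "x \<in> {real j / L..real (Suc j) / L}" "y = (S ^^ k) x"
        using n0[OF j(1) k[OF j(1)]] y by blast
      have "real (Suc j) / L \<le> 1" using j(1) L(2) by (simp add: divide_simps)
      moreover have "0 \<le> real j / L" by simp
      ultimately have x01: "x \<in> {0..1}" using x(1) by (meson atLeastAtMost_iff order_trans)
      have "(S ^^ i) x \<notin> Z" if "i < k" for i
      proof
        assume "(S ^^ i) x \<in> Z"
        moreover have "y = (S ^^ (k - i)) ((S ^^ i) x)"
          using that funpow_add[of "k - i" i S] unfolding x(2) by simp
        ultimately have "y \<in> Y" unfolding Y_def using that by blast
        with y show False by blast
      qed
      then have "\<gamma> ^ k * f x \<le> (transfer ^^ k) f y"
        unfolding x(2) using f \<gamma> x01 by (intro transfer_iterate_lower) (auto simp: prob_density_def)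
      moreover have "\<gamma> ^ k / 2 \<le> \<gamma> ^ k * f x"
        using mult_left_mono[OF j(2)[OF x(1)], of "\<gamma> ^ k"] \<gamma>(1) by simp
      ultimately show ?thesis by linarith
    qed
    moreover have "finite Y" unfolding Y_def using Z(1) by simp
    ultimately show ?thesis by blast
  qed
  moreover have "\<gamma> ^ k / 2 \<le> 1 / 2" using power_le_one[of \<gamma> k] \<gamma> by simp
  moreover have "0 < \<gamma> ^ k / 2" using \<gamma>(1) by simp
  moreover have "k \<ge> 2" by (simp add: k_def)
  ultimately show ?thesis using that by blast
qed

text \<open>Splitting off the constant \<open>c\<close> from the lower bound and renormalizing the remainder keeps
  the variation below \<open>V\<close>, so the coupling can be iterated.\<close>

lemma doeblin_split:
  assumes ly: "lasota_yorke B" and V: "V = 8 * B + 8" and k: "k \<ge> 2" and c: "0 < c" "c \<le> 1 / 2"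
    and f: "prob_density V f" and Y: "finite Y" "\<forall>y\<in>{0..1} - Y. c \<le> (transfer ^^ k) f y"
  obtains g where "prob_density V g"
    "\<And>A. A \<in> sets lebesgue_I \<Longrightarrow> mass ((transfer ^^ k) f) A = c * measure lebesgue_I A + (1 - c) * mass g A"
proof -
  let ?h = "(transfer ^^ k) f"
  have h: "prob_density (V / 2 ^ k + 2 * B) ?h" by (rule prob_density_iterate[OF ly f])
  have B: "0 \<le> B" using ly unfolding lasota_yorke_def by blast
  define r where "r = 1 / (1 - c)"
  have r: "0 \<le> r" "r \<le> 2" "(1 - c) * r = 1" using c by (auto simp: r_def field_simps)
  \<comment> \<open>Within the unit interval \<open>max 0\<close> can act only on the finite set
    \<open>Y\<close>, where the lower bound \<open>c\<close> may fail; it makes \<open>g\<close>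
    nonnegative everywhere.\<close>
  define g where "g = (\<lambda>x. max 0 (r * (?h x - c)))"
  have "bv g (r * (V / 2 ^ k + 2 * B))"
    unfolding g_def using h r(1) by (intro bv_max bv_affine) (auto simp: prob_density_def)
  \<comment> \<open>With \<open>r \<le> 2\<close> and \<open>2 ^ k \<ge> 4\<close> the left side is
    at most V / 2 + 4 * B, which is below \<open>V\<close> as soon as \<open>V\<close> exceeds 8 *
    B; hence the choice of \<open>V\<close>.\<close>
  moreover have "r * (V / 2 ^ k + 2 * B) \<le> V"
  proof -
    have "(2::real) ^ 2 \<le> 2 ^ k" using k by (intro power_increasing) auto
    then have "V / 2 ^ k \<le> V / 4" using B V by (intro divide_left_mono) auto
    moreover have "0 \<le> V / 2 ^ k" using B V by simp
    ultimately have "r * (V / 2 ^ k + 2 * B) \<le> 2 * (V / 4 + 2 * B)"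
      using r(1,2) B by (intro mult_mono) auto
    also have "\<dots> \<le> V" using V by simp
    finally show ?thesis .
  qed
  ultimately have g: "bv g V" by (rule bv_le)
  have split: "mass ?h A = c * measure lebesgue_I A + (1 - c) * mass g A" if A: "A \<in> sets lebesgue_I" for A
  proof -
    have "mass ?h A = mass (\<lambda>x. c + (1 - c) * g x) A"
      unfolding set_lebesgue_integral_def
    proof (rule integral_cong_AE)
      show "(\<lambda>x. indicator A x *\<^sub>R ?h x) \<in> borel_measurable lebesgue_I"
        using A h bv_measurable unfolding prob_density_def
        by (intro borel_measurable_scaleR borel_measurable_indicator) auto
      show "(\<lambda>x. indicator A x *\<^sub>R (c + (1 - c) * g x)) \<in> borel_measurable lebesgue_I"
        using A bv_measurable[OF g]
        by (intro borel_measurable_scaleR borel_measurable_indicator borel_measurable_add borel_measurable_times) auto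
      show "AE x in lebesgue_I. indicator A x *\<^sub>R ?h x = indicator A x *\<^sub>R (c + (1 - c) * g x)"
        using finite_null[OF Y(1)] AE_space
      proof eventually_elim
        case (elim x)
        then have "c \<le> ?h x" using Y(2) by (simp add: space_lebesgue_I)
        then have "g x = r * (?h x - c)" using r(1) by (simp add: g_def)
        then have "(1 - c) * g x = (1 - c) * r * (?h x - c)" by simp
        then show ?case by (simp add: r(3))
      qed
    qed
    then show ?thesis using mass_affine[OF bv_integrable[OF g] A] by simp
  qed
  have "1 = c + (1 - c) * mass g {0..1}"
    using split[of "{0..1}"] h by (simp add: prob_density_def measure_lebesgue_I)
  then have "(1 - c) * (mass g {0..1} - 1) = 0" by (simp add: algebra_simps)
  then have "mass g {0..1} = 1" using c by simp
  then have "prob_density V g" unfolding prob_density_def using g by (simp add: g_def)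
  then show ?thesis using split by (rule that)
qed

text \<open>The common part, \<open>c\<close> times Lebesgue measure, cancels in the difference. The
  remainders are densities with the same bound \<open>V\<close> and carry the factor
  \<open>1 - c\<close>, so the argument repeats.\<close>

lemma contraction:
  assumes ly: "lasota_yorke B" and V: "V = 8 * B + 8"
  obtains k :: nat and \<theta> :: real where "0 \<le> \<theta>" "\<theta> < 1"
    "\<And>f g n A. prob_density V f \<Longrightarrow> prob_density V g \<Longrightarrow> A \<in> sets lebesgue_I \<Longrightarrow>
      \<bar>mass f ((S ^^ (k * n)) -` A \<inter> {0..1}) - mass g ((S ^^ (k * n)) -` A \<inter> {0..1})\<bar> \<le> \<theta> ^ n"
proof -
  have "0 \<le> V" using ly V unfolding lasota_yorke_def by simp
  from doeblin[OF this] obtain k c where kc: "k \<ge> 2" "0 < c" "c \<le> 1 / 2"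
    "\<And>f. prob_density V f \<Longrightarrow> \<exists>Y. finite Y \<and> (\<forall>y\<in>{0..1} - Y. c \<le> (transfer ^^ k) f y)" by metis
  have "\<bar>mass f ((S ^^ (k * n)) -` A \<inter> {0..1}) - mass g ((S ^^ (k * n)) -` A \<inter> {0..1})\<bar> \<le> (1 - c) ^ n"
    if "prob_density V f" "prob_density V g" "A \<in> sets lebesgue_I" for f g n A
    using that
  proof (induction n arbitrary: f g)
    case 0
    have "0 \<le> mass f A \<and> mass f A \<le> 1" if f: "prob_density V f" for f
    proof -
      have *: "integrable lebesgue_I f" "\<And>x. x \<in> {0..1} \<Longrightarrow> 0 \<le> f x" "mass f {0..1} = 1" 
        using f bv_integrable unfolding prob_density_def by auto
      have A: "A \<subseteq> {0..1}" using 0(3) sets_lebesgue_I_iff by blast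
      have "0 \<le> mass f A" by (rule mass_nonneg[OF *(1) 0(3)]) (use *(2) A in blast)
      moreover have "mass f A \<le> mass f {0..1}" by (rule mass_mono_set[OF *(1) 0(3) _ A *(2)]) auto
      ultimately show ?thesis using *(3) by simp
    qed
    from this[OF 0(1)] this[OF 0(2)] show ?case
      using 0(3) sets_lebesgue_I_iff by (simp add: Int_absorb2 abs_le_iff)
  next
    case (Suc n)
    define A' where "A' = (S ^^ (k * n)) -` A \<inter> {0..1}"
    have A': "A' \<in> sets lebesgue_I" unfolding A'_def by (rule iterate_preimage_sets[OF Suc.prems(3)])
    have eq: "(S ^^ (k * Suc n)) -` A \<inter> {0..1} = (S ^^ k) -` A' \<inter> {0..1}"
      unfolding A'_def using iterate_preimage_add[of "k * n" k A] by (simp add: add.commute)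
    obtain f' where f': "prob_density V f'" "\<And>A. A \<in> sets lebesgue_I \<Longrightarrow>
      mass ((transfer ^^ k) f) A = c * measure lebesgue_I A + (1 - c) * mass f' A"
      using kc(4)[OF Suc.prems(1)] doeblin_split[OF ly V kc(1-3) Suc.prems(1)] by metis
    obtain g' where g': "prob_density V g'" "\<And>A. A \<in> sets lebesgue_I \<Longrightarrow>
      mass ((transfer ^^ k) g) A = c * measure lebesgue_I A + (1 - c) * mass g' A"
      using kc(4)[OF Suc.prems(2)] doeblin_split[OF ly V kc(1-3) Suc.prems(2)] by metis
    have f: "bv f V" "bv g V" using Suc.prems unfolding prob_density_def by auto
    have "\<bar>mass f ((S ^^ (k * Suc n)) -` A \<inter> {0..1}) - mass g ((S ^^ (k * Suc n)) -` A \<inter> {0..1})\<bar>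
        = \<bar>(1 - c) * (mass f' A' - mass g' A')\<bar>"
      unfolding eq mass_iterate[OF f(1) A', symmetric] mass_iterate[OF f(2) A', symmetric] f'(2)[OF A'] g'(2)[OF A']
      by (simp add: algebra_simps)
    also have "\<dots> = (1 - c) * \<bar>mass f' A' - mass g' A'\<bar>" using kc(3) by (simp add: abs_mult)
    also have "\<dots> \<le> (1 - c) * (1 - c) ^ n"
      using Suc.IH[OF f'(1) g'(1) Suc.prems(3)] kc(3) unfolding A'_def by (intro mult_left_mono) auto
    finally show ?case by simp
  qed
  with kc(2,3) show ?thesis using that[of "1 - c" k] by auto
qed

theorem equidistribution:
  assumes approx: "\<And>\<epsilon>. 0 < \<epsilon> \<Longrightarrow> \<exists>f V. prob_density V f \<and> (\<forall>A\<in>sets lebesgue_I. \<bar>measure \<mu> A - mass f A\<bar> \<le> \<epsilon>)"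
    and inv: "\<And>A. A \<in> sets lebesgue_I \<Longrightarrow> measure \<mu> (S -` A \<inter> {0..1}) = measure \<mu> A"
  obtains k :: nat and \<theta> :: real where "0 \<le> \<theta>" "\<theta> < 1"
    "\<And>n A. A \<in> sets lebesgue_I \<Longrightarrow> \<bar>measure \<mu> A - measure lebesgue_I ((S ^^ (k * n)) -` A \<inter> {0..1})\<bar> \<le> \<theta> ^ n"
proof -
  obtain B where ly: "lasota_yorke B" using lasota_yorke by blast
  then have B: "0 \<le> B" unfolding lasota_yorke_def by blast
  define V where "V = 8 * B + 8"
  obtain k \<theta> where k: "0 \<le> \<theta>" "\<theta> < 1"
    "\<And>f g n A. prob_density V f \<Longrightarrow> prob_density V g \<Longrightarrow> A \<in> sets lebesgue_I \<Longrightarrow>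
      \<bar>mass f ((S ^^ (k * n)) -` A \<inter> {0..1}) - mass g ((S ^^ (k * n)) -` A \<inter> {0..1})\<bar> \<le> \<theta> ^ n"
    using contraction[OF ly V_def] by metis
  \<comment> \<open>Lebesgue measure has the constant density 1 of variation 0, so it is in the
    class for \<open>V\<close> from the start.\<close>
  have one: "prob_density V (\<lambda>_. 1)"
    unfolding prob_density_def using bv_le[OF bv_const, of V] B mass_const[of "{0..1}" 1]
    by (simp add: V_def measure_lebesgue_I)
  have inv': "measure \<mu> ((S ^^ j) -` A \<inter> {0..1}) = measure \<mu> A" if "A \<in> sets lebesgue_I" for j A
    using that
  proof (induction j arbitrary: A)
    case 0
    then show ?case using sets_lebesgue_I_iff by (simp add: Int_absorb2)
  next
    case (Suc j)
    show ?case unfolding iterate_preimage_Suc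
      using Suc.IH[OF preimage_sets[OF Suc.prems]] inv[OF Suc.prems] by (rule trans)
  qed
  have "\<bar>measure \<mu> A - measure lebesgue_I ((S ^^ (k * n)) -` A \<inter> {0..1})\<bar> \<le> \<theta> ^ n"
    if A: "A \<in> sets lebesgue_I" for n A
  proof (rule field_le_epsilon)
    fix \<epsilon> :: real assume "0 < \<epsilon>"
    then obtain f W where f: "prob_density W f" "\<And>A. A \<in> sets lebesgue_I \<Longrightarrow> \<bar>measure \<mu> A - mass f A\<bar> \<le> \<epsilon>"
      using approx by blast
    \<comment> \<open>After \<open>j\<close> iterates the variation is at most 1 + 2 * B, hence
      below \<open>V\<close>; \<open>j\<close> may depend on \<open>\<epsilon>\<close> because it
      does not enter the bound.\<close>
    obtain j :: nat where "W < 2 ^ j" using real_arch_pow[of 2 W] by auto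
    then have "W / 2 ^ j \<le> 1" by (simp add: divide_simps)
    then have "W / 2 ^ j + 2 * B \<le> V" using B unfolding V_def by linarith
    then have fj: "prob_density V ((transfer ^^ j) f)"
      using prob_density_iterate[OF ly f(1), of j] bv_le unfolding prob_density_def by blast
    have bf: "bv f W" using f(1) unfolding prob_density_def by blast
    define A' where "A' = (S ^^ (k * n)) -` A \<inter> {0..1}"
    have A': "A' \<in> sets lebesgue_I" unfolding A'_def by (rule iterate_preimage_sets[OF A])
    define A'' where "A'' = (S ^^ j) -` A' \<inter> {0..1}"
    have A'': "A'' \<in> sets lebesgue_I" unfolding A''_def by (rule iterate_preimage_sets[OF A'])
    have 1: "measure \<mu> A = measure \<mu> A''" unfolding A''_def A'_def
      using inv'[OF A] inv'[OF A'[unfolded A'_def]] by simp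
    have 2: "mass f A'' = mass ((transfer ^^ j) f) A'" unfolding A''_def by (rule mass_iterate[OF bf A', symmetric])
    have 3: "measure lebesgue_I A' = mass (\<lambda>_. 1) A'" using mass_const[OF A', of 1] by simp
    have 4: "\<bar>mass ((transfer ^^ j) f) A' - mass (\<lambda>_. 1) A'\<bar> \<le> \<theta> ^ n"
      unfolding A'_def by (rule k(3)[OF fj one A])
    show "\<bar>measure \<mu> A - measure lebesgue_I ((S ^^ (k * n)) -` A \<inter> {0..1})\<bar> \<le> \<theta> ^ n + \<epsilon>"
      using 1 2 3 4 f(2)[OF A''] unfolding A'_def[symmetric] by linarith
  qed
  with k(1,2) show ?thesis by (rule that)
qed

end

section \<open>Convergence to the SRB measure\<close>

lemma bv_add:
  assumes "bv f V" "bv g W"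
  shows "bv (\<lambda>x. f x + g x) (V + W)"
proof -
  obtain F where F: "dominated {0..1} f F" "F 1 - F 0 \<le> V" using assms(1) unfolding bv_def by blast
  obtain G where G: "dominated {0..1} g G" "G 1 - G 0 \<le> W" using assms(2) unfolding bv_def by blast
  have "dominated {0..1} (\<lambda>x. f x + g x) (\<lambda>x. F x + G x)"
    unfolding dominated_def
  proof (intro ballI impI)
    fix x y :: real assume xy: "x \<in> {0..1}" "y \<in> {0..1}" "x \<le> y"
    show "\<bar>f y + g y - (f x + g x)\<bar> \<le> F y + G y - (F x + G x)"
      using dominatedD[OF F(1) xy] dominatedD[OF G(1) xy] by linarith
  qed
  then show ?thesis unfolding bv_def using F(2) G(2) by (intro exI[of _ "\<lambda>x. F x + G x"]) simp
qed

lemma bv_uminus: "bv f V \<Longrightarrow> bv (\<lambda>x. - f x) V"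
  unfolding bv_def dominated_def by (simp add: abs_minus_commute)

lemma bv_scale: "bv f V \<Longrightarrow> bv (\<lambda>x. c * f x) (\<bar>c\<bar> * V)"
  using bv_affine[of f V c 0] bv_uminus[OF bv_affine[of f V "- c" 0]] by (cases "c \<ge> 0") auto

abbreviation dist_L1 :: "(real \<Rightarrow> real) \<Rightarrow> (real \<Rightarrow> real) \<Rightarrow> real" where
  "dist_L1 f g \<equiv> (LINT x|lebesgue_I. \<bar>f x - g x\<bar>)"

lemma dist_L1_triangle:
  assumes "integrable lebesgue_I f" "integrable lebesgue_I g" "integrable lebesgue_I h"
  shows "dist_L1 f h \<le> dist_L1 f g + dist_L1 g h"
proof -
  have "dist_L1 f h \<le> (LINT x|lebesgue_I. \<bar>f x - g x\<bar> + \<bar>g x - h x\<bar>)"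
    by (rule integral_mono) (use assms in \<open>auto intro!: Bochner_Integration.integrable_add\<close>)
  also have "\<dots> = dist_L1 f g + dist_L1 g h"
    by (rule Bochner_Integration.integral_add) (use assms in auto)
  finally show ?thesis .
qed

definition bv_approx :: "(real \<Rightarrow> real) \<Rightarrow> bool" where
  "bv_approx h \<longleftrightarrow> (\<forall>\<epsilon>>0. \<exists>f V. bv f V \<and> dist_L1 h f \<le> \<epsilon>)"

lemma bv_imp_approx: "bv f V \<Longrightarrow> bv_approx f"
  unfolding bv_approx_def by (intro allI impI exI[of _ f] exI[of _ V]) simp

lemma bv_approx_add:
  assumes "integrable lebesgue_I g" "bv_approx g" "integrable lebesgue_I h" "bv_approx h"
  shows "bv_approx (\<lambda>x. g x + h x)"
  unfolding bv_approx_def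
proof (intro allI impI)
  fix \<epsilon> :: real assume "0 < \<epsilon>"
  then have "0 < \<epsilon> / 2" by simp
  then obtain f V where 1: "bv f V" "dist_L1 g f \<le> \<epsilon> / 2"
    using assms(2) unfolding bv_approx_def by blast
  obtain f' V' where 2: "bv f' V'" "dist_L1 h f' \<le> \<epsilon> / 2"
    using assms(4) \<open>0 < \<epsilon> / 2\<close> unfolding bv_approx_def by blast
  note f = 1 2
  note i = bv_integrable[OF f(1)] bv_integrable[OF f(3)]
  have "dist_L1 (\<lambda>x. g x + h x) (\<lambda>x. f x + f' x) \<le> (LINT x|lebesgue_I. \<bar>g x - f x\<bar> + \<bar>h x - f' x\<bar>)"
    by (rule integral_mono) (use assms i in \<open>auto intro!: Bochner_Integration.integrable_add Bochner_Integration.integrable_diff integrable_abs\<close>)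
  also have "\<dots> = dist_L1 g f + dist_L1 h f'"
    by (rule Bochner_Integration.integral_add) (use assms i in auto)
  finally have "dist_L1 (\<lambda>x. g x + h x) (\<lambda>x. f x + f' x) \<le> \<epsilon>" using f(2,4) by simp
  then show "\<exists>k V. bv k V \<and> dist_L1 (\<lambda>x. g x + h x) k \<le> \<epsilon>"
    using bv_add[OF f(1,3)] by blast
qed

lemma bv_approx_scale:
  assumes "bv_approx h"
  shows "bv_approx (\<lambda>x. c * h x)"
  unfolding bv_approx_def
proof (intro allI impI)
  fix \<epsilon> :: real assume "0 < \<epsilon>"
  then have "0 < \<epsilon> / (\<bar>c\<bar> + 1)" by (simp add: add_nonneg_pos)
  then obtain f V where f: "bv f V" "dist_L1 h f \<le> \<epsilon> / (\<bar>c\<bar> + 1)"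
    using assms unfolding bv_approx_def by blast
  have "dist_L1 (\<lambda>x. c * h x) (\<lambda>x. c * f x) = \<bar>c\<bar> * dist_L1 h f"
    by (simp flip: right_diff_distrib add: abs_mult)
  also have "\<dots> \<le> (\<bar>c\<bar> + 1) * (\<epsilon> / (\<bar>c\<bar> + 1))"
    using f(2) by (intro mult_mono) auto
  also have "\<dots> = \<epsilon>" by (simp add: add_nonneg_eq_0_iff)
  finally show "\<exists>k V. bv k V \<and> dist_L1 (\<lambda>x. c * h x) k \<le> \<epsilon>"
    using bv_scale[OF f(1)] by blast
qed

lemma bv_approx_lim:
  assumes s: "\<And>i. integrable lebesgue_I (s i)" "\<And>i. bv_approx (s i)" and h: "integrable lebesgue_I h"
    and lim: "\<And>x. x \<in> {0..1} \<Longrightarrow> (\<lambda>i. s i x) \<longlonglongrightarrow> h x"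
    and w: "integrable lebesgue_I w" "\<And>i x. x \<in> {0..1} \<Longrightarrow> \<bar>s i x\<bar> \<le> w x"
  shows "bv_approx h"
  unfolding bv_approx_def
proof (intro allI impI)
  fix \<epsilon> :: real assume e: "0 < \<epsilon>"
  have "(\<lambda>i. dist_L1 h (s i)) \<longlonglongrightarrow> (LINT x|lebesgue_I. 0)"
  proof (rule integral_dominated_convergence)
    show "(\<lambda>x. \<bar>h x - s i x\<bar>) \<in> borel_measurable lebesgue_I" for i
      using h s(1)[of i] by (intro borel_measurable_abs borel_measurable_diff borel_measurable_integrable)
    show "integrable lebesgue_I (\<lambda>x. \<bar>h x\<bar> + w x)"
      using h w(1) by (intro Bochner_Integration.integrable_add integrable_abs)
    show "AE x in lebesgue_I. (\<lambda>i. \<bar>h x - s i x\<bar>) \<longlonglongrightarrow> 0"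
    proof (rule AE_I2)
      fix x assume "x \<in> space lebesgue_I"
      then have "(\<lambda>i. \<bar>h x - s i x\<bar>) \<longlonglongrightarrow> \<bar>h x - h x\<bar>"
        by (intro tendsto_intros lim) (simp only: space_lebesgue_I)
      then show "(\<lambda>i. \<bar>h x - s i x\<bar>) \<longlonglongrightarrow> 0" by simp
    qed
    show "AE x in lebesgue_I. norm \<bar>h x - s i x\<bar> \<le> \<bar>h x\<bar> + w x" for i
    proof (rule AE_I2)
      fix x assume "x \<in> space lebesgue_I"
      then have "\<bar>s i x\<bar> \<le> w x" by (intro w(2)) (simp only: space_lebesgue_I)
      then show "norm \<bar>h x - s i x\<bar> \<le> \<bar>h x\<bar> + w x" unfolding real_norm_def by linarith
    qed
  qed simp
  then have "(\<lambda>i. dist_L1 h (s i)) \<longlonglongrightarrow> 0" by simp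
  then have "eventually (\<lambda>i. dist_L1 h (s i) < \<epsilon> / 2) sequentially" using e by (intro order_tendstoD(2)) auto
  then obtain i where i: "dist_L1 h (s i) < \<epsilon> / 2" using eventually_happens'[OF sequentially_bot] by blast
  have "0 < \<epsilon> / 2" using e by simp
  then obtain f V where f: "bv f V" "dist_L1 (s i) f \<le> \<epsilon> / 2"
    using s(2)[of i] unfolding bv_approx_def by blast
  have "dist_L1 h f \<le> \<epsilon>" using dist_L1_triangle[OF h s(1)[of i] bv_integrable[OF f(1)]] i f(2) by linarith
  then show "\<exists>f V. bv f V \<and> dist_L1 h f \<le> \<epsilon>" using f(1) by blast
qed

lemma integrable_indicator_borel:
  assumes "A \<in> sets borel"
  shows "integrable lebesgue_I (indicat_real A)"
proof (rule lebI.integrable_const_bound[of _ 1])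
  show "indicat_real A \<in> borel_measurable lebesgue_I"
    by (rule measurable_restrict_space1) (use assms in simp)
qed (simp add: indicator_def)

lemma bv_indicator_atMost: "bv (indicat_real {..a}) 1"
  unfolding bv_def
  by (rule exI[of _ "\<lambda>x. - indicat_real {..a} x"]) (auto simp: dominated_def indicator_def)

text \<open>Half lines are stable under intersection, generate the Borel sets and have indicators of
  variation 1. Complements and disjoint unions preserve approximability, the latter by dominated
  convergence of the partial unions.\<close>

lemma bv_approx_indicator:
  assumes "A \<in> sets borel"
  shows "bv_approx (indicat_real A)"
proof -
  have S: "sets borel = sigma_sets (UNIV :: real set) (range atMost)"
    unfolding borel_eq_atMost by simp
  have st: "Int_stable (range (atMost :: real \<Rightarrow> _))"
    by (auto simp: Int_stable_def)
  have pw: "range (atMost :: real \<Rightarrow> _) \<subseteq> Pow UNIV" by simp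
  have "A \<in> sigma_sets UNIV (range atMost)" using assms S by simp
  with st pw show ?thesis
  proof (induction rule: sigma_sets_induct_disjoint)
    case (basic A)
    then show ?case using bv_imp_approx[OF bv_indicator_atMost] by blast
  next
    case empty
    show ?case using bv_imp_approx[OF bv_const[of 0]] by simp
  next
    case (compl A)
    have A: "A \<in> sets borel" using compl(1) S by simp
    have "indicat_real (UNIV - A) = (\<lambda>x. 1 + (-1) * indicat_real A x)"
      by (auto simp: fun_eq_iff indicator_def)
    then show ?case
      using bv_approx_add[OF _ bv_imp_approx[OF bv_const[of 1]] _ bv_approx_scale[OF compl(2), of "-1"]]
        integrable_indicator_borel[OF A] by simp
  next
    case (union A)
    have A: "A i \<in> sets borel" for i using union(2) S by auto
    have part: "bv_approx (indicat_real (\<Union>i<n. A i))" for n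
    proof (induction n)
      case 0
      show ?case using bv_imp_approx[OF bv_const[of 0]] by simp
    next
      case (Suc n)
      have "A i \<inter> A n = {}" if "i < n" for i
        using union(1) that unfolding disjoint_family_on_def by simp
      then have "(\<Union>i<n. A i) \<inter> A n = {}" by blast
      then have "indicat_real (\<Union>i<Suc n. A i) = (\<lambda>x. indicat_real (\<Union>i<n. A i) x + indicat_real (A n) x)"
        by (auto simp: fun_eq_iff indicator_def lessThan_Suc)
      then show ?case
        using bv_approx_add[OF _ Suc _ union(3)[of n]] integrable_indicator_borel A by simp
    qed
    show ?case
    proof (rule bv_approx_lim[where s = "\<lambda>n. indicat_real (\<Union>i<n. A i)" and w = "\<lambda>_. 1"])
      show "(\<lambda>n. indicat_real (\<Union>i<n. A i) x) \<longlonglongrightarrow> indicat_real (\<Union>i. A i) x" for x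
        by (rule LIMSEQ_indicator_UN)
      show "integrable lebesgue_I (indicat_real (\<Union>i<n. A i))" for n
        using A by (intro integrable_indicator_borel) auto
      show "integrable lebesgue_I (indicat_real (\<Union>i. A i))"
        using A by (intro integrable_indicator_borel) auto
    qed (auto simp: part indicator_def)
  qed
qed

lemma bv_dense_L1:
  assumes "integrable lebesgue_I h"
  shows "bv_approx h"
  using assms
proof (induction rule: integrable_induct)
  case (base A c)
  then have "A \<in> sets borel" using sets_lebesgue_I_iff by blast
  from bv_approx_scale[OF bv_approx_indicator[OF this], of c]
  show ?case by (simp add: mult.commute)
next
  case (add f g)
  then show ?case by (intro bv_approx_add)
next
  case (lim f s)
  show ?case
  proof (rule bv_approx_lim[OF lim(1,5,4)])
    show "integrable lebesgue_I (\<lambda>x. 2 * \<bar>f x\<bar>)" using lim by auto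
    show "(\<lambda>i. s i x) \<longlonglongrightarrow> f x" if "x \<in> {0..1}" for x
      using lim(2)[of x] that by (simp only: space_lebesgue_I)
    show "\<bar>s i x\<bar> \<le> 2 * \<bar>f x\<bar>" if "x \<in> {0..1}" for i x
      using lim(3)[of x i] that by (simp only: space_lebesgue_I real_norm_def)
  qed
qed

lemma mass_diff_le:
  assumes "integrable lebesgue_I f" "integrable lebesgue_I g" "A \<in> sets lebesgue_I"
  shows "\<bar>mass f A - mass g A\<bar> \<le> dist_L1 f g"
proof -
  have "mass f A - mass g A = mass (\<lambda>x. f x - g x) A"
    by (rule set_integral_diff(2)[symmetric]) (use assms integrable_imp_set_integrable in auto)
  also have "\<bar>\<dots>\<bar> \<le> (LINT x|lebesgue_I. \<bar>indicator A x *\<^sub>R (f x - g x)\<bar>)"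
    unfolding set_lebesgue_integral_def by (rule integral_abs_bound)
  also have "\<dots> \<le> dist_L1 f g"
  proof (rule integral_mono)
    show "integrable lebesgue_I (\<lambda>x. \<bar>indicator A x *\<^sub>R (f x - g x)\<bar>)"
      using assms by (intro integrable_abs integrable_mult_indicator) auto
    show "\<bar>indicator A x *\<^sub>R (f x - g x)\<bar> \<le> \<bar>f x - g x\<bar>" for x
      by (auto split: split_indicator)
  qed (use assms in auto)
  finally show ?thesis .
qed

text \<open>Truncation at 0 takes the approximation no further from the nonnegative
  \<open>D\<close>, and division by its mass, which is close to 1, makes it a probability
  density.\<close>

lemma approx_by_prob_density:
  assumes D: "integrable lebesgue_I D" "\<And>x. 0 \<le> D x" "mass D {0..1} = 1" and "0 < \<epsilon>"
  shows "\<exists>f V. prob_density V f \<and> (\<forall>A\<in>sets lebesgue_I. \<bar>mass D A - mass f A\<bar> \<le> \<epsilon>)"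
proof -
  \<comment> \<open>One half of \<open>\<epsilon>\<close> is for the L1 approximation, the other for
    the normalization; the bound 1/2 keeps the mass \<open>m\<close> positive.\<close>
  define \<delta> where "\<delta> = min (\<epsilon> / 2) (1 / 2)"
  have \<delta>: "0 < \<delta>" "2 * \<delta> \<le> \<epsilon>" "\<delta> \<le> 1 / 2" using \<open>0 < \<epsilon>\<close> by (auto simp: \<delta>_def)
  obtain f0 V where f0: "bv f0 V" "dist_L1 D f0 \<le> \<delta>"
    using bv_dense_L1[OF D(1)] \<delta>(1) unfolding bv_approx_def by blast
  define f1 where "f1 = (\<lambda>x. max 0 (f0 x))"
  have f1: "bv f1 V" unfolding f1_def by (rule bv_max[OF f0(1)])
  note i1 = bv_integrable[OF f1]
  have "dist_L1 D f1 \<le> dist_L1 D f0"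
  proof (rule integral_mono)
    show "\<bar>D x - f1 x\<bar> \<le> \<bar>D x - f0 x\<bar>" for x using D(2)[of x] by (auto simp: f1_def)
  qed (use D(1) i1 bv_integrable[OF f0(1)] in auto)
  then have d1: "dist_L1 D f1 \<le> \<delta>" using f0(2) by simp
  have close: "\<bar>mass D A - mass f1 A\<bar> \<le> \<delta>" if "A \<in> sets lebesgue_I" for A
    using mass_diff_le[OF D(1) i1 that] d1 by simp
  define m where "m = mass f1 {0..1}"
  have m: "\<bar>m - 1\<bar> \<le> \<delta>" using close[of "{0..1}"] D(3) unfolding m_def by (simp add: abs_minus_commute)
  then have m0: "0 < m" using \<delta>(3) by linarith
  define f where "f = (\<lambda>x. (1 / m) * f1 x)"
  have massf: "mass f A = mass f1 A / m" for A unfolding f_def by simp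
  have "bv f ((1 / m) * V)" unfolding f_def using bv_affine[OF f1, of "1 / m" 0] m0 by simp
  then have "prob_density ((1 / m) * V) f"
    unfolding prob_density_def massf m_def[symmetric] using m0 by (simp add: f_def f1_def)
  moreover have "\<bar>mass D A - mass f A\<bar> \<le> \<epsilon>" if A: "A \<in> sets lebesgue_I" for A
  proof -
    have "0 \<le> mass f1 A" by (rule mass_nonneg[OF i1 A]) (simp add: f1_def)
    moreover have "mass f1 A \<le> m" unfolding m_def
      by (rule mass_mono_set[OF i1 A]) (use A sets_lebesgue_I_iff in \<open>auto simp: f1_def\<close>)
    moreover have "mass f1 A - mass f A = mass f1 A * ((m - 1) / m)"
      unfolding massf using m0 by (simp add: field_simps)
    ultimately have "\<bar>mass f1 A - mass f A\<bar> \<le> m * (\<bar>m - 1\<bar> / m)"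
      using m0 by (simp only: abs_mult abs_divide) (intro mult_mono; simp)
    then have "\<bar>mass f1 A - mass f A\<bar> \<le> \<delta>" using m m0 by simp
    with close[OF A] \<delta>(2) show ?thesis by linarith
  qed
  ultimately show ?thesis by blast
qed

lemma ac_measure_density:
  assumes \<mu>: "borel_prob_I \<mu>" and ac: "absolutely_continuous lebesgue_I \<mu>"
  obtains D where "integrable lebesgue_I D" "\<And>x. 0 \<le> D x" "\<And>A. A \<in> sets lebesgue_I \<Longrightarrow> measure \<mu> A = mass D A"
proof -
  interpret mu: prob_space \<mu> using \<mu> unfolding borel_prob_I_def by blast
  have sets: "sets \<mu> = sets lebesgue_I" using \<mu> unfolding borel_prob_I_def sets_lebesgue_I_eq by blast
  obtain D where D: "D \<in> borel_measurable lebesgue_I" "AE x in lebesgue_I. RN_deriv lebesgue_I \<mu> x = ennreal (D x)"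
    "\<And>x. 0 \<le> D x"
    using lebI.real_RN_deriv[OF mu.finite_measure_axioms ac sets] by metis
  have em: "emeasure \<mu> A = (\<integral>\<^sup>+x. ennreal (indicator A x * D x) \<partial>lebesgue_I)" if A: "A \<in> sets lebesgue_I" for A
  proof -
    have "emeasure \<mu> A = emeasure (density lebesgue_I (RN_deriv lebesgue_I \<mu>)) A"
      by (simp only: lebI.density_RN_deriv[OF ac sets])
    also have "\<dots> = (\<integral>\<^sup>+x. RN_deriv lebesgue_I \<mu> x * indicator A x \<partial>lebesgue_I)"
      by (rule emeasure_density[OF borel_measurable_RN_deriv A])
    also have "\<dots> = (\<integral>\<^sup>+x. ennreal (indicator A x * D x) \<partial>lebesgue_I)"
      by (rule nn_integral_cong_AE) (use D(2) in \<open>eventually_elim, auto split: split_indicator\<close>)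
    finally show ?thesis .
  qed
  have iA: "integrable lebesgue_I (\<lambda>x. indicator A x * D x)" if A: "A \<in> sets lebesgue_I" for A
  proof (rule integrableI_nonneg)
    show "(\<lambda>x. indicator A x * D x) \<in> borel_measurable lebesgue_I"
      using D(1) A by (intro borel_measurable_times borel_measurable_indicator)
    show "(\<integral>\<^sup>+x. ennreal (indicator A x * D x) \<partial>lebesgue_I) < \<infinity>"
      unfolding em[OF A, symmetric] by (simp add: mu.emeasure_eq_measure)
  qed (use D(3) in auto)
  have "measure \<mu> A = mass D A" if A: "A \<in> sets lebesgue_I" for A
  proof -
    have "emeasure \<mu> A = ennreal (LINT x|lebesgue_I. indicator A x * D x)"
      unfolding em[OF A] by (rule nn_integral_eq_integral[OF iA[OF A]]) (use D(3) in auto)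
    moreover have "0 \<le> (LINT x|lebesgue_I. indicator A x * D x)" using D(3) by (intro integral_nonneg_AE) auto
    ultimately show ?thesis unfolding set_lebesgue_integral_def by (simp add: measure_def)
  qed
  moreover have "integrable lebesgue_I D"
  proof -
    have "{0..1} \<in> sets lebesgue_I" by simp
    from iA[OF this] show ?thesis
      by (subst Bochner_Integration.integrable_cong[OF refl, of _ D "\<lambda>x. indicator {0..1} x * D x"])
        (auto simp: space_lebesgue_I)
  qed
  ultimately show ?thesis using D(3) that by blast
qed

theorem srb_equidistribution:
  assumes TI: "T \<in> {0..1} \<rightarrow> {0..1}" and pe: "piecewise_expanding T"
    and \<mu>: "borel_prob_I \<mu>" and inv: "invariant_measure T \<mu>" and ac: "absolutely_continuous lebesgue_I \<mu>"
  obtains q :: nat where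
    "\<And>n A. A \<in> sets lebesgue_I \<Longrightarrow> \<bar>measure \<mu> A - measure lebesgue_I ((T ^^ (q * n)) -` A \<inter> {0..1})\<bar> \<le> 1 / 2 ^ n"
    "T \<in> measurable lebesgue_I lebesgue_I"
    "\<And>A. A \<in> null_sets lebesgue_I \<Longrightarrow> T -` A \<inter> {0..1} \<in> null_sets lebesgue_I"
proof -
  have sets: "sets \<mu> = sets lebesgue_I" using \<mu> unfolding borel_prob_I_def sets_lebesgue_I_eq by blast
  have space: "space \<mu> = {0..1}" using sets_eq_imp_space_eq[OF sets] by (simp add: space_lebesgue_I)
  have Tm: "T \<in> measurable lebesgue_I lebesgue_I"
    using inv unfolding invariant_measure_def by (simp cong: measurable_cong_sets add: sets)
  obtain Z where Z: "piecewise_branches T Z" using piecewise_expanding_branches[OF pe] by blast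
  interpret T: branched_map T Z by unfold_locales (rule Z TI Tm)+
  obtain C \<sigma> where C: "0 < C" "1 < \<sigma>" "\<And>n x. n \<ge> 1 \<Longrightarrow> x \<in> {0..1} \<Longrightarrow> differentiable_I (T ^^ n) x \<Longrightarrow>
      C * \<sigma> ^ n < \<bar>deriv_I (T ^^ n) x\<bar>"
    using conjunct1[OF conjunct2[OF pe[unfolded piecewise_expanding_def]]] by (elim exE conjE) simp
  \<comment> \<open>The derivative has to exceed 16, the inverse of the weight bound; the successor
    in \<open>N\<close> ensures at least one application of \<open>T\<close>.\<close>
  obtain N0 where N0: "16 / C < \<sigma> ^ N0" using real_arch_pow[OF C(2)] by blast
  define N where "N = Suc N0"
  have "\<sigma> ^ N0 \<le> \<sigma> ^ N" unfolding N_def using C(2) by (intro power_increasing) auto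
  then have "C * \<sigma> ^ N0 \<le> C * \<sigma> ^ N" using C(1) by simp
  moreover have "16 < C * \<sigma> ^ N0" using N0 C(1) by (simp add: field_simps)
  ultimately have N: "16 < C * \<sigma> ^ N" by linarith
  define S where "S = T ^^ N"
  obtain Y where Y: "piecewise_branches S Y" unfolding S_def N_def using piecewise_branches_funpow[OF Z TI] by blast
  note YD = piecewise_branchesD[OF Y]
  have small: "inverse \<bar>deriv S x\<bar> \<le> 1 / 16" if x: "x \<in> {0..1} - Y" for x
  proof -
    obtain a b where ab: "(a, b) \<in> comps Y" "x \<in> {a<..<b}" using comps_cover[OF YD(1-3) x] by blast
    then have d: "(S has_real_derivative deriv S x) (at x)" using YD(5)[OF ab(1)] unfolding branch_def by blast
    have I: "x \<in> {0..1}" using x by blast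
    have "C * \<sigma> ^ N < \<bar>deriv S x\<bar>"
      using C(3)[of N x] has_real_derivative_I[OF d I] I unfolding S_def N_def by simp
    with N have "16 \<le> \<bar>deriv S x\<bar>" by linarith
    then have "inverse \<bar>deriv S x\<bar> \<le> inverse 16" by (intro le_imp_inverse_le) auto
    then show ?thesis by simp
  qed
  have "\<exists>Z'. piecewise_branches S Z' \<and> (\<forall>x\<in>{0..1} - Z'. inverse \<bar>deriv S x\<bar> \<le> 1 / 16) \<and>
     (\<forall>a b. (a, b) \<in> comps Z' \<longrightarrow>
       (\<exists>F. dominated {a..b} (\<lambda>x. if x \<in> Z' then 0 else inverse \<bar>deriv S x\<bar>) F \<and> F b - F a \<le> 1 / 4))"
    by (rule refine_branches[OF Y], erule small, rule exI, intro conjI ballI allI impI, assumption, blast, blast)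
  then obtain Z' where Z': "piecewise_branches S Z'" "\<And>x. x \<in> {0..1} - Z' \<Longrightarrow> inverse \<bar>deriv S x\<bar> \<le> 1 / 16"
    "\<And>a b. (a, b) \<in> comps Z' \<Longrightarrow>
       \<exists>F. dominated {a..b} (\<lambda>x. if x \<in> Z' then 0 else inverse \<bar>deriv S x\<bar>) F \<and> F b - F a \<le> 1 / 4"
    by blast
  have Sm: "S \<in> measurable lebesgue_I lebesgue_I" unfolding S_def by (rule measurable_funpow[OF Tm])
  have SI: "S \<in> {0..1} \<rightarrow> {0..1}" unfolding S_def by (rule funpow_unit_interval[OF TI])
  interpret S: branched_map S Z' by unfold_locales (rule Z'(1) SI Sm)+
  \<comment> \<open>\<open>T\<close> is onto because some positive iterate is. Hence an interval
    whose image has once become everything keeps this property at all later times, as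
    \<open>covering\<close> demands.\<close>
  have onto: "(T ^^ n) ` {0..1} = {0..1}" for n
  proof -
    obtain n1 where n1: "n1 \<ge> 1" "(T ^^ n1) ` {0..1} = {0..1}"
      using conjunct2[OF conjunct2[OF pe[unfolded piecewise_expanding_def]]]
      by (elim allE[of _ "{0..1}"]) auto
    have "(T ^^ n1) ` {0..1} \<subseteq> T ` {0..1}"
    proof -
      have "T ^^ n1 = T \<circ> (T ^^ (n1 - 1))" using n1(1) by (cases n1) auto
      then have "(T ^^ n1) ` {0..1} = T ` ((T ^^ (n1 - 1)) ` {0..1})" by (simp only: image_comp)
      also have "\<dots> \<subseteq> T ` {0..1}" using funpow_unit_interval[OF TI, of "n1 - 1"] by (intro image_mono) blast
      finally show ?thesis .
    qed
    with n1(2) have T1: "T ` {0..1} = {0..1}" using TI by blast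
    show ?thesis
    proof (induction n)
      case (Suc n)
      have "(T ^^ Suc n) ` {0..1} = T ` ((T ^^ n) ` {0..1})" by (simp only: funpow.simps(2) image_comp)
      then show ?case unfolding Suc T1 .
    qed simp
  qed
  have cover: "\<exists>n0. \<forall>n\<ge>n0. (S ^^ n) ` {a..b} = {0..1}" if ab: "0 \<le> a" "a < b" "b \<le> 1" for a b
  proof -
    have "is_interval {a..b} \<and> {a..b} \<subseteq> {0..1} \<and> 0 < emeasure lborel {a..b}"
      using ab by (auto simp: is_interval_cc)
    then obtain n0 where n0: "(T ^^ n0) ` {a..b} = {0..1}"
      using conjunct2[OF conjunct2[OF pe[unfolded piecewise_expanding_def]]] by blast
    have "(S ^^ n) ` {a..b} = {0..1}" if "n \<ge> n0" for n
    proof -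
      have "n \<le> N * n" by (simp add: N_def)
      with that have "n0 \<le> N * n" by (rule order_trans)
      then have "N * n = (N * n - n0) + n0" by simp
      then have "S ^^ n = (T ^^ (N * n - n0)) \<circ> (T ^^ n0)"
        unfolding S_def funpow_mult by (metis funpow_add)
      then have "(S ^^ n) ` {a..b} = (T ^^ (N * n - n0)) ` ((T ^^ n0) ` {a..b})" by (simp only: image_comp)
      then show ?thesis unfolding n0 onto .
    qed
    then show ?thesis by blast
  qed
  interpret S: expanding_map S Z'
  proof unfold_locales
    show "S.weight x \<le> 1 / 16" if "x \<in> {0..1}" for x
      using Z'(2)[of x] that by (simp add: S.weight_def)
    show "\<exists>G. dominated {a..b} S.weight G \<and> G b - G a \<le> 1 / 4" if "(a, b) \<in> comps Z'" for a b
      using Z'(3)[OF that] unfolding S.weight_def[abs_def] .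
    show "\<exists>n0. \<forall>n\<ge>n0. (S ^^ n) ` {a..b} = {0..1}" if "0 \<le> a" "a < b" "b \<le> 1" for a b
      by (rule cover[OF that])
  qed
  obtain D where D: "integrable lebesgue_I D" "\<And>x. 0 \<le> D x"
    "\<And>A. A \<in> sets lebesgue_I \<Longrightarrow> measure \<mu> A = mass D A"
    using ac_measure_density[OF \<mu> ac] by metis
  interpret mu: prob_space \<mu> using \<mu> unfolding borel_prob_I_def by blast
  have "mass D {0..1} = 1" using D(3)[of "{0..1}"] mu.prob_space space by simp
  from approx_by_prob_density[OF D(1,2) this]
  have approx: "\<exists>f V. prob_density V f \<and> (\<forall>A\<in>sets lebesgue_I. \<bar>measure \<mu> A - mass f A\<bar> \<le> \<epsilon>)" if "0 < \<epsilon>" for \<epsilon>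
    using that D(3) by simp
  have invT: "measure \<mu> (T -` A \<inter> {0..1}) = measure \<mu> A" if A: "A \<in> sets lebesgue_I" for A
  proof -
    have "T \<in> measurable \<mu> \<mu>" "distr \<mu> \<mu> T = \<mu>" using inv unfolding invariant_measure_def by auto
    then have "measure \<mu> A = measure \<mu> (T -` A \<inter> space \<mu>)"
      using measure_distr[of T \<mu> \<mu> A] A sets by simp
    then show ?thesis by (simp add: space)
  qed
  have invn: "measure \<mu> ((T ^^ n) -` A \<inter> {0..1}) = measure \<mu> A" if "A \<in> sets lebesgue_I" for n A
    using that
  proof (induction n arbitrary: A)
    case 0
    then show ?case using sets_lebesgue_I_iff by (simp add: Int_absorb2)
  next
    case (Suc n)
    show ?case unfolding T.iterate_preimage_Suc
      using Suc.IH[OF T.preimage_sets[OF Suc.prems]] invT[OF Suc.prems] by (rule trans)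
  qed
  have invS: "measure \<mu> (S -` A \<inter> {0..1}) = measure \<mu> A" if "A \<in> sets lebesgue_I" for A
    unfolding S_def by (rule invn[OF that])
  obtain k \<theta> where k: "0 \<le> \<theta>" "\<theta> < 1"
    "\<And>n A. A \<in> sets lebesgue_I \<Longrightarrow> \<bar>measure \<mu> A - measure lebesgue_I ((S ^^ (k * n)) -` A \<inter> {0..1})\<bar> \<le> \<theta> ^ n"
    using S.equidistribution[OF approx invS] by metis
  \<comment> \<open>\<open>r\<close> steps turn the rate \<open>\<theta>\<close> into 1/2; as
    \<open>S\<close> is \<open>T ^^ N\<close>, the number \<open>q\<close> is
    \<open>N * k * r\<close>.\<close>
  obtain r where r: "\<theta> ^ r < 1 / 2" using real_arch_pow_inv[OF _ k(2), of "1 / 2"] by auto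
  have "\<bar>measure \<mu> A - measure lebesgue_I ((T ^^ ((N * k * r) * n)) -` A \<inter> {0..1})\<bar> \<le> 1 / 2 ^ n"
    if A: "A \<in> sets lebesgue_I" for n A
  proof -
    have "S ^^ (k * (r * n)) = T ^^ ((N * k * r) * n)" unfolding S_def funpow_mult by (simp add: mult.assoc)
    moreover have "\<theta> ^ (r * n) \<le> (1 / 2) ^ n" unfolding power_mult using k(1) r by (intro power_mono) auto
    ultimately show ?thesis using k(3)[OF A, of "r * n"] by (simp add: power_one_over)
  qed
  then show ?thesis using Tm T.preimage_null by (rule that)
qed

section \<open>Measures of balls and grid approximations\<close>

text \<open>Nonsingularity carries an almost sure property along orbits: the exceptional null set is
  pulled back once for each step.\<close>

lemma AE_pullback:
  assumes T: "\<forall>A\<in>null_sets lebesgue_I. T -` A \<inter> {0..1} \<in> null_sets lebesgue_I"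
    and TI: "T \<in> {0..1} \<rightarrow> {0..1}" and P: "AE x in lebesgue_I. P x"
  shows "AE x in lebesgue_I. P ((T ^^ n) x)"
proof (induction n)
  case 0
  then show ?case using P by simp
next
  case (Suc n)
  obtain N where N: "{x \<in> space lebesgue_I. \<not> P ((T ^^ n) x)} \<subseteq> N" "N \<in> null_sets lebesgue_I"
    using AE_E[OF Suc] null_setsI by metis
  show ?case
  proof (rule AE_I'[OF bspec[OF T N(2)]])
    show "{x \<in> space lebesgue_I. \<not> P ((T ^^ Suc n) x)} \<subseteq> T -` N \<inter> {0..1}"
    proof
      fix x assume x: "x \<in> {x \<in> space lebesgue_I. \<not> P ((T ^^ Suc n) x)}"
      then have "x \<in> {0..1}" "T x \<in> {0..1}" using TI by (auto simp: space_lebesgue_I)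
      then show "x \<in> T -` N \<inter> {0..1}"
        using x N(1) by (auto simp: space_lebesgue_I funpow_swap1)
    qed
  qed
qed

section \<open>Lebesgue measure of unions of ideal balls\<close>

lemma ideal_ball_sets: "ideal_ball k \<in> sets lebesgue_I"
proof -
  obtain i j where k: "prod_decode k = (i, j)" by force
  have "ideal_ball k = {0..1} \<inter> ball (ideal_point i) (pos_rational j)"
    unfolding ideal_ball_def k by auto
  then show ?thesis unfolding sets_lebesgue_I_iff by simp
qed

lemma ideal_ball_subset: "ideal_ball k \<subseteq> {0..1}"
  using ideal_ball_sets sets_lebesgue_I_iff by blast

lemma ideal_ball_convex: "x \<in> ideal_ball l \<Longrightarrow> y \<in> ideal_ball l \<Longrightarrow> x \<le> z \<Longrightarrow> z \<le> y \<Longrightarrow> z \<in> ideal_ball l"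
  by (auto simp: ideal_ball_def dist_real_def split: prod.splits)

lemma ideal_ball_open:
  assumes "x \<in> ideal_ball l"
  obtains \<epsilon> where "0 < \<epsilon>" "\<And>y. y \<in> {0..1} \<Longrightarrow> \<bar>y - x\<bar> < \<epsilon> \<Longrightarrow> y \<in> ideal_ball l"
proof -
  obtain i j where l: "prod_decode l = (i, j)" by force
  have x: "dist (ideal_point i) x < pos_rational j" using assms unfolding ideal_ball_def l by simp
  show ?thesis
  proof (rule that[of "pos_rational j - dist (ideal_point i) x"])
    show "y \<in> ideal_ball l" if "y \<in> {0..1}" "\<bar>y - x\<bar> < pos_rational j - dist (ideal_point i) x" for y
      using that unfolding ideal_ball_def l dist_real_def by auto
  qed (use x in simp)
qed

text \<open>Membership of the two rational end points is decidable and, since balls are convex,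
  places the whole cell inside the ball.\<close>

definition cell_in :: "nat \<Rightarrow> nat \<Rightarrow> nat \<Rightarrow> bool" where
  "cell_in l t K \<longleftrightarrow> real t / real K \<in> ideal_ball l \<and> real (Suc t) / real K \<in> ideal_ball l"

lemma cell_Ioc_subset:
  assumes "cell_in l t K"
  shows "{real t / real K<..real (Suc t) / real K} \<subseteq> ideal_ball l"
proof
  fix x assume "x \<in> {real t / real K<..real (Suc t) / real K}"
  then have "real t / real K \<le> x" "x \<le> real (Suc t) / real K" by simp_all
  then show "x \<in> ideal_ball l" using assms ideal_ball_convex unfolding cell_in_def by blast
qed

lemma grid_cells_disjoint:
  assumes "s \<noteq> t"
  shows "{real s / real K<..real (Suc s) / real K} \<inter> {real t / real K<..real (Suc t) / real K} = {}"
proof -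
  have "Suc s \<le> t \<or> Suc t \<le> s" using assms by linarith
  then have "real (Suc s) / real K \<le> real t / real K \<or> real (Suc t) / real K \<le> real s / real K"
    by (meson divide_right_mono of_nat_0_le_iff of_nat_le_iff)
  then show ?thesis by auto
qed

lemma open_grid_cells_disjoint:
  "disjoint_family_on (\<lambda>j. {real j / real K<..<real (Suc j) / real K}) J"
  unfolding disjoint_family_on_def
proof (intro ballI impI)
  fix s t :: nat assume "s \<noteq> t"
  then show "{real s / real K<..<real (Suc s) / real K} \<inter> {real t / real K<..<real (Suc t) / real K} = {}"
    using grid_cells_disjoint[of s t K] greaterThanAtMost_iff greaterThanLessThan_iff less_imp_le
    by (metis (no_types, lifting) disjoint_iff)
qed

lemma measure_cells:
  assumes "K > 0" "S \<subseteq> {..<K}"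
  shows "measure lebesgue_I (\<Union>t\<in>S. {real t / real K<..real (Suc t) / real K}) = real (card S) / real K"
    (is "measure _ (\<Union>t\<in>S. ?C t) = _")
proof -
  have I: "0 \<le> real t / real K" "real t / real K \<le> real (Suc t) / real K" "real (Suc t) / real K \<le> 1"
    if "t \<in> S" for t
    using assms that by (auto simp: divide_simps)
  have "measure lebesgue_I (\<Union>t\<in>S. ?C t) = (\<Sum>t\<in>S. measure lebesgue_I (?C t))"
  proof (rule lebI.finite_measure_finite_Union)
    show "finite S" using assms(2) finite_subset by blast
    show "?C ` S \<subseteq> sets lebesgue_I" using I by (intro image_subsetI interval_sets_lebesgue_I)
    show "disjoint_family_on ?C S"
      unfolding disjoint_family_on_def using grid_cells_disjoint by blast
  qed
  also have "\<dots> = (\<Sum>t\<in>S. 1 / real K)"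
  proof (rule sum.cong[OF refl])
    fix t assume "t \<in> S"
    from measure_lebesgue_I_Ioc[OF I[OF this]] show "measure lebesgue_I (?C t) = 1 / real K"
      by (simp add: add_divide_distrib)
  qed
  finally show ?thesis by simp
qed

lemma balls_sets: "(\<Union>l\<in>L. ideal_ball l) \<in> sets lebesgue_I"
  by (rule sets.countable_UN'') (auto intro: ideal_ball_sets)

lemma cells_lower_bound:
  assumes "K > 0" "S \<subseteq> {..<K}" "\<And>t. t \<in> S \<Longrightarrow> \<exists>l\<in>L. cell_in l t K"
  shows "real (card S) / real K \<le> measure lebesgue_I (\<Union>l\<in>L. ideal_ball l)"
  unfolding measure_cells[OF assms(1,2), symmetric]
proof (rule lebI.finite_measure_mono[OF _ balls_sets])
  show "(\<Union>t\<in>S. {real t / real K<..real (Suc t) / real K}) \<subseteq> (\<Union>l\<in>L. ideal_ball l)"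
    using assms(3) cell_Ioc_subset by blast
qed

lemma cell_in_refine:
  assumes "cell_in l t K"
  shows "cell_in l (2 * t) (2 * K)" "cell_in l (Suc (2 * t)) (2 * K)"
proof -
  have e: "real (2 * t) / real (2 * K) = real t / real K" "real (Suc (Suc (2 * t))) / real (2 * K) = real (Suc t) / real K"
  proof -
    have "real (2 * t) = 2 * real t" "real (Suc (Suc (2 * t))) = 2 * real (Suc t)" "real (2 * K) = 2 * real K" by simp_all
    then show "real (2 * t) / real (2 * K) = real t / real K" "real (Suc (Suc (2 * t))) / real (2 * K) = real (Suc t) / real K"
      by (simp_all only: mult_divide_mult_cancel_left_if) simp_all
  qed
  have "real t / real K \<le> real (Suc (2 * t)) / real (2 * K)" "real (Suc (2 * t)) / real (2 * K) \<le> real (Suc t) / real K"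
    unfolding e[symmetric] by (intro divide_right_mono; simp)+
  then have "real (Suc (2 * t)) / real (2 * K) \<in> ideal_ball l"
    using assms ideal_ball_convex unfolding cell_in_def by blast
  then show "cell_in l (2 * t) (2 * K)" "cell_in l (Suc (2 * t)) (2 * K)"
    using assms unfolding cell_in_def e by simp_all
qed

text \<open>Dyadic grids are nested, so the cells contained in some ball increase with the level and
  exhaust the union up to one point. Continuity from below then brings the cell counts close to its
  measure.\<close>

lemma cells_approximate:
  assumes "r < measure lebesgue_I (\<Union>l\<in>L. ideal_ball l)"
  shows "\<exists>K>0. r < real (card {t. t < K \<and> (\<exists>l\<in>L. cell_in l t K)}) / real K"
proof -
  define S where "S k = {t. t < 2 ^ k \<and> (\<exists>l\<in>L. cell_in l t (2 ^ k))}" for k :: nat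
  define W where "W k = (\<Union>t\<in>S k. {real t / real (2 ^ k)<..real (Suc t) / real (2 ^ k)})" for k :: nat
  have mW: "measure lebesgue_I (W k) = real (card (S k)) / real (2 ^ k)" for k
    unfolding W_def by (rule measure_cells) (auto simp: S_def)
  have sub: "W k \<subseteq> (\<Union>l\<in>L. ideal_ball l)" for k
    unfolding W_def S_def using cell_Ioc_subset by blast
  have inc: "W k \<subseteq> W (Suc k)" for k
  proof
    fix x assume "x \<in> W k"
    then obtain t l where t: "t < 2 ^ k" "l \<in> L" "cell_in l t (2 ^ k)"
      "real t / real (2 ^ k) < x" "x \<le> real (Suc t) / real (2 ^ k)"
      unfolding W_def S_def by auto
    have S: "2 * t \<in> S (Suc k)" "Suc (2 * t) \<in> S (Suc k)"
      using t(1,2) cell_in_refine[OF t(3)] by (auto simp: S_def)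
    show "x \<in> W (Suc k)"
    proof (cases "x \<le> real (Suc (2 * t)) / real (2 ^ Suc k)")
      case True
      moreover have "real (2 * t) / real (2 ^ Suc k) < x" using t(4) by simp
      ultimately show ?thesis unfolding W_def by (intro UN_I[OF S(1)]) simp
    next
      case False
      moreover have "x \<le> real (Suc (Suc (2 * t))) / real (2 ^ Suc k)" using t(5) by (simp add: field_simps)
      ultimately show ?thesis unfolding W_def by (intro UN_I[OF S(2)]) simp
    qed
  qed
  \<comment> \<open>The half-open cells miss the point 0, which has measure 0.\<close>
  have cover: "(\<Union>l\<in>L. ideal_ball l) - {0..0} \<subseteq> (\<Union>k. W k)"
  proof
    fix x assume "x \<in> (\<Union>l\<in>L. ideal_ball l) - {0..0}"
    then obtain l where l: "l \<in> L" "x \<in> ideal_ball l" "x \<noteq> 0" by auto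
    then have x: "0 < x" "x \<le> 1" using ideal_ball_subset[of l] by force+
    obtain \<epsilon> where e: "0 < \<epsilon>" "\<And>y. y \<in> {0..1} \<Longrightarrow> \<bar>y - x\<bar> < \<epsilon> \<Longrightarrow> y \<in> ideal_ball l"
      using ideal_ball_open[OF l(2)] by blast
    obtain k where "1 / \<epsilon> < 2 ^ k" using real_arch_pow[of 2 "1 / \<epsilon>"] by auto
    then have k: "1 / 2 ^ k < \<epsilon>" using e(1) by (simp add: field_simps)
    \<comment> \<open>The index of the half-open cell that contains \<open>x\<close>: ceiling minus
      1, since the right end belongs to the cell.\<close>
    define t where "t = nat (\<lceil>x * 2 ^ k\<rceil> - 1)"
    have pos: "0 < x * 2 ^ k" using x by simp
    then have "1 \<le> \<lceil>x * 2 ^ k\<rceil>" by linarith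
    then have rt: "real t = real_of_int \<lceil>x * 2 ^ k\<rceil> - 1" unfolding t_def by simp
    have t1: "real t < x * 2 ^ k" "x * 2 ^ k \<le> real (Suc t)" using rt by (simp_all, linarith+)
    have "x * 2 ^ k \<le> 2 ^ k" using x by simp
    then have "real t < 2 ^ k" using t1 by linarith
    then have tk: "t < 2 ^ k" by (metis of_nat_less_iff of_nat_numeral of_nat_power)
    then have tk': "real (Suc t) \<le> real (2 ^ k)" by (simp only: of_nat_le_iff Suc_le_eq)
    have c: "real t / real (2 ^ k) < x" "x \<le> real (Suc t) / real (2 ^ k)"
      using t1 by (simp_all add: field_simps)
    have d: "real (Suc t) / real (2 ^ k) = real t / real (2 ^ k) + 1 / 2 ^ k" by (simp add: field_simps)
    have "real t / real (2 ^ k) \<in> ideal_ball l"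
      by (rule e(2)) (use c d k x tk in auto)
    moreover have "real (Suc t) / real (2 ^ k) \<in> ideal_ball l"
    proof (rule e(2))
      show "\<bar>real (Suc t) / real (2 ^ k) - x\<bar> < \<epsilon>" using c d k by linarith
      show "real (Suc t) / real (2 ^ k) \<in> {0..1}" using tk' by (simp add: divide_simps)
    qed
    ultimately have "t \<in> S k" using l(1) tk unfolding S_def cell_in_def by auto
    then show "x \<in> (\<Union>k. W k)" unfolding W_def using c by auto
  qed
  have Ws: "W k \<in> sets lebesgue_I" for k
  proof -
    have "W k \<in> sets borel" unfolding W_def by (rule sets.finite_UN) (auto simp: S_def)
    then show ?thesis using sub[of k] balls_sets[of L] unfolding sets_lebesgue_I_iff by blast
  qed
  have lim: "(\<lambda>k. measure lebesgue_I (W k)) \<longlonglongrightarrow> measure lebesgue_I (\<Union>k. W k)"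
    using Ws inc by (intro lebI.finite_Lim_measure_incseq incseq_SucI) auto
  have le: "measure lebesgue_I (\<Union>l\<in>L. ideal_ball l) \<le> measure lebesgue_I (\<Union>k. W k)"
  proof -
    have "measure lebesgue_I (\<Union>l\<in>L. ideal_ball l) \<le> measure lebesgue_I ((\<Union>k. W k) \<union> {0..0})"
    proof (rule lebI.finite_measure_mono)
      show "(\<Union>l\<in>L. ideal_ball l) \<subseteq> (\<Union>k. W k) \<union> {0..0}" using cover by blast
      show "(\<Union>k. W k) \<union> {0..0} \<in> sets lebesgue_I"
        by (intro sets.Un sets.countable_UN) (use Ws in \<open>auto intro!: interval_sets_lebesgue_I(1) simp del: atLeastAtMost_singleton\<close>)
    qed
    also have "\<dots> \<le> measure lebesgue_I (\<Union>k. W k) + measure lebesgue_I {0..0}"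
      by (rule measure_Un_le)
        (use Ws in \<open>auto intro!: interval_sets_lebesgue_I(1) simp del: atLeastAtMost_singleton\<close>)
    also have "measure lebesgue_I {0..0} = 0" by (simp add: measure_lebesgue_I)
    finally show ?thesis by simp
  qed
  have "eventually (\<lambda>k. r < measure lebesgue_I (W k)) sequentially"
    by (rule order_tendstoD(1)[OF lim less_le_trans[OF assms le]])
  then obtain k where "r < measure lebesgue_I (W k)" using eventually_happens'[OF sequentially_bot] by blast
  then show ?thesis unfolding mW S_def by (intro exI[of _ "2 ^ k"]) simp
qed

text \<open>All data are fractions, so clearing denominators leaves inequalities between natural
  numbers.\<close>

lemma dec_in_ideal_ball:
  assumes "rec_fun l" "rec_fun t" "rec_fun K"
  shows "dec (\<lambda>e. real (t e) / real (Suc (K e)) \<in> ideal_ball (l e))"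
proof -
  let ?i = "\<lambda>e. fst (prod_decode (l e))" let ?j = "\<lambda>e. snd (prod_decode (l e))"
  let ?n = "\<lambda>e. fst (prod_decode (?i e)) mod Suc (Suc (snd (prod_decode (?i e))))"
  let ?d = "\<lambda>e. Suc (snd (prod_decode (?i e)))"
  let ?p = "\<lambda>e. Suc (fst (prod_decode (?j e)))" let ?q = "\<lambda>e. Suc (snd (prod_decode (?j e)))"
  \<comment> \<open>One of the two truncated differences is 0, so their sum is the distance.\<close>
  have abs: "\<bar>real a - real b\<bar> = real ((a - b) + (b - a))" for a b :: nat by (cases "a \<le> b") auto
  have eq: "real (t e) / real (Suc (K e)) \<in> ideal_ball (l e) \<longleftrightarrow> t e \<le> Suc (K e) \<and>
     ((?n e * Suc (K e) - t e * ?d e) + (t e * ?d e - ?n e * Suc (K e))) * ?q e < ?p e * (?d e * Suc (K e))" for e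
  proof -
    define n d k p q where "n = ?n e" and "d = ?d e" and "k = Suc (K e)" and "p = ?p e" and "q = ?q e"
    have pos: "d > 0" "k > 0" "q > 0" unfolding d_def k_def q_def by simp_all
    have ip: "ideal_point (?i e) = real n / real d"
      unfolding ideal_point_def n_def d_def by (simp add: case_prod_unfold)
    have pr: "pos_rational (?j e) = real p / real q"
      unfolding pos_rational_def p_def q_def by (simp add: case_prod_unfold)
    have "real (t e) / real k \<in> ideal_ball (l e) \<longleftrightarrow> real (t e) / real k \<le> 1 \<and> \<bar>real n / real d - real (t e) / real k\<bar> < real p / real q"
      unfolding ideal_ball_def by (simp add: case_prod_unfold ip pr dist_real_def)
    also have "real (t e) / real k \<le> 1 \<longleftrightarrow> t e \<le> k" using pos by simp
    also have "real n / real d - real (t e) / real k = (real (n * k) - real (t e * d)) / real (d * k)"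
      using pos by (simp add: field_simps)
    also have "\<bar>\<dots>\<bar> = real ((n * k - t e * d) + (t e * d - n * k)) / real (d * k)"
      using abs[of "n * k" "t e * d"] by (simp only: abs_divide abs_of_nat)
    also have "\<dots> < real p / real q \<longleftrightarrow> real ((n * k - t e * d) + (t e * d - n * k)) * real q < real p * real (d * k)"
    proof -
      have "a / x < b / y \<longleftrightarrow> a * y < b * x" if "0 < x" "0 < y" for a b x y :: real
        using that by (simp add: field_simps)
      then show ?thesis using pos by (simp del: of_nat_add of_nat_mult)
    qed
    also have "\<dots> \<longleftrightarrow> ((n * k - t e * d) + (t e * d - n * k)) * q < p * (d * k)"
      by (simp only: of_nat_mult[symmetric] of_nat_less_iff)
    finally show ?thesis unfolding n_def d_def k_def p_def q_def .
  qed
  show ?thesis unfolding eq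
    by (intro dec_conj dec_le dec_less rec_fun_add rec_fun_mult rec_fun_diff rec_fun_mod rec_fun_fst rec_fun_snd rec_fun_Suc assms)
qed

text \<open>A path of length \<open>n\<close> is coded by one number, which turns the iterated
  relation into a search.\<close>

lemma sig1_relpow:
  assumes R: "sig1 (\<lambda>e. (e 0, e (Suc 0)) \<in> R)" and f: "rec_fun f" "rec_fun g" "rec_fun n"
  shows "sig1 (\<lambda>e. (f e, g e) \<in> R ^^ n e)"
proof -
  have R': "sig1 (\<lambda>e. (f e, g e) \<in> R)" if "rec_fun f" "rec_fun g" for f g
    using sig1_subst[OF R, of "\<lambda>i. if i = 0 then f else g"] that by simp
  have eq: "(f e, g e) \<in> R ^^ n e \<longleftrightarrow>
     (\<exists>p. seq_nth p 0 = f e \<and> seq_nth p (n e) = g e \<and> (\<forall>i<n e. (seq_nth p i, seq_nth p (Suc i)) \<in> R))" for e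
  proof
    assume "(f e, g e) \<in> R ^^ n e"
    then obtain h where h: "h 0 = f e" "h (n e) = g e" "\<forall>i<n e. (h i, h (Suc i)) \<in> R"
      unfolding relpow_fun_conv by blast
    obtain p where p: "\<forall>j<Suc (n e). seq_nth p j = h j" using seq_nth_surj[of "Suc (n e)" h] by blast
    then show "\<exists>p. seq_nth p 0 = f e \<and> seq_nth p (n e) = g e \<and> (\<forall>i<n e. (seq_nth p i, seq_nth p (Suc i)) \<in> R)"
      using h by (intro exI[of _ p]) auto
  next
    assume "\<exists>p. seq_nth p 0 = f e \<and> seq_nth p (n e) = g e \<and> (\<forall>i<n e. (seq_nth p i, seq_nth p (Suc i)) \<in> R)"
    then show "(f e, g e) \<in> R ^^ n e" unfolding relpow_fun_conv by blast
  qed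
  note ren = rec_fun_rename[where p = Suc]
  show ?thesis unfolding eq
    by (intro sig1_ex sig1_conj sig1_ball sig1_dec[OF dec_eq] rec_fun_seq_nth rec_fun_const rec_fun_var ren f
        R' rec_fun_Suc)
qed


text \<open>The ball about the centre (2j+1)/(2M) of radius 1/(2M), that is, the open grid cell
  number \<open>j\<close>. Both numberings store a denominator minus 1, hence
  \<open>2 * M - 1\<close>.\<close>

definition grid_ball :: "nat \<Rightarrow> nat \<Rightarrow> nat" where
  "grid_ball M j = prod_encode (prod_encode (2 * j + 1, 2 * M - 1), prod_encode (0, 2 * M - 1))"

lemma grid_point:
  assumes "j < M"
  shows "ideal_point (prod_encode (2 * j + 1, 2 * M - 1)) = real (2 * j + 1) / real (2 * M)"
proof -
  have "(2 * j + 1) mod (2 * M - 1 + 2) = 2 * j + 1" using assms by (intro mod_less) simp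
  moreover have "2 * M - 1 + 1 = 2 * M" using assms by simp
  ultimately show ?thesis unfolding ideal_point_def by (simp only: prod_encode_inverse prod.case)
qed

lemma ideal_ball_grid:
  assumes "j < M"
  shows "ideal_ball (grid_ball M j) = {real j / real M<..<real (Suc j) / real M}"
proof -
  have M: "0 < real M" using assms by simp
  have "2 * M - 1 + 1 = 2 * M" using assms by simp
  then have r: "pos_rational (prod_encode (0, 2 * M - 1)) = 1 / real (2 * M)"
    unfolding pos_rational_def by (simp only: prod_encode_inverse prod.case) simp
  have e: "real (2 * j + 1) / real (2 * M) = real j / real M + 1 / real (2 * M)"
    "real (Suc j) / real M = real j / real M + 1 / real (2 * M) + 1 / real (2 * M)"
    using M by (simp_all add: field_simps)
  have b: "0 \<le> real j / real M" "real (Suc j) / real M \<le> 1" using assms by (simp_all add: divide_simps)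
  have "x \<in> ideal_ball (grid_ball M j) \<longleftrightarrow> x \<in> {real j / real M<..<real (Suc j) / real M}" for x
  proof -
    have "x \<in> ideal_ball (grid_ball M j) \<longleftrightarrow> x \<in> {0..1} \<and> \<bar>real j / real M + 1 / real (2 * M) - x\<bar> < 1 / real (2 * M)"
      unfolding ideal_ball_def grid_ball_def prod_encode_inverse prod.case grid_point[OF assms] r dist_real_def e(1) by blast
    also have "\<dots> \<longleftrightarrow> x \<in> {real j / real M<..<real (Suc j) / real M}"
      using b unfolding e(2) abs_less_iff atLeastAtMost_iff greaterThanLessThan_iff by linarith
    finally show ?thesis .
  qed
  then show ?thesis by blast
qed

text \<open>A list of \<open>M\<close> natural numbers \<open>a\<^sub>j\<close> is turned into the measure with the weights
  \<open>(a\<^sub>j + 1) / D\<close>; adding 1 makes them positive, and dividing by their sum makes the total 1.\<close>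

definition weight_sum :: "nat \<Rightarrow> nat \<Rightarrow> nat" where
  "weight_sum M a = (\<Sum>j<M. Suc (seq_nth a j))"

definition grid_code :: "nat \<Rightarrow> nat \<Rightarrow> nat" where
  "grid_code M a = rec_nat 0 (\<lambda>j r. Suc (prod_encode (prod_encode
     (prod_encode (2 * j + 1, 2 * M - 1), prod_encode (seq_nth a j, weight_sum M a - 1)), r))) M"

lemma weighted_points_grid_code:
  assumes "M > 0"
  shows "weighted_points (grid_code M a) =
    map (\<lambda>j. (prod_encode (2 * j + 1, 2 * M - 1), real (Suc (seq_nth a j)) / real (weight_sum M a))) (rev [0..<M])"
proof -
  let ?c = "\<lambda>j. prod_encode (prod_encode (2 * j + 1, 2 * M - 1), prod_encode (seq_nth a j, weight_sum M a - 1))"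
  \<comment> \<open>The code of a nonempty list is the successor of a pair code, so the recursion
    prepends entries and the list appears in reverse order.\<close>
  have "rec_nat 0 (\<lambda>j r. Suc (prod_encode (?c j, r))) n = list_encode (map ?c (rev [0..<n]))" for n
    by (induction n) simp_all
  then have code: "list_decode (grid_code M a) = map ?c (rev [0..<M])" unfolding grid_code_def by simp
  have "0 < weight_sum M a" unfolding weight_sum_def using assms by (intro sum_pos) auto
  then have "weight_sum M a - 1 + 1 = weight_sum M a" by simp
  then have "pos_rational (prod_encode (seq_nth a j, weight_sum M a - 1)) = real (Suc (seq_nth a j)) / real (weight_sum M a)" for j
    unfolding pos_rational_def by (simp only: prod_encode_inverse prod.case) simp
  then show ?thesis unfolding weighted_points_def code map_map comp_def by simp
qed

lemma sum_list_rev_upt: "sum_list (map f (rev [0..<n])) = (\<Sum>j<n. f j :: real)"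
  by (induction n) (simp_all add: add.commute)

lemma grid_code_wf:
  assumes "M > 0"
  shows "pmf_of_list_wf (weighted_points (grid_code M a))"
proof -
  have pos: "0 < weight_sum M a" unfolding weight_sum_def using assms by (intro sum_pos) auto
  have "(\<Sum>j<M. real (Suc (seq_nth a j)) / real (weight_sum M a)) = real (weight_sum M a) / real (weight_sum M a)"
    unfolding sum_divide_distrib[symmetric] by (simp only: weight_sum_def of_nat_sum)
  also have "\<dots> = 1" using pos by simp
  finally have "(\<Sum>j<M. real (Suc (seq_nth a j)) / real (weight_sum M a)) = 1" .
  then show ?thesis
    unfolding weighted_points_grid_code[OF assms] pmf_of_list_wf_def
    by (auto simp: comp_def sum_list_rev_upt simp del: of_nat_Suc)
qed

lemma ideal_point_in: "ideal_point k \<in> {0..1}"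
proof -
  obtain a b where k: "prod_decode k = (a, b)" by force
  have "a mod (b + 2) \<le> b + 1" using mod_less_divisor[of "b + 2" a] by linarith
  then have "real (a mod (b + 2)) \<le> real (b + 1)" by (rule of_nat_mono)
  then show ?thesis unfolding ideal_point_def k by (simp add: divide_simps)
qed

lemma measure_grid_code:
  assumes "M > 0" "A \<in> sets borel_I"
  shows "measure (ideal_measure (grid_code M a)) A =
    (\<Sum>j | j < M \<and> real (2 * j + 1) / real (2 * M) \<in> A. real (Suc (seq_nth a j)) / real (weight_sum M a))"
proof -
  let ?w = "weighted_points (grid_code M a)"
  have m: "ideal_point \<in> measurable (measure_pmf (pmf_of_list ?w)) borel_I"
    using ideal_point_in by (simp add: measurable_pmf_measure1 space_restrict_space)
  have "measure (ideal_measure (grid_code M a)) A = measure (measure_pmf (pmf_of_list ?w)) (ideal_point -` A)"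
    unfolding ideal_measure_def using measure_distr[OF m assms(2)] by simp
  also have "\<dots> = sum_list (map snd (filter (\<lambda>x. fst x \<in> ideal_point -` A) ?w))"
    by (rule measure_pmf_of_list[OF grid_code_wf[OF assms(1)]])
  also have "\<dots> = (\<Sum>j<M. if ideal_point (prod_encode (2 * j + 1, 2 * M - 1)) \<in> A
      then real (Suc (seq_nth a j)) / real (weight_sum M a) else 0)"
    unfolding weighted_points_grid_code[OF assms(1)] sum_list_map_filter'
    by (simp add: comp_def sum_list_rev_upt if_distrib cong: if_cong)
  also have "\<dots> = (\<Sum>j<M. if real (2 * j + 1) / real (2 * M) \<in> A
      then real (Suc (seq_nth a j)) / real (weight_sum M a) else 0)"
    by (rule sum.cong[OF refl]) (simp only: lessThan_iff grid_point)
  also have "\<dots> = (\<Sum>j | j < M \<and> real (2 * j + 1) / real (2 * M) \<in> A. real (Suc (seq_nth a j)) / real (weight_sum M a))"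
    by (subst sum.inter_filter[symmetric]) (auto simp: lessThan_def)
  finally show ?thesis .
qed

text \<open>Centres of grid cells are moved by less than \<open>1 / M\<close>, so it suffices that each weight
  exceeds the mass of its cell by at most \<open>\<delta>\<close>.\<close>

lemma prokhorov_grid_code:
  assumes M: "M > 0" and \<mu>: "borel_prob_I \<mu>"
    and cells: "\<And>j. j < M \<Longrightarrow> real (Suc (seq_nth a j)) / real (weight_sum M a) \<le>
       measure \<nu> {real j / real M<..<real (Suc j) / real M} + \<delta>"
    and \<nu>: "finite_measure \<nu>" "sets \<nu> = sets borel_I"
    and close: "\<And>A. A \<in> sets borel_I \<Longrightarrow> \<bar>measure \<mu> A - measure \<nu> A\<bar> \<le> \<eta>"
    and \<epsilon>: "real M * \<delta> + \<eta> \<le> \<epsilon>" "1 / real M \<le> \<epsilon>" and \<delta>: "0 \<le> \<delta>"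
  shows "prokhorov (ideal_measure (grid_code M a)) \<mu> \<le> \<epsilon>"
  unfolding prokhorov_def
proof (rule cInf_lower)
  show "bdd_below {\<epsilon>. 0 < \<epsilon> \<and> (\<forall>A\<in>sets borel_I. measure (ideal_measure (grid_code M a)) A \<le>
       measure \<mu> {x \<in> {0..1}. \<exists>a\<in>A. dist x a < \<epsilon>} + \<epsilon>)}"
    by (rule bdd_belowI[of _ 0]) auto
  interpret nu: finite_measure \<nu> by fact
  interpret mu: prob_space \<mu> using \<mu> unfolding borel_prob_I_def by blast
  have sets_\<mu>: "sets \<mu> = sets borel_I" using \<mu> unfolding borel_prob_I_def by blast
  have "0 < 1 / real M" using M by simp
  with \<epsilon>(2) have e0: "0 < \<epsilon>" by linarith
  let ?G = "\<lambda>j. {real j / real M<..<real (Suc j) / real M}"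
  have "measure (ideal_measure (grid_code M a)) A \<le> measure \<mu> {x \<in> {0..1}. \<exists>a\<in>A. dist x a < \<epsilon>} + \<epsilon>"
    if A: "A \<in> sets borel_I" for A
  proof -
    let ?J = "{j. j < M \<and> real (2 * j + 1) / real (2 * M) \<in> A}"
    let ?N = "{x \<in> {0..1}. \<exists>a\<in>A. dist x a < \<epsilon>}"
    have fin: "finite ?J" by simp
    have "open (\<Union>a\<in>A. ball a \<epsilon>)" by blast
    moreover have "?N = {0..1} \<inter> (\<Union>a\<in>A. ball a \<epsilon>)" by (auto simp: dist_commute)
    ultimately have N: "?N \<in> sets borel_I" by (auto simp: sets_restrict_space)
    have GI: "?G j \<subseteq> {0..1}" if "j < M" for j
    proof -
      have l: "0 \<le> real j / real M" and u: "real (Suc j) / real M \<le> 1" using that by (simp_all add: divide_simps)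
      show ?thesis
      proof
        fix x assume x: "x \<in> ?G j"
        then show "x \<in> {0..1}" using l u unfolding greaterThanLessThan_iff atLeastAtMost_iff by linarith
      qed
    qed
    have Gs: "?G j \<in> sets borel_I" if "j < M" for j
      using GI[OF that] by (auto simp: sets_restrict_space_iff)
    have "measure (ideal_measure (grid_code M a)) A = (\<Sum>j\<in>?J. real (Suc (seq_nth a j)) / real (weight_sum M a))"
      by (rule measure_grid_code[OF M A])
    also have "\<dots> \<le> (\<Sum>j\<in>?J. measure \<nu> (?G j) + \<delta>)" using cells by (intro sum_mono) auto
    also have "\<dots> = (\<Sum>j\<in>?J. measure \<nu> (?G j)) + real (card ?J) * \<delta>" by (simp add: sum.distrib)
    also have "\<dots> \<le> (\<Sum>j\<in>?J. measure \<nu> (?G j)) + real M * \<delta>"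
    proof -
      have "card ?J \<le> card {..<M}" by (rule card_mono) auto
      then show ?thesis using \<delta> by (intro add_left_mono mult_right_mono) auto
    qed
    also have "(\<Sum>j\<in>?J. measure \<nu> (?G j)) = measure \<nu> (\<Union>j\<in>?J. ?G j)"
    proof (rule nu.finite_measure_finite_Union[symmetric, OF fin])
      show "?G ` ?J \<subseteq> sets \<nu>" unfolding \<nu>(2) using Gs by blast
      show "disjoint_family_on ?G ?J" by (rule open_grid_cells_disjoint)
    qed
    also have "measure \<nu> (\<Union>j\<in>?J. ?G j) \<le> measure \<nu> ?N"
    proof (rule nu.finite_measure_mono)
      show "?N \<in> sets \<nu>" unfolding \<nu>(2) by (rule N)
      show "(\<Union>j\<in>?J. ?G j) \<subseteq> ?N"
      proof
        fix x assume "x \<in> (\<Union>j\<in>?J. ?G j)"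
        then obtain j where j: "j < M" "real (2 * j + 1) / real (2 * M) \<in> A" "x \<in> ?G j" by blast
        define u w where "u = real j / real M" and "w = 1 / real M"
        have e: "real (2 * j + 1) / real (2 * M) = u + w / 2" "real (Suc j) / real M = u + w" "0 < w"
          using M by (simp_all add: u_def w_def field_simps)
        have "u < x" "x < u + w" using j(3) unfolding e(2) u_def[symmetric] by simp_all
        then have "dist x (u + w / 2) < \<epsilon>" using e(3) \<epsilon>(2) unfolding dist_real_def w_def[symmetric] by linarith
        moreover have "x \<in> {0..1}" using GI[OF j(1)] j(3) by (rule subsetD)
        ultimately show "x \<in> ?N" using j(2) unfolding e(1) by blast
      qed
    qed
    also have "measure \<nu> ?N \<le> measure \<mu> ?N + \<eta>" using close[OF N] by linarith
    finally show ?thesis using \<epsilon>(1) by linarith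
  qed
  with e0 show "\<epsilon> \<in> {\<epsilon>. 0 < \<epsilon> \<and> (\<forall>A\<in>sets borel_I. measure (ideal_measure (grid_code M a)) A \<le>
       measure \<mu> {x \<in> {0..1}. \<exists>a\<in>A. dist x a < \<epsilon>} + \<epsilon>)}" by blast
qed

section \<open>The search condition and its semidecidability\<close>

lemma rec_fun_of_bool: "dec P \<Longrightarrow> rec_fun (\<lambda>e. of_bool (P e))"
  by (simp only: dec_def)

lemma rec_fun_weight_sum:
  assumes "rec_fun M" "rec_fun a"
  shows "rec_fun (\<lambda>e. weight_sum (M e) (a e))"
  unfolding weight_sum_def
  by (intro rec_fun_sum rec_fun_Suc rec_fun_seq_nth rec_fun_var rec_fun_rename[where p = Suc] assms)

lemma rec_fun_grid_ball:
  assumes "rec_fun M" "rec_fun j"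
  shows "rec_fun (\<lambda>e. grid_ball (M e) (j e))"
  unfolding grid_ball_def
  by (intro rec_fun_prod_encode rec_fun_add rec_fun_diff rec_fun_mult rec_fun_const assms)

lemma rec_fun_grid_code:
  assumes "rec_fun M" "rec_fun a"
  shows "rec_fun (\<lambda>e. grid_code (M e) (a e))"
  unfolding grid_code_def
  by (intro rec_fun_rec_nat rec_fun_prod_encode rec_fun_add rec_fun_diff rec_fun_mult rec_fun_const rec_fun_Suc
      rec_fun_seq_nth rec_fun_var rec_fun_weight_sum rec_fun_rename[where p = "\<lambda>i. Suc (Suc i)"] assms)

lemma sig1_enumerated:
  assumes "partial_recursive 2 \<phi>"
  shows "sig1 (\<lambda>e. (e 0, e (Suc 0)) \<in> {(i, k). \<exists>n. \<phi> [i, n] = Some k})"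
proof -
  obtain f where f: "\<And>xs. length xs = 2 \<Longrightarrow> \<phi> xs = recf_eval f xs"
    using assms unfolding partial_recursive_def by blast
  let ?G = "\<lambda>i e. if i = 0 then e (Suc (Suc 0)) else if i = Suc 0 then e (Suc 0) else e 0"
  have "rec_fun (?G i)" for i
    by (cases "i = 0"; cases "i = Suc 0") auto
  from sig1_subst[where G = ?G, OF sig1_recf_graph[of f 2] this]
  have "sig1 (\<lambda>e. recf_eval f [e (Suc 0), e 0] = Some (e (Suc (Suc 0))))"
    by (simp add: numeral_2_eq_2)
  then have "sig1 (\<lambda>e. \<exists>n. recf_eval f [e 0, n] = Some (e (Suc 0)))" by (intro sig1_ex)
  then show ?thesis by (simp add: f)
qed

text \<open>\<open>R\<close> relates a ball to the balls that make up its preimage, so \<open>R ^^ N\<close> describes the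
  preimages under \<open>T ^^ N\<close>.\<close>

lemma iterate_ball_preimage:
  assumes T: "\<forall>A\<in>null_sets lebesgue_I. T -` A \<inter> {0..1} \<in> null_sets lebesgue_I"
    and TI: "T \<in> {0..1} \<rightarrow> {0..1}" and E: "AE x in lebesgue_I. x \<in> E"
    and U: "\<And>i. T -` ideal_ball i \<inter> E = (\<Union>k\<in>R `` {i}. ideal_ball k) \<inter> E"
  shows "AE x in lebesgue_I. \<forall>i. (T ^^ N) x \<in> ideal_ball i \<longleftrightarrow> x \<in> (\<Union>l\<in>(R ^^ N) `` {i}. ideal_ball l)"
proof (induction N)
  case 0
  show ?case by (rule AE_I2) auto
next
  case (Suc N)
  have "AE x in lebesgue_I. \<forall>i. (T ^^ N) (T x) \<in> ideal_ball i \<longleftrightarrow> T x \<in> (\<Union>l\<in>(R ^^ N) `` {i}. ideal_ball l)"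
    using AE_pullback[OF T TI Suc, of 1] by simp
  with E show ?case
  proof eventually_elim
    case (elim x)
    have "T x \<in> ideal_ball l \<longleftrightarrow> x \<in> (\<Union>k\<in>R `` {l}. ideal_ball k)" for l using U[of l] elim(1) by blast
    then have "(T ^^ Suc N) x \<in> ideal_ball i \<longleftrightarrow> (\<exists>l k. (i, l) \<in> R ^^ N \<and> (l, k) \<in> R \<and> x \<in> ideal_ball k)" for i
      using elim(2) by (simp add: funpow_swap1) blast
    moreover have "(\<exists>l k. (i, l) \<in> R ^^ N \<and> (l, k) \<in> R \<and> x \<in> ideal_ball k) \<longleftrightarrow>
        x \<in> (\<Union>l\<in>(R ^^ Suc N) `` {i}. ideal_ball l)" for i
      by (auto simp: relcomp_unfold)
    ultimately show ?case by blast
  qed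
qed

text \<open>A certificate that a weight is below the mass of the balls reached from \<open>b\<close>
  plus \<open>1 / (M * M)\<close>. In a grid of \<open>Suc K\<close> cells, \<open>p\<close> labels
  a cell by 0 or by one plus the number of a ball containing it; the labelled cells bound the mass
  from below, and the inequality is written without denominators.\<close>

definition certified :: "(nat \<times> nat) set \<Rightarrow> nat \<Rightarrow> nat \<Rightarrow> nat \<Rightarrow> nat \<Rightarrow> nat \<Rightarrow> bool" where
  "certified R N M a j b \<longleftrightarrow> (\<exists>K p.
     Suc (seq_nth a j) * (Suc K * (M * M)) <
       (\<Sum>t<Suc K. of_bool (0 < seq_nth p t)) * (weight_sum M a * (M * M)) + Suc K * weight_sum M a \<and>
     (\<forall>t<Suc K. 0 < seq_nth p t \<longrightarrow>
        (b, seq_nth p t - 1) \<in> R ^^ N \<and> cell_in (seq_nth p t - 1) t (Suc K)))"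

text \<open>Soundness is \<open>cells_lower_bound\<close>, completeness
  \<open>cells_approximate\<close>: a strict inequality leaves room for a grid that proves
  it.\<close>

lemma certified_iff:
  assumes "M > 0"
  shows "certified R N M a j b \<longleftrightarrow> real (Suc (seq_nth a j)) / real (weight_sum M a) <
    measure lebesgue_I (\<Union>l\<in>(R ^^ N) `` {b}. ideal_ball l) + 1 / real (M * M)" (is "?L \<longleftrightarrow> ?R")
proof -
  have D: "0 < weight_sum M a" unfolding weight_sum_def using assms by (intro sum_pos) auto
  have MM: "0 < M * M" using assms by simp
  let ?m = "measure lebesgue_I (\<Union>l\<in>(R ^^ N) `` {b}. ideal_ball l)"
  \<comment> \<open>Cross multiplication by the positive denominators, which links the test on
    natural numbers to its real meaning.\<close>
  have arith: "s * (k * m) < c * (d * m) + k * d \<longleftrightarrow> real s / real d < real c / real k + 1 / real m"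
    if "0 < k" "0 < m" "0 < d" for s k m c d :: nat
  proof -
    have "real c / real k + 1 / real m = (real c * real m + real k) / (real k * real m)"
      using that by (simp add: field_simps)
    moreover have "real s / real d < (real c * real m + real k) / (real k * real m) \<longleftrightarrow>
        real s * (real k * real m) < (real c * real m + real k) * real d"
      using that by (simp add: divide_less_eq less_divide_eq field_simps)
    moreover have "\<dots> \<longleftrightarrow> real (s * (k * m)) < real (c * (d * m) + k * d)"
      by (simp add: algebra_simps)
    ultimately show ?thesis by (simp only: of_nat_less_iff)
  qed
  show ?thesis
  proof
    assume ?L
    then obtain K p where Kp:
      "Suc (seq_nth a j) * (Suc K * (M * M)) <
       (\<Sum>t<Suc K. of_bool (0 < seq_nth p t)) * (weight_sum M a * (M * M)) + Suc K * weight_sum M a"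
      "\<And>t. t < Suc K \<Longrightarrow> 0 < seq_nth p t \<Longrightarrow>
        (b, seq_nth p t - 1) \<in> R ^^ N \<and> cell_in (seq_nth p t - 1) t (Suc K)"
      unfolding certified_def by blast
    define S where "S = {t. t < Suc K \<and> 0 < seq_nth p t}"
    have c: "(\<Sum>t<Suc K. of_bool (0 < seq_nth p t)) = card S"
      unfolding S_def by (subst sum_of_bool_eq) (auto simp: Int_def lessThan_def)
    have "real (card S) / real (Suc K) \<le> ?m"
      by (rule cells_lower_bound) (use Kp(2) in \<open>auto simp: S_def\<close>)
    moreover have "real (Suc (seq_nth a j)) / real (weight_sum M a) < real (card S) / real (Suc K) + 1 / real (M * M)"
      using Kp(1) unfolding c by (rule arith[OF zero_less_Suc MM D, THEN iffD1])
    ultimately show ?R by linarith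
  next
    assume ?R
    then have "real (Suc (seq_nth a j)) / real (weight_sum M a) - 1 / real (M * M) < ?m" by linarith
    then obtain K' where K': "K' > 0" "real (Suc (seq_nth a j)) / real (weight_sum M a) - 1 / real (M * M) <
        real (card {t. t < K' \<and> (\<exists>l\<in>(R ^^ N) `` {b}. cell_in l t K')}) / real K'"
      using cells_approximate by blast
    then obtain K where K: "K' = Suc K" by (cases K') auto
    define S where "S = {t. t < Suc K \<and> (\<exists>l\<in>(R ^^ N) `` {b}. cell_in l t (Suc K))}"
    define L where "L t = (SOME l. (b, l) \<in> R ^^ N \<and> cell_in l t (Suc K))" for t
    have L: "(b, L t) \<in> R ^^ N \<and> cell_in (L t) t (Suc K)" if "t \<in> S" for t
      unfolding L_def by (rule someI_ex) (use that in \<open>auto simp: S_def\<close>)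
    obtain p where p: "\<And>t. t < Suc K \<Longrightarrow> seq_nth p t = (if t \<in> S then Suc (L t) else 0)"
      using seq_nth_surj[of "Suc K" "\<lambda>t. if t \<in> S then Suc (L t) else 0"] by blast
    have "(\<Sum>t<Suc K. of_bool (0 < seq_nth p t)) = (\<Sum>t<Suc K. of_bool (t \<in> S) :: nat)"
      by (rule sum.cong) (auto simp: p)
    also have "\<dots> = card S" unfolding S_def by (subst sum_of_bool_eq) (auto simp: Int_def lessThan_def)
    finally have c: "(\<Sum>t<Suc K. of_bool (0 < seq_nth p t)) = card S" .
    have "real (Suc (seq_nth a j)) / real (weight_sum M a) < real (card S) / real (Suc K) + 1 / real (M * M)"
      using K'(2) unfolding K S_def by linarith
    then have "Suc (seq_nth a j) * (Suc K * (M * M)) <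
       (\<Sum>t<Suc K. of_bool (0 < seq_nth p t)) * (weight_sum M a * (M * M)) + Suc K * weight_sum M a"
      unfolding c by (rule arith[OF zero_less_Suc MM D, THEN iffD2])
    moreover have "(b, seq_nth p t - 1) \<in> R ^^ N \<and> cell_in (seq_nth p t - 1) t (Suc K)"
      if "t < Suc K" "0 < seq_nth p t" for t
      using that p[OF that(1)] L[of t] by (cases "t \<in> S") auto
    ultimately show ?L unfolding certified_def by blast
  qed
qed

lemma sig1_certified:
  assumes R: "sig1 (\<lambda>e. (e 0, e (Suc 0)) \<in> R)"
    and f: "rec_fun N" "rec_fun M" "rec_fun a" "rec_fun j" "rec_fun b"
  shows "sig1 (\<lambda>e. certified R (N e) (M e) (a e) (j e) (b e))"
proof -
  note ren = rec_fun_rename[where p = Suc] rec_fun_rename[where p = "\<lambda>i. Suc (Suc i)"]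
    rec_fun_rename[where p = "\<lambda>i. Suc (Suc (Suc i))"]
  show ?thesis
    unfolding certified_def cell_in_def
    by (intro sig1_ex sig1_conj sig1_ball sig1_imp sig1_dec[OF dec_less] sig1_relpow[OF R] sig1_dec[OF dec_in_ideal_ball]
        dec_less rec_fun_add rec_fun_mult rec_fun_diff rec_fun_Suc rec_fun_sum rec_fun_of_bool rec_fun_seq_nth
        rec_fun_weight_sum rec_fun_const rec_fun_var ren f)
qed

text \<open>The numerators are the masses scaled by \<open>D\<close>, rounded down and increased by
  1. Their sum is thus at least \<open>D\<close>, so replacing the denominator \<open>D\<close> by
  the sum only lowers the weights, and each exceeds its mass by at most 1/D.\<close>

lemma grid_weights_exist:
  assumes M: "M > 0" and m: "\<And>j. j < M \<Longrightarrow> 0 \<le> m j" "(\<Sum>j<M. m j) = 1" and "0 < \<delta>"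
  obtains a where "\<And>j. j < M \<Longrightarrow> real (Suc (seq_nth a j)) / real (weight_sum M a) < m j + \<delta>"
proof -
  obtain D :: nat where "1 / \<delta> < real D" using reals_Archimedean2 by blast
  moreover have "0 < 1 / \<delta>" using \<open>0 < \<delta>\<close> by simp
  ultimately have "0 < real D" by linarith
  then have D: "0 < D" "1 / real D < \<delta>"
    using \<open>1 / \<delta> < real D\<close> \<open>0 < \<delta>\<close> by (simp_all add: field_simps)
  obtain a where a: "\<And>j. j < M \<Longrightarrow> seq_nth a j = nat \<lfloor>real D * m j\<rfloor>"
    using seq_nth_surj[of M "\<lambda>j. nat \<lfloor>real D * m j\<rfloor>"] by blast
  have up: "real D * m j \<le> real (Suc (seq_nth a j))" "real (Suc (seq_nth a j)) \<le> real D * m j + 1" if "j < M" for j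
  proof -
    have "0 \<le> real D * m j" using m(1)[OF that] by simp
    then have "real (seq_nth a j) = real_of_int \<lfloor>real D * m j\<rfloor>" unfolding a[OF that] by simp
    then show "real D * m j \<le> real (Suc (seq_nth a j))" "real (Suc (seq_nth a j)) \<le> real D * m j + 1"
      by (simp_all, linarith+)
  qed
  have "real D = (\<Sum>j<M. real D * m j)" using m(2) by (simp flip: sum_distrib_left)
  also have "\<dots> \<le> (\<Sum>j<M. real (Suc (seq_nth a j)))" using up by (intro sum_mono) auto
  also have "\<dots> = real (weight_sum M a)" unfolding weight_sum_def by (simp only: of_nat_sum)
  finally have W: "real D \<le> real (weight_sum M a)" .
  have "real (Suc (seq_nth a j)) / real (weight_sum M a) < m j + \<delta>" if j: "j < M" for j
  proof -
    have "real (Suc (seq_nth a j)) / real (weight_sum M a) \<le> real (Suc (seq_nth a j)) / real D"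
      using W D(1) by (intro divide_left_mono) auto
    also have "\<dots> \<le> (real D * m j + 1) / real D" using up(2)[OF j] by (intro divide_right_mono) auto
    also have "\<dots> = m j + 1 / real D" using D(1) by (simp add: field_simps)
    also have "\<dots> < m j + \<delta>" using D(2) by simp
    finally show ?thesis .
  qed
  then show ?thesis by (rule that)
qed

theorem proposition5:
  fixes T :: "real \<Rightarrow> real" and \<mu> :: "real measure"
  assumes "T \<in> {0..1} \<rightarrow> {0..1}"
    and "ae_computable lebesgue_I T"
    and "piecewise_expanding T"
    and "SRB_measure T \<mu>"
  shows "computable_measure \<mu>"
proof -
  have \<mu>: "borel_prob_I \<mu>" "invariant_measure T \<mu>" "absolutely_continuous lebesgue_I \<mu>"
    using assms(4) unfolding SRB_measure_def ergodic_acip_def ergodic_measure_def by auto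
  obtain q where q: "\<And>n A. A \<in> sets lebesgue_I \<Longrightarrow>
      \<bar>measure \<mu> A - measure lebesgue_I ((T ^^ (q * n)) -` A \<inter> {0..1})\<bar> \<le> 1 / 2 ^ n"
    and Tm: "T \<in> measurable lebesgue_I lebesgue_I"
    and Tnull: "\<forall>A\<in>null_sets lebesgue_I. T -` A \<inter> {0..1} \<in> null_sets lebesgue_I"
    using srb_equidistribution[OF assms(1,3) \<mu>] by metis
  obtain E U where E: "emeasure lebesgue_I E = 1" "\<And>i. T -` ideal_ball i \<inter> E = U i \<inter> E"
    and U: "uniformly_constructive_open U"
    using assms(2) unfolding ae_computable_def by blast
  obtain \<phi> where \<phi>: "partial_recursive 2 \<phi>" "\<And>i. U i = \<Union> {ideal_ball k | k. \<exists>n. \<phi> [i, n] = Some k}"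
    using U unfolding uniformly_constructive_open_def by blast
  define R where "R = {(i, k). \<exists>n. \<phi> [i, n] = Some k}"
  have "AE x in lebesgue_I. x \<in> E"
    by (rule lebI.AE_prob_1) (simp add: measure_def E(1))
  moreover have "T -` ideal_ball i \<inter> E = (\<Union>k\<in>R `` {i}. ideal_ball k) \<inter> E" for i
  proof -
    have "U i = (\<Union>k\<in>R `` {i}. ideal_ball k)" unfolding \<phi>(2) R_def by blast
    then show ?thesis using E(2) by simp
  qed
  ultimately have ball: "AE x in lebesgue_I. \<forall>i. (T ^^ N) x \<in> ideal_ball i \<longleftrightarrow>
      x \<in> (\<Union>l\<in>(R ^^ N) `` {i}. ideal_ball l)" for N
    by (rule iterate_ball_preimage[OF Tnull assms(1)])
  have TNm: "T ^^ N \<in> measurable lebesgue_I lebesgue_I" for N by (rule measurable_funpow[OF Tm])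
  define \<nu> where "\<nu> N = distr lebesgue_I lebesgue_I (T ^^ N)" for N
  have \<nu>: "measure (\<nu> N) A = measure lebesgue_I ((T ^^ N) -` A \<inter> {0..1})" if "A \<in> sets lebesgue_I" for N A
    unfolding \<nu>_def using measure_distr[OF TNm that] by (simp add: space_lebesgue_I)
  have \<nu>_prob: "prob_space (\<nu> N)" for N unfolding \<nu>_def by (rule lebI.prob_space_distr[OF TNm])
  have sets_\<nu>: "sets (\<nu> N) = sets lebesgue_I" for N by (simp add: \<nu>_def)
  have \<nu>_ball: "measure (\<nu> N) (ideal_ball i) = measure lebesgue_I (\<Union>l\<in>(R ^^ N) `` {i}. ideal_ball l)" for N i
    unfolding \<nu>[OF ideal_ball_sets]
  proof (rule lebI.finite_measure_eq_AE)
    show "AE x in lebesgue_I. x \<in> (T ^^ N) -` ideal_ball i \<inter> {0..1} \<longleftrightarrow> x \<in> (\<Union>l\<in>(R ^^ N) `` {i}. ideal_ball l)"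
      using ball[of N] AE_space by eventually_elim (auto simp: space_lebesgue_I)
    show "(T ^^ N) -` ideal_ball i \<inter> {0..1} \<in> sets lebesgue_I"
      using measurable_sets[OF TNm ideal_ball_sets] by (simp only: space_lebesgue_I)
  qed (rule balls_sets)
  \<comment> \<open>With \<open>M = 2 ^ Suc n\<close> cells and an excess of at most
    \<open>1 / (M * M)\<close> in each weight, the total excess is at most 1 / 2 ^ Suc n. The
    iterate \<open>q * Suc n\<close> is within the same distance of \<open>\<mu>\<close>, and both
    errors add up to 1 / 2 ^ n.\<close>
  define P where "P n a \<longleftrightarrow> (\<forall>j<2 ^ Suc n. certified R (q * Suc n) (2 ^ Suc n) a j (grid_ball (2 ^ Suc n) j))" for n a :: nat
  have sigP: "sig1 (\<lambda>e. P (e 0) (e (Suc 0)))"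
    unfolding P_def
    by (intro sig1_ball sig1_certified[OF sig1_enumerated[OF \<phi>(1), folded R_def]] rec_fun_mult rec_fun_power
        rec_fun_grid_ball rec_fun_const rec_fun_Suc rec_fun_var)
  have cell: "measure (\<nu> N) {real j / real M<..<real (Suc j) / real M} =
      measure lebesgue_I (\<Union>l\<in>(R ^^ N) `` {grid_ball M j}. ideal_ball l)" if "j < M" for N M j
    using \<nu>_ball[of N "grid_ball M j"] unfolding ideal_ball_grid[OF that] .
  \<comment> \<open>The open cells carry the whole mass 1, so the rounded masses can serve as
    weights; this makes the search halt.\<close>
  have total: "\<exists>a. P n a" for n
  proof -
    define M :: nat where "M = 2 ^ Suc n"
    have M: "M > 0" by (simp add: M_def)
    let ?G = "\<lambda>j. {real j / real M<..<real (Suc j) / real M}"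
    interpret nu: prob_space "\<nu> (q * Suc n)" by (rule \<nu>_prob)
    have Gs: "?G j \<in> sets lebesgue_I" if "j < M" for j
      using ideal_ball_sets[of "grid_ball M j"] unfolding ideal_ball_grid[OF that] .
    have "(\<Sum>j<M. measure (\<nu> (q * Suc n)) (?G j)) = measure (\<nu> (q * Suc n)) (\<Union>j<M. ?G j)"
    proof (rule nu.finite_measure_finite_Union[symmetric])
      show "?G ` {..<M} \<subseteq> nu.events" using Gs by (auto simp: sets_\<nu>)
      show "disjoint_family_on ?G {..<M}" by (rule open_grid_cells_disjoint)
    qed simp
    also have "\<dots> = 1"
    proof -
      \<comment> \<open>Only points whose image is a grid point escape the open cells; they form a
        null set by nonsingularity.\<close>
      let ?F = "(\<lambda>j. real j / real M) ` {..M}"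
      have "AE x in lebesgue_I. x \<notin> ?F" by (rule finite_null) simp
      from AE_pullback[OF Tnull assms(1) this, of "q * Suc n"]
      have "AE x in lebesgue_I. x \<in> (T ^^ (q * Suc n)) -` (\<Union>j<M. ?G j) \<inter> {0..1}"
        using AE_space
      proof eventually_elim
        case (elim x)
        define y where "y = (T ^^ (q * Suc n)) x"
        have y: "0 \<le> y" "y \<le> 1" "y \<notin> ?F"
          using elim funpow_unit_interval[OF assms(1), of "q * Suc n"] by (auto simp: y_def space_lebesgue_I)
        define j where "j = nat \<lfloor>y * real M\<rfloor>"
        have j: "real j \<le> y * real M" "y * real M < real (Suc j)"
          using y(1) unfolding j_def by (simp_all, linarith+)
        have "y \<noteq> 1" using y(3) M by force
        then have "y * real M < real M" using y(2) M by simp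
        then have jM: "j < M" using j(1) by linarith
        have "y \<noteq> real j / real M" using y(3) jM by auto
        moreover have "real j / real M \<le> y" using j(1) M by (simp add: pos_divide_le_eq)
        moreover have "y < real (Suc j) / real M" using j(2) M by (subst pos_less_divide_eq) simp_all
        ultimately have "y \<in> ?G j" unfolding greaterThanLessThan_iff by linarith
        then show ?case using jM elim unfolding y_def by (auto simp: space_lebesgue_I)
      qed
      moreover have "(\<Union>j<M. ?G j) \<in> sets lebesgue_I" using Gs by auto
      ultimately show ?thesis
        unfolding \<nu>[OF \<open>(\<Union>j<M. ?G j) \<in> sets lebesgue_I\<close>]
        using measurable_sets[OF TNm \<open>(\<Union>j<M. ?G j) \<in> sets lebesgue_I\<close>]
        by (subst lebI.prob_eq_1) (auto simp: space_lebesgue_I)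
    qed
    finally have sum: "(\<Sum>j<M. measure (\<nu> (q * Suc n)) (?G j)) = 1" .
    obtain a where "\<And>j. j < M \<Longrightarrow> real (Suc (seq_nth a j)) / real (weight_sum M a) < measure (\<nu> (q * Suc n)) (?G j) + 1 / real (M * M)"
      using grid_weights_exist[OF M _ sum, of "1 / real (M * M)"] M by auto
    then show ?thesis unfolding P_def M_def[symmetric] certified_iff[OF M] using cell by auto
  qed
  have "rec_fun (\<lambda>e. grid_code (2 ^ Suc (e 0)) (e (Suc 0)))"
    by (intro rec_fun_grid_code rec_fun_power rec_fun_const rec_fun_Suc rec_fun_var)
  from sig1_uniformize[where P = P and h = "\<lambda>n a. grid_code (2 ^ Suc n) a", OF sigP total this]
  obtain \<psi> where \<psi>: "partial_recursive 1 \<psi>" "\<And>n. \<exists>a. P n a \<and> \<psi> [n] = Some (grid_code (2 ^ Suc n) a)"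
    by blast
  have "\<exists>c. \<psi> [n] = Some c \<and> pmf_of_list_wf (weighted_points c) \<and> prokhorov (ideal_measure c) \<mu> \<le> 1 / 2 ^ n" for n
  proof -
    obtain a where a: "P n a" "\<psi> [n] = Some (grid_code (2 ^ Suc n) a)" using \<psi>(2) by blast
    define M :: nat where "M = 2 ^ Suc n"
    have M: "M > 0" by (simp add: M_def)
    have "prokhorov (ideal_measure (grid_code M a)) \<mu> \<le> 1 / 2 ^ n"
    proof (rule prokhorov_grid_code[OF M \<mu>(1)])
      show "real (Suc (seq_nth a j)) / real (weight_sum M a) \<le>
         measure (\<nu> (q * Suc n)) {real j / real M<..<real (Suc j) / real M} + 1 / real (M * M)" if "j < M" for j
        using a(1) that cell[OF that, of "q * Suc n"] unfolding P_def M_def[symmetric] certified_iff[OF M] by force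
      show "finite_measure (\<nu> (q * Suc n))" using \<nu>_prob prob_space_def by blast
      show "sets (\<nu> (q * Suc n)) = sets borel_I" unfolding sets_\<nu> by (rule sets_lebesgue_I_eq)
      show "\<bar>measure \<mu> A - measure (\<nu> (q * Suc n)) A\<bar> \<le> 1 / 2 ^ Suc n" if "A \<in> sets borel_I" for A
      proof -
        have A: "A \<in> sets lebesgue_I" using that by (simp only: sets_lebesgue_I_eq)
        show ?thesis using q[OF A, of "Suc n"] unfolding \<nu>[OF A] .
      qed
      show "real M * (1 / real (M * M)) + 1 / 2 ^ Suc n \<le> 1 / 2 ^ n" by (simp add: M_def field_simps)
      show "1 / real M \<le> 1 / 2 ^ n" by (simp add: M_def field_simps)
    qed simp
    then show ?thesis using a(2) grid_code_wf[OF M] unfolding M_def by blast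
  qed
  then show ?thesis unfolding computable_measure_def using \<mu>(1) \<psi>(1) by blast
qed

end
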